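(* Let $K$ be a field of positive characteristic, $S=K[x_1,\ldots,x_N]$, and let $I\subseteq S$ be a nonzero proper ideal satisfying condition ($\diamond+$). Then $I$ has floating test ideals. In other words, $$\tau(\lambda\bullet I)=\bigcap_{\mathfrak{p}\in\overline{\mathrm{StAss}}(I)}\mathfrak{p}^{(\lfloor\lambda e_{\mathfrak{p}}(I)\rfloor+1-\operatorname{ht}(\mathfrak{p}))}\qquad\text{for all }\lambda\in\mathbb{R}_{>0}.$$ In particular (independently of the characteristic), $$\operatorname{fpt}(I)=\min_{\mathfrak{p}\in\overline{\mathrm{StAss}}(I)}\frac{\operatorname{ht}(\mathfrak{p})}{e_{\mathfrak{p}}(I)}.$$
   Context: For a prime $\mathfrak{p}$ of $S$, $\mathfrak{p}^{(\ell)}=\mathfrak{p}^\ell S_{\mathfrak{p}}\cap S$ is the $\ell$-th symbolic power for $\ell\ge1$, and $\mathfrak{p}^{(\ell)}=S$ for $\ell\le0$. Set $e_{\mathfrak{p}}(I)=\max\{\ell:I\subseteq\mathfrak{p}^{(\ell)}\}$. $\overline{J}$ denotes integral closure of an ideal $J$, $\mathrm{Ass}(J)$ means the set of associated primes of $S/J$, and $\overline{\mathrm{StAss}}(I)=\bigcup_{s\in\mathbb{Z}_{>0}}\mathrm{Ass}(\overline{I^s})$ (a finite set). Condition ($\diamond$): there exist functions $g_{I;\mathfrak{p}}:\mathbb{N}\to\mathbb{N}$ (for $\mathfrak{p}\in\overline{\mathrm{StAss}}(I)$) such that $\overline{I^s}=\bigcap_{\mathfrak{p}\in\overline{\mathrm{StAss}}(I)}\mathfrak{p}^{(g_{I;\mathfrak{p}}(s))}$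 for all $s\gg0$. Condition ($\diamond+$): $I$ satisfies ($\diamond$) and there exist a term ordering $\prec$ on $S$ and a polynomial $F\in S$ such that (i) the initial monomial $\operatorname{in}_\prec(F)$ is square-free, and (ii) $F\in\mathfrak{p}^{(\operatorname{ht}(\mathfrak{p}))}$ for all $\mathfrak{p}\in\overline{\mathrm{StAss}}(I)$. Test ideals: let $p=\operatorname{char}(K)$. For $q=p^e$ and an ideal $J$, $J^{[q]}=(f^q:f\in J)$, and $J^{[1/q]}$ is the smallest ideal $L\subseteq S$ with $J\subseteq L^{[q]}$. For $\lambda\in\mathbb{R}_{>0}$, $\tau(\lambda\bullet I)=\bigcup_{e>0}\big(I^{\lceil\lambda p^e\rceil}\big)^{[1/p^e]}$ (an increasing union). $\operatorname{fpt}(I)=\min\{\lambda\in\mathbb{R}_{>0}:\tau(\lambda\bullet I)\ne S\}$. $I$ has floating test ideals if $\tau(\lambda\bullet I)=\bigcap_{\mathfrak{p}\in\operatorname{Spec}(S),\,\mathfrak{p}\supseteq I}\mathfrak{p}^{(\lfloor\lambda e_{\mathfrak{p}}(I)\rfloor+1-\operatorname{ht}(\mathfrak{p}))}$ for all $\lambda\in\mathbb{R}_{>0}$. *)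

theory Defs
  imports
    "HOL-Algebra.QuotRing"
    "HOL-Algebra.Ideal_Product"
    "HOL-Decision_Procs.Algebra_Aux"
    "HOL-Library.Poly_Mapping"
    Complex_Main
    "HOL-Computational_Algebra.Fraction_Field"
begin

text \<open>
  The polynomial ring $K[x_1,\ldots,x_N]$ is the type of finitely supported functions from
  exponent vectors to \<open>'k\<close>, with variables indexed by a finite type \<open>'n\<close>, $N =$ \<open>CARD('n)\<close>.
  The linear order on \<open>'n\<close> is only there because the library instance making this type an
  integral domain asks for it; it is unrelated to the term orders below.
  The ideal theory of \<^theory>\<open>HOL-Algebra.Ideal\<close> is applied to the ring
  \<^const>\<open>cring_class_ops\<close>, whose carrier is the whole type.
\<close>

type_synonym ('n, 'k) mpoly = "('n \<Rightarrow>\<^sub>0 nat) \<Rightarrow>\<^sub>0 'k"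

abbreviation is_ideal :: "'a::comm_ring_1 set \<Rightarrow> bool" where
  "is_ideal I \<equiv> ideal I cring_class_ops"

abbreviation ideal_power :: "'a::comm_ring_1 set \<Rightarrow> nat \<Rightarrow> 'a set" where
  "ideal_power I n \<equiv> I [^]\<^bsub>ideals_set cring_class_ops\<^esub> n"

definition Spec :: "'a::comm_ring_1 set set" where
  "Spec = {P. primeideal P cring_class_ops}"

text \<open>The supremum in \<^typ>\<open>nat\<close> is the intended one only for primes of finite height; this covers
  all primes of a polynomial ring in finitely many variables over a field.\<close>

definition height :: "'a::comm_ring_1 set \<Rightarrow> nat" where
  "height P = Sup {n. \<exists>c. (\<forall>i\<le>n. c i \<in> Spec) \<and> (\<forall>i<n. c i \<subset> c (Suc i)) \<and> c n = P}"

text \<open>The localization $S_P$, as a subring of the field of fractions.\<close>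

definition localization :: "'a::idom set \<Rightarrow> 'a fract ring" where
  "localization P = cring_class_ops\<lparr>carrier := {Fract a s |a s. s \<notin> P}\<rparr>"

text \<open>For positive exponent this is $P^l S_P \cap S$.\<close>

definition symbolic_power :: "'a::idom set \<Rightarrow> int \<Rightarrow> 'a set" where
  "symbolic_power P l =
    (if l \<le> 0 then UNIV
     else {f. Fract f 1 \<in> Idl\<^bsub>localization P\<^esub> ((\<lambda>a. Fract a 1) ` ideal_power P (nat l))})"

text \<open>The number $e_P(I)$.\<close>

definition symbolic_order :: "'a::idom set \<Rightarrow> 'a set \<Rightarrow> int" where
  "symbolic_order P I = (GREATEST l. I \<subseteq> symbolic_power P l)"

definition integral_closure :: "'a::comm_ring_1 set \<Rightarrow> 'a set" where
  "integral_closure J =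
    {f. \<exists>n>0. \<exists>a. (\<forall>i\<in>{1..n}. a i \<in> ideal_power J i) \<and> f ^ n + (\<Sum>i=1..n. a i * f ^ (n - i)) = 0}"

text \<open>Primes that are annihilators of an element of the module $S/J$.\<close>

definition Ass :: "'a::comm_ring_1 set \<Rightarrow> 'a set set" where
  "Ass J = {P \<in> Spec. \<exists>x\<in>carrier (cring_class_ops Quot J).
      P = {r. (J +>\<^bsub>cring_class_ops\<^esub> r) \<otimes>\<^bsub>cring_class_ops Quot J\<^esub> x = \<zero>\<^bsub>cring_class_ops Quot J\<^esub>}}"

definition StAss :: "'a::comm_ring_1 set \<Rightarrow> 'a set set" where
  "StAss I = (\<Union>s\<in>{1..}. Ass (integral_closure (ideal_power I s)))"

definition diamond :: "'a::idom set \<Rightarrow> bool" where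
  "diamond I \<longleftrightarrow> (\<exists>g :: 'a set \<Rightarrow> nat \<Rightarrow> nat. \<forall>\<^sub>F s in sequentially.
     integral_closure (ideal_power I s) = (\<Inter>P\<in>StAss I. symbolic_power P (int (g P s))))"

text \<open>In a pair \<open>(m, m') \<in> r\<close>, the monomial \<open>m\<close> is the smaller one. No well-foundedness is required:
  for finitely many variables it follows from the other conditions.\<close>

definition term_order :: "(('n \<Rightarrow>\<^sub>0 nat) \<times> ('n \<Rightarrow>\<^sub>0 nat)) set \<Rightarrow> bool" where
  "term_order r \<longleftrightarrow> linear_order r \<and> (\<forall>m. (0, m) \<in> r) \<and>
     (\<forall>m m' t. (m, m') \<in> r \<longrightarrow> (m + t, m' + t) \<in> r)"

text \<open>Meaningful for nonzero \<open>F\<close> only.\<close>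

definition initial_monomial ::
    "(('n \<Rightarrow>\<^sub>0 nat) \<times> ('n \<Rightarrow>\<^sub>0 nat)) set \<Rightarrow> ('n, 'k::zero) mpoly \<Rightarrow> ('n \<Rightarrow>\<^sub>0 nat)" where
  "initial_monomial r F =
    (THE m. m \<in> Poly_Mapping.keys F \<and> (\<forall>m'\<in>Poly_Mapping.keys F. (m', m) \<in> r))"

definition squarefree_monomial :: "('n \<Rightarrow>\<^sub>0 nat) \<Rightarrow> bool" where
  "squarefree_monomial m \<longleftrightarrow> (\<forall>i. Poly_Mapping.lookup m i \<le> 1)"

definition diamond_plus :: "('n::{finite,linorder}, 'k::field) mpoly set \<Rightarrow> bool" where
  "diamond_plus I \<longleftrightarrow> diamond I \<and>
    (\<exists>r F. term_order r \<and> F \<noteq> 0 \<and> squarefree_monomial (initial_monomial r F) \<and>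
       (\<forall>P\<in>StAss I. F \<in> symbolic_power P (int (height P))))"

definition frobenius_power :: "nat \<Rightarrow> 'a::comm_ring_1 set \<Rightarrow> 'a set" where
  "frobenius_power q J = Idl\<^bsub>cring_class_ops\<^esub> {f ^ q |f. f \<in> J}"

text \<open>The ideal $J^{[1/q]}$.\<close>

definition frobenius_root :: "nat \<Rightarrow> 'a::comm_ring_1 set \<Rightarrow> 'a set" where
  "frobenius_root q J = (LEAST L. is_ideal L \<and> J \<subseteq> frobenius_power q L)"

definition test_ideal :: "real \<Rightarrow> ('n::{finite,linorder}, 'k::field) mpoly set \<Rightarrow> ('n, 'k) mpoly set" where
  "test_ideal c I =
    (\<Union>e\<in>{1..}. frobenius_root (CHAR('k) ^ e) (ideal_power I (nat \<lceil>c * real (CHAR('k) ^ e)\<rceil>)))"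

definition fpt :: "('n::{finite,linorder}, 'k::field) mpoly set \<Rightarrow> real" where
  "fpt I = (LEAST c. 0 < c \<and> test_ideal c I \<noteq> UNIV)"

definition floating_test_ideals :: "('n::{finite,linorder}, 'k::field) mpoly set \<Rightarrow> bool" where
  "floating_test_ideals I \<longleftrightarrow> (\<forall>c>0. test_ideal c I =
     (\<Inter>P\<in>{P \<in> Spec. I \<subseteq> P}.
        symbolic_power P (\<lfloor>c * real_of_int (symbolic_order P I)\<rfloor> + 1 - int (height P))))"

end

(*
  A Frobenius power L^[q] of an ideal of S is detected by coordinates: S is free over S^q, with basis
  the products of a K^q-basis of K and the monomials with exponents below q. Hence Frobenius powers
  commute with intersections and colons.

  Test ideals lie in the symbolic powers: a prime P of height h is, locally at P, generated by at
  most h elements, so the pigeonhole principle puts P^(n) into (P^(k))^[q] as soon as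
  n + q > kq + h(q - 1).

  For the converse let f lie in all the symbolic powers on the right-hand side. Order at P is a
  valuation (at least on powers of one element, by an argument of Lech on minimal generators), so
  I^s is not in P^(l) for l > s e_P(I), and condition (diamond) makes the integral closure of I^s
  contain the intersection of the P^(s e_P(I)) for large s. Therefore f^q F^(q-1) lies in the
  integral closure of I^s with s = ceil(c q) + l, l the number of generators of I, hence in
  I^ceil(c q) by a tight closure argument. So F^(q-1) lies in (tau : f)^[q], and since the initial
  monomial of F^(q-1) has exponents below q, tau : f contains a unit.

  Finiteness of StAss(I) comes from F as well: all its members satisfy F^(q-1) P <= P^[q], which
  forces their initial ideals, and those of their intersections, to be squarefree.
*)
theory Submission
  imports Defs "HOL-Computational_Algebra.Polynomial" "HOL-Computational_Algebra.Primes"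
begin

section \<open>Ideals of the full ring\<close>

text \<open>No local ring is studied as such: a statement about S_P is phrased through
  \<open>sat P J\<close>, the contraction of J S_P, and minimal generators of P S_P are a locally
  generating set of least cardinality. The obstacle is that multiplicativity of the order at P rests
  on regularity of S_P, which enters here only through Frobenius: flatness makes the q-th powers of
  minimal generators independent in Lech's sense, so the product of all y^(q-1) avoids the ideal of
  the y^q. This is enough to see that x^q has order exactly q times that of x.

  \<open>height\<close> is a supremum of naturals, so it dominates the number of local generators
  only once chains of primes are known to be bounded. Both facts come from adjoining the variables
  one at a time and extending P \<inter> K[V] back to S.

  All room in the estimates comes from \<lfloor>c d\<rfloor> + 1 > c d: multiplied by q, the gap
  outgrows the errors height P and (l + 1) d, which do not depend on q. The l generators are the
  loss in passing from the integral closure of I^(k + l) to I^k, a bound of Briancon-Skoda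
  type.\<close>

lemma is_ideal_iff:
  "is_ideal I \<longleftrightarrow> 0 \<in> I \<and> (\<forall>x\<in>I. \<forall>y\<in>I. x + y \<in> I) \<and> (\<forall>c. \<forall>x\<in>I. c * x \<in> I)"
  for I :: "'a::comm_ring_1 set"
proof
  assume I: "is_ideal I"
  interpret ideal I cring_class_ops by (rule I)
  show "0 \<in> I \<and> (\<forall>x\<in>I. \<forall>y\<in>I. x + y \<in> I) \<and> (\<forall>c. \<forall>x\<in>I. c * x \<in> I)"
    using zero_closed a_closed I_l_closed
    by (auto simp: zero_class plus_class times_class carrier_class)
next
  assume *: "0 \<in> I \<and> (\<forall>x\<in>I. \<forall>y\<in>I. x + y \<in> I) \<and> (\<forall>c. \<forall>x\<in>I. c * x \<in> I)"
  have neg: "- x \<in> I" if "x \<in> I" for x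
    using * that by (metis mult_minus1)
  have inv: "inv\<^bsub>add_monoid cring_class_ops\<^esub> x \<in> I" if "x \<in> I" for x
    using neg[OF that] uminus_class[of x] by (simp only: a_inv_def)
  have ab: "abelian_group (cring_class_ops :: 'a ring)"
    using cring_class.abelian_group_axioms .
  show "is_ideal I"
  proof (rule idealI)
    show "ring (cring_class_ops :: 'a ring)" using cring_class.ring_axioms .
    show "subgroup I (add_monoid cring_class_ops)"
    proof (rule group.subgroupI[OF abelian_group.a_group[OF ab]])
      show "inv\<^bsub>add_monoid cring_class_ops\<^esub> a \<in> I" if "a \<in> I" for a
        using that by (rule inv)
    qed (use * in \<open>auto simp: plus_class carrier_class\<close>)
  qed (metis * times_class mult.commute)+
qed

lemma is_idealI:
  assumes "0 \<in> I" "\<And>x y. x \<in> I \<Longrightarrow> y \<in> I \<Longrightarrow> x + y \<in> I" "\<And>c x. x \<in> I \<Longrightarrow> c * x \<in> I"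
  shows "is_ideal I"
  using assms by (auto simp: is_ideal_iff)

lemma ideal_zero: "is_ideal I \<Longrightarrow> 0 \<in> I"
  and ideal_add: "is_ideal I \<Longrightarrow> x \<in> I \<Longrightarrow> y \<in> I \<Longrightarrow> x + y \<in> I"
  and ideal_mult: "is_ideal I \<Longrightarrow> x \<in> I \<Longrightarrow> c * x \<in> I"
  by (auto simp: is_ideal_iff)

lemma ideal_mult_right: "is_ideal I \<Longrightarrow> x \<in> I \<Longrightarrow> x * c \<in> I"
  by (metis ideal_mult mult.commute)

lemma ideal_uminus: "is_ideal I \<Longrightarrow> x \<in> I \<Longrightarrow> - x \<in> I"
  by (metis ideal_mult mult_minus1)

lemma ideal_diff: "is_ideal I \<Longrightarrow> x \<in> I \<Longrightarrow> y \<in> I \<Longrightarrow> x - y \<in> I"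
  by (metis ideal_add ideal_uminus diff_conv_add_uminus)

lemma ideal_sum: "is_ideal I \<Longrightarrow> (\<And>i. i \<in> A \<Longrightarrow> f i \<in> I) \<Longrightarrow> sum f A \<in> I"
  by (induction A rule: infinite_finite_induct) (auto intro: ideal_zero ideal_add)

lemma ideal_UNIV: "is_ideal UNIV"
  by (auto simp: is_ideal_iff)

lemma ideal_eq_UNIV_iff: "is_ideal I \<Longrightarrow> I = UNIV \<longleftrightarrow> 1 \<in> I"
  by (metis UNIV_I UNIV_eq_I ideal_mult mult.right_neutral)

lemma ideal_Inter: "(\<And>I. I \<in> \<I> \<Longrightarrow> is_ideal I) \<Longrightarrow> is_ideal (\<Inter>\<I>)"
  unfolding is_ideal_iff by blast

declare nat_pow_0 [simp del] nat_pow_Suc [simp del]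

abbreviation idl :: "'a::comm_ring_1 set \<Rightarrow> 'a set" where
  "idl X \<equiv> Idl\<^bsub>cring_class_ops\<^esub> X"

lemma idl_ideal: "is_ideal (idl X)"
  by (rule ring.genideal_ideal[OF cring_class.ring_axioms]) (auto simp: carrier_class)

lemma idl_superset: "X \<subseteq> idl X"
  by (rule ring.genideal_self[OF cring_class.ring_axioms]) (auto simp: carrier_class)

lemma idl_base: "x \<in> X \<Longrightarrow> x \<in> idl X"
  using idl_superset by blast

lemma idl_minimal: "is_ideal I \<Longrightarrow> X \<subseteq> I \<Longrightarrow> idl X \<subseteq> I"
  by (rule ring.genideal_minimal[OF cring_class.ring_axioms])

lemma idl_mono: "X \<subseteq> Y \<Longrightarrow> idl X \<subseteq> idl Y"
  by (meson idl_ideal idl_minimal idl_superset order_trans)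

lemma idl_image_explicit:
  assumes "finite A"
  shows "idl (f ` A) = {\<Sum>a\<in>A. r a * f a |r. True}"
proof
  let ?S = "{\<Sum>a\<in>A. r a * f a |r. True}"
  have "is_ideal ?S"
  proof (rule is_idealI)
    show "0 \<in> ?S" by (rule CollectI, rule exI[of _ "\<lambda>_. 0"]) simp
  next
    fix x y assume "x \<in> ?S" "y \<in> ?S"
    then obtain r s where "x = (\<Sum>a\<in>A. r a * f a)" "y = (\<Sum>a\<in>A. s a * f a)" by blast
    then show "x + y \<in> ?S"
      by (intro CollectI exI[of _ "\<lambda>a. r a + s a"]) (simp add: sum.distrib distrib_right)
  next
    fix c x assume "x \<in> ?S"
    then obtain r where "x = (\<Sum>a\<in>A. r a * f a)" by blast
    then show "c * x \<in> ?S"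
      by (intro CollectI exI[of _ "\<lambda>a. c * r a"]) (simp add: sum_distrib_left mult.assoc)
  qed
  moreover have "f ` A \<subseteq> ?S"
  proof clarify
    fix a assume "a \<in> A"
    then have "(\<Sum>b\<in>A. (if b = a then 1 else 0) * f b) = f a"
      using assms by (subst sum.remove[of _ a]) (auto intro!: sum.neutral)
    then show "\<exists>r. f a = (\<Sum>b\<in>A. r b * f b) \<and> True"
      by (intro exI[of _ "\<lambda>b. if b = a then 1 else 0"]) simp
  qed
  ultimately show "idl (f ` A) \<subseteq> ?S" by (rule idl_minimal)
  show "?S \<subseteq> idl (f ` A)"
    by (auto intro!: ideal_sum[OF idl_ideal] ideal_mult[OF idl_ideal]
        intro: idl_base)
qed

lemma idl_finite_explicit:
  assumes "finite A"
  shows "idl A = {\<Sum>a\<in>A. r a * a |r. True}"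
  using idl_image_explicit[OF assms, of "\<lambda>a. a"] by simp

section \<open>Powers of an ideal\<close>

lemma ideal_power_0: "ideal_power I 0 = UNIV"
  by (simp add: nat_pow_def ideals_set_def cring_class_ops_def)

lemma ideal_power_Suc:
  "ideal_power I (Suc n) = ideal_prod cring_class_ops (ideal_power I n) I"
  by (simp add: nat_pow_def ideals_set_def)

lemma ideal_power_ideal:
  assumes "is_ideal I" shows "is_ideal (ideal_power I n)"
proof (induction n)
  case 0 then show ?case by (simp add: ideal_power_0 ideal_UNIV)
next
  case (Suc n) then show ?case
    using assms by (simp add: ideal_power_Suc ring.ideal_prod_is_ideal[OF cring_class.ring_axioms])
qed

lemma ideal_power_Suc_span:
  assumes "is_ideal I"
  shows "ideal_power I (Suc n) = idl {a * b |a b. a \<in> ideal_power I n \<and> b \<in> I}" (is "_ = idl ?X")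
proof
  have "x \<in> idl ?X" if "x \<in> ideal_prod cring_class_ops (ideal_power I n) I" for x
    using that
    by (induction rule: ideal_prod.induct)
       (auto simp: times_class plus_class intro: idl_base ideal_add[OF idl_ideal])
  then show "ideal_power I (Suc n) \<subseteq> idl ?X" by (auto simp: ideal_power_Suc)
  have "a * b \<in> ideal_prod cring_class_ops (ideal_power I n) I"
    if "a \<in> ideal_power I n" "b \<in> I" for a b
    using ideal_prod.prod[OF that, of cring_class_ops] by (simp add: times_class)
  then show "idl ?X \<subseteq> ideal_power I (Suc n)"
    by (intro idl_minimal ideal_power_ideal assms) (auto simp: ideal_power_Suc)
qed

lemma ideal_power_mult_Suc:
  "is_ideal I \<Longrightarrow> a \<in> ideal_power I n \<Longrightarrow> b \<in> I \<Longrightarrow> a * b \<in> ideal_power I (Suc n)"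
  by (auto simp: ideal_power_Suc_span intro: idl_base)

lemma ideal_power_subsetI:
  assumes "is_ideal I" "is_ideal J"
    and "\<And>a b. a \<in> ideal_power I n \<Longrightarrow> b \<in> I \<Longrightarrow> a * b \<in> J"
  shows "ideal_power I (Suc n) \<subseteq> J"
  unfolding ideal_power_Suc_span[OF assms(1)] using assms by (intro idl_minimal) auto

text \<open>The colon ideal (J : f). To show that a whole span multiplies f into J, it is enough to
  test generators, because the good elements form this ideal; products of spans are handled this way
  throughout.\<close>

lemma ideal_colon: "is_ideal J \<Longrightarrow> is_ideal {x. x * f \<in> J}"
  by (auto simp: is_ideal_iff distrib_right mult.assoc)

lemma ideal_power_mult:
  assumes I: "is_ideal I" and "a \<in> ideal_power I m" "b \<in> ideal_power I n"
  shows "a * b \<in> ideal_power I (m + n)"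
  using assms(3)
proof (induction n arbitrary: b)
  case 0
  then show ?case using assms by (auto intro: ideal_mult_right ideal_power_ideal)
next
  case (Suc n)
  have "ideal_power I (Suc n) \<subseteq> {x. x * a \<in> ideal_power I (m + Suc n)}"
  proof (rule ideal_power_subsetI[OF I])
    fix c d assume "c \<in> ideal_power I n" "d \<in> I"
    with Suc.IH[of c] have "a * c * d \<in> ideal_power I (Suc (m + n))"
      by (intro ideal_power_mult_Suc I)
    then show "c * d \<in> {x. x * a \<in> ideal_power I (m + Suc n)}"
      by (simp add: mult_ac)
  qed (intro ideal_colon ideal_power_ideal I)
  with Suc.prems show ?case by (auto simp: mult.commute)
qed

lemma ideal_power_antimono:
  assumes I: "is_ideal I" and "m \<le> n" shows "ideal_power I n \<subseteq> ideal_power I m"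
  using assms(2)
proof (induction rule: dec_induct)
  case (step n)
  have "ideal_power I (Suc n) \<subseteq> ideal_power I n"
    by (rule ideal_power_subsetI[OF I]) (auto intro: ideal_power_ideal I ideal_mult_right)
  with step show ?case by blast
qed simp

lemma ideal_power_1:
  assumes "is_ideal I" shows "ideal_power I 1 = I"
proof
  show "ideal_power I 1 \<subseteq> I"
    using ideal_power_subsetI[OF assms assms, of 0] by (simp add: assms ideal_mult)
  show "I \<subseteq> ideal_power I 1"
    using ideal_power_mult_Suc[OF assms, of 1 0] by (auto simp: ideal_power_0)
qed

lemma ideal_power_power:
  assumes "is_ideal I" "a \<in> ideal_power I m" shows "a ^ n \<in> ideal_power I (n * m)"
proof (induction n)
  case (Suc n) then show ?case using ideal_power_mult[OF assms(1,2) Suc] by simp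
qed (simp add: ideal_power_0)

lemma ideal_power_mono:
  assumes "is_ideal I" "is_ideal J" "I \<subseteq> J" shows "ideal_power I n \<subseteq> ideal_power J n"
proof (induction n)
  case (Suc n)
  then show ?case using assms
    by (intro ideal_power_subsetI) (auto intro: ideal_power_mult_Suc ideal_power_ideal)
qed (simp add: ideal_power_0)

lemma ideal_power_ideal_power:
  assumes "is_ideal I" shows "ideal_power (ideal_power I m) n = ideal_power I (m * n)"
proof
  note J = ideal_power_ideal[OF assms]
  show "ideal_power (ideal_power I m) n \<subseteq> ideal_power I (m * n)"
  proof (induction n)
    case (Suc n)
    show ?case
      by (rule ideal_power_subsetI[OF J J])
         (use Suc ideal_power_mult[OF assms] in \<open>force simp: add.commute\<close>)
  qed (simp add: ideal_power_0)
  show "ideal_power I (m * n) \<subseteq> ideal_power (ideal_power I m) n"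
  proof (induction n)
    case (Suc n)
    \<comment> \<open>Factors of I are split off one at a time, for every k; the case k = m is the
      induction step in n.\<close>
    have "ideal_power I (k + m * n) \<subseteq> idl {a * b |a b. a \<in> ideal_power I k \<and> b \<in> ideal_power I (m * n)}"
      (is "_ \<subseteq> ?S k") for k
    proof (induction k)
      case 0 then show ?case by (auto simp: ideal_power_0 intro!: idl_base) (metis mult.left_neutral)
    next
      case (Suc k)
      have "ideal_power I (Suc (k + m * n)) \<subseteq> ?S (Suc k)"
      proof (rule ideal_power_subsetI[OF assms idl_ideal])
        fix x b assume x: "x \<in> ideal_power I (k + m * n)" and b: "b \<in> I"
        have "?S k \<subseteq> {x. x * b \<in> ?S (Suc k)}"
        proof (intro idl_minimal ideal_colon idl_ideal subsetI, clarify)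
          fix c d assume "c \<in> ideal_power I k" "d \<in> ideal_power I (m * n)"
          then have "(c * b) * d \<in> ?S (Suc k)"
            using ideal_power_mult_Suc[OF assms _ b] by (intro idl_base) blast
          then show "c * d * b \<in> ?S (Suc k)" by (simp add: mult_ac)
        qed
        then show "x * b \<in> ?S (Suc k)" using Suc x by blast
      qed
      then show ?case by simp
    qed
    also have "?S m \<subseteq> ideal_power (ideal_power I m) (Suc n)"
      by (intro idl_minimal ideal_power_ideal J)
         (use Suc ideal_power_mult_Suc[OF J] in \<open>force simp: mult.commute\<close>)
    finally show ?case by simp
  qed (simp add: ideal_power_0)
qed

section \<open>Prime ideals\<close>

lemma SpecD:
  assumes "P \<in> Spec"
  shows "is_ideal P" "1 \<notin> P" "a * b \<in> P \<Longrightarrow> a \<in> P \<or> b \<in> P"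
proof -
  interpret primeideal P cring_class_ops using assms by (simp add: Spec_def)
  show I: "is_ideal P" by (rule is_ideal)
  show "a * b \<in> P \<Longrightarrow> a \<in> P \<or> b \<in> P"
    using I_prime[of a b] by (simp add: times_class carrier_class)
  have "P \<noteq> UNIV" using I_notcarr by (simp add: cring_class_ops_def)
  then show "1 \<notin> P" using ideal_eq_UNIV_iff[OF I] by blast
qed

lemma SpecI:
  fixes P :: "'a::comm_ring_1 set"
  assumes "is_ideal P" "1 \<notin> P" "\<And>a b. a * b \<in> P \<Longrightarrow> a \<in> P \<or> b \<in> P"
  shows "P \<in> Spec"
proof -
  have "primeideal P cring_class_ops"
    by (rule primeidealI) (use assms cring_class.is_cring in \<open>auto simp: cring_class_ops_def\<close>)
  then show ?thesis by (simp add: Spec_def)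
qed

lemma Spec_power: "P \<in> Spec \<Longrightarrow> a ^ n \<in> P \<Longrightarrow> a \<in> P"
  by (induction n) (auto dest: SpecD)

lemma Spec_prod: "finite A \<Longrightarrow> P \<in> Spec \<Longrightarrow> (\<And>i. i \<in> A \<Longrightarrow> f i \<notin> P) \<Longrightarrow> prod f A \<notin> P"
  by (induction A rule: finite_induct) (auto dest: SpecD(3) SpecD(2))

section \<open>Symbolic powers and Frobenius powers\<close>

text \<open>For a prime P this is J S_P \<inter> S with denominators cleared; local arguments are
  carried out with it inside S.\<close>

definition sat :: "'a::comm_ring_1 set \<Rightarrow> 'a set \<Rightarrow> 'a set" where
  "sat P J = {f. \<exists>s. s \<notin> P \<and> s * f \<in> J}"

lemma satI: "s \<notin> P \<Longrightarrow> s * f \<in> J \<Longrightarrow> f \<in> sat P J"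
  by (auto simp: sat_def)

lemma satE:
  assumes "f \<in> sat P J" obtains s where "s \<notin> P" "s * f \<in> J"
  using assms by (auto simp: sat_def)

lemma sat_superset: "P \<in> Spec \<Longrightarrow> J \<subseteq> sat P J"
  using SpecD(2) by (force intro: satI[of 1])

lemma sat_mono: "J \<subseteq> J' \<Longrightarrow> sat P J \<subseteq> sat P J'"
  by (auto simp: sat_def)

lemma sat_ideal:
  assumes P: "P \<in> Spec" and J: "is_ideal J" shows "is_ideal (sat P J)"
proof (rule is_idealI)
  show "0 \<in> sat P J" using sat_superset[OF P] ideal_zero[OF J] by blast
next
  fix x y assume "x \<in> sat P J" "y \<in> sat P J"
  then obtain s t where "s \<notin> P" "s * x \<in> J" "t \<notin> P" "t * y \<in> J" by (auto elim!: satE)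
  then have "t * (s * x) + s * (t * y) \<in> J" and st: "s * t \<notin> P"
    using SpecD(3)[OF P] by (blast intro: ideal_add[OF J] ideal_mult[OF J])+
  moreover have "t * (s * x) + s * (t * y) = s * t * (x + y)" by (simp add: algebra_simps)
  ultimately show "x + y \<in> sat P J" by (intro satI[OF st]) simp
next
  fix c x assume "x \<in> sat P J"
  then obtain s where "s \<notin> P" "s * x \<in> J" by (auto elim!: satE)
  then show "c * x \<in> sat P J"
    using ideal_mult[OF J, of "s * x" c] by (intro satI[of s]) (auto simp: mult.left_commute)
qed

lemma sat_cancel:
  assumes "P \<in> Spec" "s \<notin> P" "s * f \<in> sat P J" shows "f \<in> sat P J"
proof -
  obtain t where t: "t \<notin> P" "t * (s * f) \<in> J" using assms(3) by (elim satE)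
  then show ?thesis
    using SpecD(3)[OF assms(1)] assms(2) by (intro satI[of "t * s"]) (auto simp: mult.assoc)
qed

lemma sat_minimal:
  assumes "\<And>s f. s \<notin> P \<Longrightarrow> s * f \<in> L \<Longrightarrow> f \<in> L" "J \<subseteq> L" shows "sat P J \<subseteq> L"
  using assms by (auto simp: sat_def)

text \<open>The symbolic power at a natural exponent. By \<open>symbolic_power_eq\<close> it agrees
  with the fractional definition, every exponent \<le> 0 becoming 0.\<close>

definition sat_power :: "'a::comm_ring_1 set \<Rightarrow> nat \<Rightarrow> 'a set" where
  "sat_power P n = sat P (ideal_power P n)"

lemma sat_power_ideal: "P \<in> Spec \<Longrightarrow> is_ideal (sat_power P n)"
  by (simp add: sat_power_def sat_ideal SpecD(1) ideal_power_ideal)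

lemma sat_power_cancel: "P \<in> Spec \<Longrightarrow> s \<notin> P \<Longrightarrow> s * f \<in> sat_power P n \<Longrightarrow> f \<in> sat_power P n"
  unfolding sat_power_def by (rule sat_cancel)

lemma sat_power_0: "P \<in> Spec \<Longrightarrow> sat_power P 0 = UNIV"
  using sat_superset[of P UNIV] by (auto simp: sat_power_def ideal_power_0)

lemma sat_power_1:
  assumes "P \<in> Spec" shows "sat_power P 1 = P"
proof -
  have "sat_power P 1 = sat P P"
    using SpecD(1)[OF assms] unfolding sat_power_def by (simp only: ideal_power_1)
  also have "\<dots> = P"
    using sat_superset[OF assms, of P] SpecD(3)[OF assms] by (auto simp: sat_def)
  finally show ?thesis .
qed

lemma sat_power_antimono: "P \<in> Spec \<Longrightarrow> m \<le> n \<Longrightarrow> sat_power P n \<subseteq> sat_power P m"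
  unfolding sat_power_def by (intro sat_mono ideal_power_antimono SpecD(1))

lemma sat_power_mult:
  assumes P: "P \<in> Spec" and "a \<in> sat_power P m" "b \<in> sat_power P n"
  shows "a * b \<in> sat_power P (m + n)"
proof -
  obtain s t where "s \<notin> P" "s * a \<in> ideal_power P m" "t \<notin> P" "t * b \<in> ideal_power P n"
    using assms by (auto simp: sat_power_def elim!: satE)
  then show ?thesis unfolding sat_power_def
    using ideal_power_mult[OF SpecD(1)[OF P], of "s * a" m "t * b" n] SpecD(3)[OF P, of s t]
    by (intro satI[of "s * t"]) (auto simp: mult_ac)
qed

lemma sat_power_power:
  assumes "P \<in> Spec" "a \<in> sat_power P m" shows "a ^ n \<in> sat_power P (n * m)"
proof (induction n)
  case (Suc n) then show ?case using sat_power_mult[OF assms(1,2) Suc] by simp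
qed (simp add: sat_power_0 assms)

lemma ideal_power_subset_sat_power:
  assumes P: "P \<in> Spec" and I: "is_ideal I" "I \<subseteq> sat_power P m"
  shows "ideal_power I n \<subseteq> sat_power P (n * m)"
proof (induction n)
  case (Suc n)
  then show ?case using sat_power_mult[OF P, of _ "n * m" _ m] I
    by (intro ideal_power_subsetI[OF I(1) sat_power_ideal[OF P]]) (auto simp: add.commute)
qed (simp add: sat_power_0 P)

text \<open>The one contact with the field of fractions. The fractions with numerator in J and
  denominator outside P already form an ideal of S_P, so they are the extension of J, and
  contracting them to S gives the saturation.\<close>

lemma mem_Idl_localization_iff:
  fixes J :: "'a::idom set"
  assumes P: "P \<in> Spec" and J: "is_ideal J"
  shows "Fract f 1 \<in> Idl\<^bsub>localization P\<^esub> ((\<lambda>a. Fract a 1) ` J) \<longleftrightarrow> f \<in> sat P J"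
proof -
  let ?R = "localization P"
  have nz: "s \<noteq> 0" if "s \<notin> P" for s using that SpecD(1)[OF P] ideal_zero by blast
  have one: "1 \<notin> P" using SpecD[OF P] by auto
  have prod: "s * t \<notin> P" if "s \<notin> P" "t \<notin> P" for s t
    using that SpecD[OF P] by auto
  have carr: "carrier ?R = {Fract a s |a s. s \<notin> P}"
    by (simp add: localization_def)
  have ops: "\<zero>\<^bsub>?R\<^esub> = 0" "\<one>\<^bsub>?R\<^esub> = 1" "x \<oplus>\<^bsub>?R\<^esub> y = x + y" "x \<otimes>\<^bsub>?R\<^esub> y = x * y" for x y
    by (simp_all add: localization_def cring_class_ops_def)
  have add: "Fract a s + Fract b t = Fract (a * t + b * s) (s * t)" if "s \<notin> P" "t \<notin> P" for a b s t
    using that nz by simp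
  have closed: "0 \<in> carrier ?R" "1 \<in> carrier ?R"
    using one by (auto simp: carr Zero_fract_def One_fract_def)
  have closed2: "x + y \<in> carrier ?R" "x * y \<in> carrier ?R" "- x \<in> carrier ?R"
    if "x \<in> carrier ?R" "y \<in> carrier ?R" for x y
  proof -
    obtain a s b t where "x = Fract a s" "s \<notin> P" "y = Fract b t" "t \<notin> P"
      using \<open>x \<in> _\<close> \<open>y \<in> _\<close> unfolding carr by blast
    then show "x + y \<in> carrier ?R" "x * y \<in> carrier ?R" "- x \<in> carrier ?R"
      using add[of s t a b] prod[of s t] unfolding carr by (auto intro: exI[of _ "- a"])
  qed
  have ring: "ring ?R"
  proof (rule ringI)
    show "abelian_group ?R"
    proof (rule abelian_groupI)
      fix x assume "x \<in> carrier ?R"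
      then show "\<exists>y\<in>carrier ?R. y \<oplus>\<^bsub>?R\<^esub> x = \<zero>\<^bsub>?R\<^esub>"
        using closed2(3) by (intro bexI[of _ "- x"]) (simp_all add: ops)
    qed (simp_all add: ops closed closed2 add_ac)
    show "Group.monoid ?R"
      by (rule monoidI) (simp_all add: ops closed closed2 mult_ac)
  qed (simp_all add: ops algebra_simps)
  let ?T = "{Fract a s |a s. a \<in> J \<and> s \<notin> P}"
  have T: "ideal ?T ?R"
  proof (rule idealI[OF ring])
    have group: "group (add_monoid ?R)"
      by (rule abelian_group.a_group[OF ring.is_abelian_group[OF ring]])
    show "subgroup ?T (add_monoid ?R)"
    proof (rule group.subgroupI[OF group])
      show "?T \<subseteq> carrier (add_monoid ?R)" by (auto simp: carr)
      show "?T \<noteq> {}" using one ideal_zero[OF J] by blast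
    next
      fix x assume "x \<in> ?T"
      then obtain a s where as: "x = Fract a s" "a \<in> J" "s \<notin> P" by blast
      have "inv\<^bsub>add_monoid ?R\<^esub> x = Fract (- a) s"
        by (rule group.inv_equality[OF group]) (use as nz in \<open>auto simp: carr ops Zero_fract_def eq_fract\<close>)
      then show "inv\<^bsub>add_monoid ?R\<^esub> x \<in> ?T" using as ideal_uminus[OF J] by blast
    next
      fix x y assume "x \<in> ?T" "y \<in> ?T"
      then obtain a s b t where st: "x = Fract a s" "s \<notin> P" "a \<in> J" "y = Fract b t" "t \<notin> P" "b \<in> J"
        by blast
      then have "a * t + b * s \<in> J" using J by (intro ideal_add ideal_mult_right)
      then show "x \<otimes>\<^bsub>add_monoid ?R\<^esub> y \<in> ?T"
        using st add[of s t a b] prod[of s t] by (auto simp: ops)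
    qed
  next
    fix x y assume "x \<in> ?T" "y \<in> carrier ?R"
    then obtain a s b t where st: "x = Fract a s" "s \<notin> P" "a \<in> J" "y = Fract b t" "t \<notin> P"
      unfolding carr by blast
    then have "x * y = Fract (a * b) (s * t)" "y * x = Fract (a * b) (s * t)" "a * b \<in> J"
      using ideal_mult_right[OF J] by (auto simp: mult_ac)
    then show "y \<otimes>\<^bsub>?R\<^esub> x \<in> ?T" "x \<otimes>\<^bsub>?R\<^esub> y \<in> ?T"
      using st prod[of s t] by (auto simp: ops)
  qed
  show ?thesis
  proof
    assume "Fract f 1 \<in> Idl\<^bsub>?R\<^esub> ((\<lambda>a. Fract a 1) ` J)"
    moreover have "Idl\<^bsub>?R\<^esub> ((\<lambda>a. Fract a 1) ` J) \<subseteq> ?T"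
      by (rule ring.genideal_minimal[OF ring T]) (use one in auto)
    ultimately obtain a s where "Fract f 1 = Fract a s" "a \<in> J" "s \<notin> P" by blast
    then show "f \<in> sat P J" using nz[of s] by (auto simp: eq_fract mult.commute intro: satI[of s])
  next
    assume "f \<in> sat P J"
    then obtain s where s: "s \<notin> P" "s * f \<in> J" by (elim satE)
    have "Fract f 1 = Fract 1 s \<otimes>\<^bsub>?R\<^esub> Fract (s * f) 1"
      using nz[OF s(1)] by (simp add: ops eq_fract)
    moreover have "Fract 1 s \<in> carrier ?R" using s by (auto simp: carr)
    ultimately show "Fract f 1 \<in> Idl\<^bsub>?R\<^esub> ((\<lambda>a. Fract a 1) ` J)"
      using s(2) by (auto simp: genideal_def intro: ideal.I_l_closed)
  qed
qed

lemma symbolic_power_eq: "P \<in> Spec \<Longrightarrow> symbolic_power P l = sat_power P (nat l)"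
  unfolding symbolic_power_def
  by (simp only: mem_Idl_localization_iff ideal_power_ideal SpecD(1) Collect_mem_eq sat_power_def[symmetric])
     (simp add: sat_power_0)

section \<open>Frobenius powers and the pigeonhole containment\<close>

lemma frobenius_power_ideal: "is_ideal (frobenius_power q J)"
  unfolding frobenius_power_def by (rule idl_ideal)

lemma power_mem_frobenius_power: "f \<in> J \<Longrightarrow> f ^ q \<in> frobenius_power q J"
  unfolding frobenius_power_def by (rule idl_base) blast

lemma frobenius_power_minimal:
  "is_ideal L \<Longrightarrow> (\<And>f. f \<in> J \<Longrightarrow> f ^ q \<in> L) \<Longrightarrow> frobenius_power q J \<subseteq> L"
  unfolding frobenius_power_def by (rule idl_minimal) blast+

lemma frobenius_power_mono: "J \<subseteq> J' \<Longrightarrow> frobenius_power q J \<subseteq> frobenius_power q J'"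
  by (rule frobenius_power_minimal[OF frobenius_power_ideal]) (auto intro: power_mem_frobenius_power)

lemma prod_mem_ideal_power:
  assumes J: "is_ideal J" and "finite Y" "Y \<subseteq> J"
  shows "(\<Prod>y\<in>Y. y ^ b y) \<in> ideal_power J (\<Sum>y\<in>Y. b y)"
  using assms(2,3)
proof (induction Y rule: finite_induct)
  case (insert y Y)
  have "y ^ b y \<in> ideal_power J (b y)"
    using ideal_power_power[OF J, of y 1] insert.prems ideal_power_1[OF J] by simp
  with insert show ?case by (simp add: ideal_power_mult[OF J])
qed (simp add: ideal_power_0)

lemma ideal_power_span_eq:
  assumes "finite Y"
  shows "ideal_power (idl Y) n = idl {\<Prod>y\<in>Y. y ^ b y |b. sum b Y = n}"
    (is "_ = idl (?M n)")
proof
  note I = idl_ideal[of Y]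
  show "idl (?M n) \<subseteq> ideal_power (idl Y) n"
    using prod_mem_ideal_power[OF I assms idl_superset]
    by (intro idl_minimal ideal_power_ideal I) auto
  show "ideal_power (idl Y) n \<subseteq> idl (?M n)"
  proof (induction n)
    case 0
    have "1 \<in> idl (?M 0)"
      by (rule idl_base) (auto intro: exI[of _ "\<lambda>_. 0"])
    then show ?case using ideal_eq_UNIV_iff[OF idl_ideal] by blast
  next
    case (Suc n)
    have step: "x * y \<in> idl (?M (Suc n))" if "x \<in> idl (?M n)" "y \<in> Y" for x y
    proof -
      have "idl (?M n) \<subseteq> {x. x * y \<in> idl (?M (Suc n))}"
      proof (intro idl_minimal ideal_colon idl_ideal subsetI, clarify)
        fix b assume "n = sum b Y"
        have "(\<Prod>z\<in>Y. z ^ b z) * y = (\<Prod>z\<in>Y. z ^ (b(y := Suc (b y))) z)"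
          using that assms by (simp add: prod.remove[of _ y] mult_ac)
        moreover have "(\<Sum>z\<in>Y. (b(y := Suc (b y))) z) = Suc (sum b Y)"
          using that assms by (simp add: sum.remove[of _ y])
        ultimately show "(\<Prod>z\<in>Y. z ^ b z) * y \<in> idl (?M (Suc (sum b Y)))"
          by (intro idl_base) blast
      qed
      then show ?thesis using that by blast
    qed
    show ?case
    proof (rule ideal_power_subsetI[OF I idl_ideal])
      fix a c assume a: "a \<in> ideal_power (idl Y) n" and c: "c \<in> idl Y"
      have "idl Y \<subseteq> {x. x * a \<in> idl (?M (Suc n))}"
        using Suc step[of a] a
        by (intro idl_minimal ideal_colon idl_ideal) (auto simp: mult.commute[of _ a])
      then show "a * c \<in> idl (?M (Suc n))" using c by (auto simp: mult.commute)
    qed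
  qed
qed

text \<open>Dividing each exponent of a monomial of degree n by q splits off the q-th power of a
  monomial of degree D; the remainders sum to at most \<open>card Y * (q - 1)\<close>, so the
  hypothesis gives k q < (D + 1) q and D \<ge> k. The summand q on the left replaces a subtraction
  on the right.\<close>

lemma ideal_power_subset_frobenius_power:
  assumes Y: "finite Y" and q: "q > 0" and n: "n + q > k * q + card Y * (q - 1)"
  shows "ideal_power (idl Y) n \<subseteq> frobenius_power q (ideal_power (idl Y) k)"
  unfolding ideal_power_span_eq[OF Y, of n]
proof (intro idl_minimal frobenius_power_ideal subsetI, clarify)
  fix b assume nb: "n = sum b Y"
  note I = idl_ideal[of Y]
  let ?D = "\<Sum>y\<in>Y. b y div q"
  have "sum b Y = (\<Sum>y\<in>Y. b y div q * q + b y mod q)" by simp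
  also have "\<dots> = ?D * q + (\<Sum>y\<in>Y. b y mod q)"
    by (simp only: sum.distrib sum_distrib_right)
  also have "(\<Sum>y\<in>Y. b y mod q) \<le> (\<Sum>y\<in>Y. q - 1)"
    using q by (intro sum_mono) (simp add: Suc_leI less_Suc_eq_le[symmetric])
  finally have "n \<le> ?D * q + card Y * (q - 1)" by (simp add: nb)
  with n have "k * q < Suc ?D * q" by simp
  then have "k \<le> ?D" using q by (metis mult_less_cancel2 less_Suc_eq_le)
  moreover have "(\<Prod>y\<in>Y. y ^ (b y div q)) \<in> ideal_power (idl Y) ?D"
    by (rule prod_mem_ideal_power[OF I Y idl_superset])
  ultimately have "(\<Prod>y\<in>Y. y ^ (b y div q)) \<in> ideal_power (idl Y) k"
    using ideal_power_antimono[OF I] by blast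
  then have "(\<Prod>y\<in>Y. y ^ (b y mod q)) * (\<Prod>y\<in>Y. y ^ (b y div q)) ^ q
      \<in> frobenius_power q (ideal_power (idl Y) k)"
    by (intro ideal_mult[OF frobenius_power_ideal] power_mem_frobenius_power)
  also have "(\<Prod>y\<in>Y. y ^ (b y mod q)) * (\<Prod>y\<in>Y. y ^ (b y div q)) ^ q = (\<Prod>y\<in>Y. y ^ b y)"
    by (simp add: prod_power_distrib prod.distrib[symmetric] power_mult[symmetric] power_add[symmetric])
  finally show "(\<Prod>y\<in>Y. y ^ b y) \<in> frobenius_power q (ideal_power (idl Y) k)" .
qed

text \<open>Local generators of P compute its symbolic powers, since the denominators of the factors
  can be multiplied.\<close>

lemma sat_power_eq_span:
  assumes P: "P \<in> Spec" and Y: "Y \<subseteq> P" "P \<subseteq> sat P (idl Y)"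
  shows "sat_power P n = sat P (ideal_power (idl Y) n)"
proof
  note I = idl_ideal[of Y]
  have "ideal_power P n \<subseteq> sat P (ideal_power (idl Y) n)"
  proof (induction n)
    case 0 then show ?case using sat_superset[OF P] by (simp add: ideal_power_0)
  next
    case (Suc n)
    show ?case
    proof (rule ideal_power_subsetI[OF SpecD(1)[OF P] sat_ideal[OF P ideal_power_ideal[OF I]]])
      fix a b assume "a \<in> ideal_power P n" "b \<in> P"
      then have "a \<in> sat P (ideal_power (idl Y) n)" "b \<in> sat P (idl Y)"
        using Suc Y by blast+
      then obtain s t where st: "s \<notin> P" "s * a \<in> ideal_power (idl Y) n"
        "t \<notin> P" "t * b \<in> idl Y"
        unfolding sat_def by blast
      have "s * t * (a * b) = (s * a) * (t * b)" by (simp add: mult_ac)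
      also have "\<dots> \<in> ideal_power (idl Y) (Suc n)"
        by (rule ideal_power_mult_Suc[OF I st(2,4)])
      finally show "a * b \<in> sat P (ideal_power (idl Y) (Suc n))"
        using SpecD(3)[OF P, of s t] st by (intro satI[of "s * t"]) auto
    qed
  qed
  then show "sat_power P n \<subseteq> sat P (ideal_power (idl Y) n)"
    unfolding sat_power_def by (rule sat_minimal[rotated]) (rule sat_cancel[OF P])
  show "sat P (ideal_power (idl Y) n) \<subseteq> sat_power P n"
    unfolding sat_power_def
    using ideal_power_mono[OF I SpecD(1)[OF P] idl_minimal[OF SpecD(1)[OF P] Y(1)]]
    by (rule sat_mono)
qed

section \<open>Independence of Frobenius powers of generators\<close>

lemma idl_finite_subset:
  assumes "x \<in> idl X"
  obtains F where "finite F" "F \<subseteq> X" "x \<in> idl F"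
proof -
  let ?S = "{x. \<exists>F. finite F \<and> F \<subseteq> X \<and> x \<in> idl F}"
  have "is_ideal ?S"
  proof (rule is_idealI)
    show "0 \<in> ?S" using ideal_zero[OF idl_ideal] by blast
  next
    fix x y assume "x \<in> ?S" "y \<in> ?S"
    then obtain F G where "finite F" "F \<subseteq> X" "x \<in> idl F" "finite G" "G \<subseteq> X" "y \<in> idl G"
      by blast
    moreover from this have "x \<in> idl (F \<union> G)" "y \<in> idl (F \<union> G)"
      using idl_mono[of F "F \<union> G"] idl_mono[of G "F \<union> G"] by blast+
    ultimately show "x + y \<in> ?S"
      by (intro CollectI exI[of _ "F \<union> G"]) (auto intro: ideal_add[OF idl_ideal])
  qed (blast intro: ideal_mult[OF idl_ideal])
  moreover have "X \<subseteq> ?S"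
    by (auto intro!: exI[of _ "{_}"] idl_base)
  ultimately have "idl X \<subseteq> ?S" by (rule idl_minimal)
  then show ?thesis using assms that by blast
qed

text \<open>A generating set of least cardinality is a basis of P S_P modulo its square: a relation
  with a coefficient outside P, hence invertible at P, would make one generator redundant.\<close>

lemma obtain_minimal_generators:
  assumes P: "P \<in> Spec" and Y0: "finite Y0" "Y0 \<subseteq> P" "P \<subseteq> sat P (idl Y0)"
  obtains Y where "finite Y" "Y \<subseteq> P" "P \<subseteq> sat P (idl Y)"
    "\<And>r y. (\<Sum>y\<in>Y. r y * y) \<in> sat_power P 2 \<Longrightarrow> y \<in> Y \<Longrightarrow> r y \<in> P"
proof -
  let ?gen = "\<lambda>Y. finite Y \<and> Y \<subseteq> P \<and> P \<subseteq> sat P (idl Y)"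
  obtain Y where Y: "?gen Y" and min: "\<And>Z. ?gen Z \<Longrightarrow> card Y \<le> card Z"
    using ex_has_least_nat[of ?gen Y0 card] Y0 by blast
  then have fin: "finite Y" and YP: "Y \<subseteq> P" and gen: "P \<subseteq> sat P (idl Y)" by auto
  have IP: "is_ideal P" by (rule SpecD(1)[OF P])
  have "r y0 \<in> P" if r: "(\<Sum>y\<in>Y. r y * y) \<in> sat_power P 2" and y0: "y0 \<in> Y" for r y0
  proof (rule ccontr)
    assume ry0: "r y0 \<notin> P"
    \<comment> \<open>\<open>?M\<close> is P times the ideal of Y, and it contains the square of
      that ideal.\<close>
    let ?M = "{\<Sum>y\<in>Y. m y * y |m. \<forall>y. m y \<in> P}"
    have "ideal_power (idl Y) (Suc 1) \<subseteq> ?M"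
    proof (rule ideal_power_subsetI[OF idl_ideal])
      show "is_ideal ?M"
      proof (rule is_idealI)
        show "0 \<in> ?M" using ideal_zero[OF IP] by (intro CollectI exI[of _ "\<lambda>_. 0"]) simp
      next
        fix x y assume "x \<in> ?M" "y \<in> ?M"
        then obtain m m' where "x = (\<Sum>y\<in>Y. m y * y)" "\<forall>y. m y \<in> P"
          "y = (\<Sum>y\<in>Y. m' y * y)" "\<forall>y. m' y \<in> P" by blast
        then show "x + y \<in> ?M"
          by (intro CollectI exI[of _ "\<lambda>y. m y + m' y"])
             (auto simp: sum.distrib distrib_right intro: ideal_add[OF IP])
      next
        fix c x assume "x \<in> ?M"
        then obtain m where "x = (\<Sum>y\<in>Y. m y * y)" "\<forall>y. m y \<in> P" by blast
        then show "c * x \<in> ?M"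
          by (intro CollectI exI[of _ "\<lambda>y. c * m y"])
             (auto simp: sum_distrib_left mult.assoc intro: ideal_mult[OF IP])
      qed
    next
      fix a b assume a: "a \<in> ideal_power (idl Y) 1" and "b \<in> idl Y"
      then obtain c where b: "b = (\<Sum>y\<in>Y. c y * y)"
        unfolding idl_finite_explicit[OF fin] by blast
      have "a \<in> P" using a YP idl_minimal[OF IP, of Y]
        by (auto simp only: ideal_power_1[OF idl_ideal])
      then show "a * b \<in> ?M" unfolding b
        by (intro CollectI exI[of _ "\<lambda>y. a * c y"])
           (auto simp: sum_distrib_left mult.assoc intro: ideal_mult_right[OF IP])
    qed
    then have sub: "ideal_power (idl Y) 2 \<subseteq> ?M" by (simp add: numeral_2_eq_2)
    obtain s where s: "s \<notin> P" "s * (\<Sum>y\<in>Y. r y * y) \<in> ideal_power (idl Y) 2"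
      using r unfolding sat_power_eq_span[OF P YP gen] by (elim satE)
    then obtain m where m: "s * (\<Sum>y\<in>Y. r y * y) = (\<Sum>y\<in>Y. m y * y)" "\<forall>y. m y \<in> P"
      using sub by blast
    \<comment> \<open>\<open>?t\<close> differs from s r(y0) by an element of P, so it is a unit of
      S_P and expresses y0 by the other generators.\<close>
    let ?t = "s * r y0 - m y0" and ?Z = "Y - {y0}"
    have "?t * y0 = (\<Sum>y\<in>?Z. (m y - s * r y) * y)"
      using m(1) fin y0
      by (simp add: sum.remove[of Y y0] algebra_simps sum_subtractf sum_distrib_left)
    then have t0: "?t * y0 \<in> idl ?Z"
      unfolding idl_finite_explicit[OF finite_Diff[OF fin]]
      by (intro CollectI exI[of _ "\<lambda>y. m y - s * r y"]) simp
    have "?t \<notin> P"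
    proof
      assume "?t \<in> P"
      then have "?t + m y0 \<in> P" using m(2) by (intro ideal_add[OF IP]) auto
      then show False using SpecD(3)[OF P, of s "r y0"] s ry0 by auto
    qed
    with t0 have "y0 \<in> sat P (idl ?Z)" by (intro satI)
    then have "Y \<subseteq> sat P (idl ?Z)"
      using sat_superset[OF P, of "idl ?Z"] idl_superset[of ?Z] by blast
    then have "idl Y \<subseteq> sat P (idl ?Z)"
      by (rule idl_minimal[OF sat_ideal[OF P idl_ideal]])
    then have "sat P (idl Y) \<subseteq> sat P (idl ?Z)"
      by (rule sat_minimal[rotated]) (rule sat_cancel[OF P])
    with gen have "P \<subseteq> sat P (idl ?Z)" by (rule order_trans)
    then have "card Y \<le> card ?Z" using fin YP by (intro min) auto
    then show False using fin y0 by (metis card_Diff1_less not_le)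
  qed
  then show ?thesis by (rule that[OF fin YP gen])
qed

section \<open>Independence in the sense of Lech\<close>

text \<open>For prime P this says that locally at P the classes of the a(y) are a basis of J/J^2
  over S/J, where J is the ideal they generate. A family is used instead of a set because its
  members are replaced one at a time.\<close>

definition lech_independent :: "'a::comm_ring_1 set \<Rightarrow> 'b set \<Rightarrow> ('b \<Rightarrow> 'a) \<Rightarrow> bool" where
  "lech_independent P Y a \<longleftrightarrow>
    (\<forall>r. (\<Sum>y\<in>Y. r y * a y) = 0 \<longrightarrow> (\<forall>y\<in>Y. r y \<in> sat P (idl (a ` Y))))"

lemma lech_independentD:
  assumes "lech_independent P Y a" "(\<Sum>y\<in>Y. r y * a y) = 0" "y \<in> Y"
  shows "r y \<in> sat P (idl (a ` Y))"
  using assms unfolding lech_independent_def by blast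

text \<open>Lech's lemma on splitting a factor off one member. Multiplied by b, an expression of c r
  in the old ideal becomes a relation of the original family; multiplied by c, so does a relation of
  the new one. The coefficients then lie in the old ideal, which is the smaller one.\<close>

lemma lech_factor:
  fixes a :: "'b \<Rightarrow> 'a::comm_ring_1"
  assumes P: "P \<in> Spec" and fin: "finite Y" and y0: "y0 \<in> Y" "a y0 = b * c"
    and indep: "lech_independent P Y a"
  shows "c * r \<in> sat P (idl (a ` Y)) \<Longrightarrow> r \<in> sat P (idl (a(y0 := b) ` Y))"
    and "lech_independent P Y (a(y0 := b))"
proof -
  let ?a = "a(y0 := b)"
  let ?E = "sat P (idl (a ` Y))" and ?E' = "sat P (idl (?a ` Y))"
  have E': "is_ideal ?E'" by (rule sat_ideal[OF P idl_ideal])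
  have "a y \<in> idl (?a ` Y)" if "y \<in> Y" for y
  proof (cases "y = y0")
    case True
    have "b \<in> idl (?a ` Y)" using y0 by (intro idl_base) auto
    then show ?thesis using True y0 ideal_mult_right[OF idl_ideal] by metis
  next
    case False
    then show ?thesis using that by (intro idl_base) (auto intro!: image_eqI[of _ _ y])
  qed
  then have "idl (a ` Y) \<subseteq> idl (?a ` Y)"
    by (intro idl_minimal idl_ideal) auto
  then have EE': "?E \<subseteq> ?E'" by (rule sat_mono)
  have bE': "b \<in> ?E'"
    using sat_superset[OF P] y0 by (fastforce intro: idl_base)
  have split: "(\<Sum>y\<in>Y. g y) = g y0 + (\<Sum>y\<in>Y - {y0}. g y)" for g :: "'b \<Rightarrow> 'a"
    using fin y0 by (simp add: sum.remove)
  show cancel: "r \<in> ?E'" if "c * r \<in> ?E" for r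
  proof -
    obtain s u where s: "s \<notin> P" "s * (c * r) = (\<Sum>y\<in>Y. u y * a y)"
      using \<open>c * r \<in> ?E\<close> unfolding idl_image_explicit[OF fin] by (auto elim!: satE)
    \<comment> \<open>The expression of s c r by the family, multiplied by b and brought to one
      side; b c is the member at y0.\<close>
    let ?v = "\<lambda>y. if y = y0 then s * r - b * u y0 else - b * u y"
    have "(\<Sum>y\<in>Y. ?v y * a y)
        = (s * r - b * u y0) * (b * c) + (\<Sum>y\<in>Y - {y0}. - (b * (u y * a y)))"
      unfolding split[of "\<lambda>y. ?v y * a y"]
      by (intro arg_cong2[of _ _ _ _ "(+)"] sum.cong) (auto simp: y0 mult.assoc)
    also have "\<dots> = (s * r - b * u y0) * (b * c) - b * (\<Sum>y\<in>Y - {y0}. u y * a y)"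
      by (simp add: sum_negf sum_distrib_left)
    also have "(\<Sum>y\<in>Y - {y0}. u y * a y) = s * (c * r) - u y0 * (b * c)"
      using s(2) split[of "\<lambda>y. u y * a y"] y0(2) by simp
    also have "(s * r - b * u y0) * (b * c) - b * (s * (c * r) - u y0 * (b * c)) = 0"
      by (simp add: algebra_simps)
    finally have "?v y0 \<in> ?E" by (rule lech_independentD[where r = ?v, OF indep _ y0(1)])
    then have "(s * r - b * u y0) + u y0 * b \<in> ?E'"
      using EE' ideal_mult[OF E' bE'] by (intro ideal_add[OF E']) auto
    then have "s * r \<in> ?E'" by (simp add: algebra_simps)
    then show ?thesis by (rule sat_cancel[OF P s(1)])
  qed
  show "lech_independent P Y ?a"
    unfolding lech_independent_def
  proof (intro allI impI ballI)
    fix u y assume u: "(\<Sum>y\<in>Y. u y * ?a y) = 0" and y: "y \<in> Y"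
    \<comment> \<open>The relation u multiplied by c, which at y0 is absorbed by b c =
      a(y0).\<close>
    let ?v = "\<lambda>y. if y = y0 then u y0 else c * u y"
    have "(\<Sum>y\<in>Y. ?v y * a y) = c * (\<Sum>y\<in>Y. u y * ?a y)"
      unfolding sum_distrib_left by (intro sum.cong) (auto simp: y0 mult_ac)
    also have "\<dots> = 0" using u by simp
    finally have *: "?v y \<in> ?E" by (rule lech_independentD[where r = ?v, OF indep _ y])
    show "u y \<in> ?E'"
    proof (cases "y = y0")
      case True then show ?thesis using * EE' by auto
    next
      case False then show ?thesis using * by (intro cancel) simp
    qed
  qed
qed

text \<open>The exponent q is lowered to 1 for one y at a time, and \<open>lech_factor\<close>
  cancels y^(q - 1) from the product meanwhile. In the end 1 would lie in the saturation of an ideal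
  contained in P.\<close>

lemma lech_prod_not_mem:
  assumes P: "P \<in> Spec" and fin: "finite Y" and Y: "Y \<subseteq> P" and q: "q > 0"
    and indep: "lech_independent P Y (\<lambda>y. y ^ q)"
  shows "(\<Prod>y\<in>Y. y ^ (q - 1)) \<notin> sat P (idl ((\<lambda>y. y ^ q) ` Y))"
proof
  assume W: "(\<Prod>y\<in>Y. y ^ (q - 1)) \<in> sat P (idl ((\<lambda>y. y ^ q) ` Y))"
  \<comment> \<open>The intermediate family: members of T are already lowered to exponent 1.\<close>
  define a where "a T y = (if y \<in> T then y else y ^ q)" for T and y :: 'a
  have "lech_independent P Y (a T) \<and> (\<Prod>y\<in>Y - T. y ^ (q - 1)) \<in> sat P (idl (a T ` Y))"
    if "T \<subseteq> Y" for T
    using finite_subset[OF that fin] that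
  proof (induction T rule: finite_induct)
    case empty
    have "a {} = (\<lambda>y. y ^ q)" by (auto simp: a_def)
    then show ?case using indep W by simp
  next
    case (insert t T)
    have upd: "(a T)(t := t) = a (insert t T)" using insert.hyps by (auto simp: a_def fun_eq_iff)
    have "a T t = t * t ^ (q - 1)" using insert.hyps q by (simp add: a_def power_eq_if)
    note step = lech_factor[where a = "a T", OF P fin _ this, unfolded upd]
    have "Y - T = insert t (Y - insert t T)" using insert.hyps insert.prems by blast
    then have "(\<Prod>y\<in>Y - T. y ^ (q - 1)) = t ^ (q - 1) * (\<Prod>y\<in>Y - insert t T. y ^ (q - 1))"
      using fin by (metis (no_types, lifting) DiffE finite_Diff insertCI prod.insert)
    with insert.IH insert.prems have IH: "lech_independent P Y (a T)"
      "t ^ (q - 1) * (\<Prod>y\<in>Y - insert t T. y ^ (q - 1)) \<in> sat P (idl (a T ` Y))"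
      by simp_all
    have "t \<in> Y" using insert.prems by simp
    then show ?case using step[OF _ IH(1)] IH(2) by blast
  qed
  from this[of Y] have "1 \<in> sat P (idl (a Y ` Y))" by simp
  then obtain s where "s \<notin> P" "s \<in> idl (a Y ` Y)" by (auto elim!: satE)
  moreover have "idl (a Y ` Y) \<subseteq> P"
    using Y by (intro idl_minimal SpecD(1)[OF P]) (auto simp: a_def)
  ultimately show False by blast
qed

section \<open>Consequences of flatness of Frobenius\<close>

text \<open>The maps in \<open>coords e\<close> stand for the coordinates of S as a free module over
  its q-th powers, q = p^e, followed by the q-th root; hence a factor g^q comes out as g.
  \<open>coords_mem_iff\<close> is the form in which flatness is used.\<close>

locale flat_frobenius =
  fixes p :: nat and coords :: "nat \<Rightarrow> ('a::idom \<Rightarrow> 'a) set"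
  assumes p_gt_1: "p > 1"
    and frob_add: "\<And>x y e. (x + y :: 'a) ^ (p ^ e) = x ^ (p ^ e) + y ^ (p ^ e)"
    and coords_add: "\<And>\<phi> e x y. \<phi> \<in> coords e \<Longrightarrow> \<phi> (x + y) = \<phi> x + \<phi> y"
    and coords_mult: "\<And>\<phi> e g h. \<phi> \<in> coords e \<Longrightarrow> \<phi> (g ^ (p ^ e) * h) = g * \<phi> h"
    and coords_mem_iff:
      "\<And>L e h. is_ideal L \<Longrightarrow> h \<in> frobenius_power (p ^ e) L \<longleftrightarrow> (\<forall>\<phi>\<in>coords e. \<phi> h \<in> L)"
begin

lemma p_pos [simp]: "p > 0"
  using p_gt_1 by simp

text \<open>The lower bound 1 on e keeps the exponent within the union that defines
  \<open>test_ideal\<close>.\<close>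

lemma pe_unbounded: "\<exists>e\<ge>1. p ^ e > n"
proof -
  have "n < 2 ^ n" by (rule less_exp)
  also have "\<dots> \<le> p ^ n" using p_gt_1 by (intro power_mono) simp_all
  also have "\<dots> \<le> p ^ Suc n" using p_gt_1 by simp
  finally show ?thesis by (intro exI[of _ "Suc n"]) simp
qed

lemma frob_sum: "(sum f A :: 'a) ^ (p ^ e) = (\<Sum>x\<in>A. f x ^ (p ^ e))"
  by (induction A rule: infinite_finite_induct) (simp_all add: frob_add)

lemma coords_sum:
  assumes "\<phi> \<in> coords e" shows "\<phi> (sum f A) = (\<Sum>x\<in>A. \<phi> (f x))"
proof -
  have "\<phi> 0 = 0" using coords_add[OF assms, of 0 0] by (metis add_0 add_cancel_right_right)
  then show ?thesis
    by (induction A rule: infinite_finite_induct) (simp_all add: coords_add[OF assms])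
qed

lemma frobenius_power_Inter:
  fixes \<L> :: "'a set set"
  assumes "\<And>L. L \<in> \<L> \<Longrightarrow> is_ideal L"
  shows "frobenius_power (p ^ e) (\<Inter>\<L>) = (\<Inter>L\<in>\<L>. frobenius_power (p ^ e) L)"
  using assms by (auto simp: coords_mem_iff ideal_Inter)

lemma frobenius_power_colon:
  fixes L :: "'a set"
  assumes "is_ideal L"
  shows "h * f ^ (p ^ e) \<in> frobenius_power (p ^ e) L \<longleftrightarrow> h \<in> frobenius_power (p ^ e) {x. x * f \<in> L}"
proof -
  have "\<phi> (h * f ^ (p ^ e)) = \<phi> h * f" if "\<phi> \<in> coords e" for \<phi>
    using coords_mult[OF that, of f h] by (simp add: mult.commute)
  then show ?thesis using assms by (simp add: coords_mem_iff ideal_colon)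
qed

text \<open>Multiplying s f up to s^q f turns the factor into a colon by s inside the Frobenius
  power, and a symbolic power absorbs that colon.\<close>

lemma frobenius_power_cancel:
  fixes P :: "'a set"
  assumes P: "P \<in> Spec" and s: "s \<notin> P" "s * f \<in> frobenius_power (p ^ e) (sat_power P k)"
  shows "f \<in> frobenius_power (p ^ e) (sat_power P k)"
proof -
  have "s * f * s ^ (p ^ e - 1) \<in> frobenius_power (p ^ e) (sat_power P k)"
    by (rule ideal_mult_right[OF frobenius_power_ideal s(2)])
  also have "s * f * s ^ (p ^ e - 1) = f * (s ^ (p ^ e - 1) * s)"
    by (simp only: mult_ac)
  also have "s ^ (p ^ e - 1) * s = s ^ (p ^ e)"
    by (rule power_minus_mult) simp
  finally have "f \<in> frobenius_power (p ^ e) {x. x * s \<in> sat_power P k}"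
    by (simp add: frobenius_power_colon sat_power_ideal[OF P])
  moreover have "{x. x * s \<in> sat_power P k} \<subseteq> sat_power P k"
  proof clarify
    fix x assume "x * s \<in> sat_power P k"
    then show "x \<in> sat_power P k" by (intro sat_power_cancel[OF P s(1), of x]) (simp only: mult.commute)
  qed
  ultimately show ?thesis by (rule rev_subsetD[OF _ frobenius_power_mono])
qed

lemma sat_power_subset_frobenius_power:
  fixes P :: "'a set"
  assumes P: "P \<in> Spec" and Y: "finite Y" "Y \<subseteq> P" "P \<subseteq> sat P (idl Y)"
    and n: "n + p ^ e > k * p ^ e + card Y * (p ^ e - 1)"
  shows "sat_power P n \<subseteq> frobenius_power (p ^ e) (sat_power P k)"
  unfolding sat_power_eq_span[OF P Y(2,3), of n]
proof (rule sat_minimal)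
  have "ideal_power (idl Y) n \<subseteq> frobenius_power (p ^ e) (ideal_power (idl Y) k)"
    by (rule ideal_power_subset_frobenius_power[OF Y(1) _ n]) simp
  also have "\<dots> \<subseteq> frobenius_power (p ^ e) (sat_power P k)"
    unfolding sat_power_eq_span[OF P Y(2,3)] by (rule frobenius_power_mono[OF sat_superset[OF P]])
  finally show "ideal_power (idl Y) n \<subseteq> frobenius_power (p ^ e) (sat_power P k)" .
qed (rule frobenius_power_cancel[OF P])

lemma frobenius_power_subset_sat_span:
  fixes P :: "'a set"
  assumes P: "P \<in> Spec" and Y: "finite Y" "P \<subseteq> sat P (idl Y)"
  shows "frobenius_power (p ^ e) P \<subseteq> sat P (idl ((\<lambda>y. y ^ (p ^ e)) ` Y))"
proof (rule frobenius_power_minimal[OF sat_ideal[OF P idl_ideal]])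
  fix f assume "f \<in> P"
  then obtain s r where s: "s \<notin> P" "s * f = (\<Sum>y\<in>Y. r y * y)"
    using Y unfolding idl_finite_explicit[OF Y(1)] sat_def by blast
  have "s ^ (p ^ e) * f ^ (p ^ e) = (\<Sum>y\<in>Y. r y ^ (p ^ e) * y ^ (p ^ e))"
    by (simp flip: power_mult_distrib frob_sum add: s)
  then have "s ^ (p ^ e) * f ^ (p ^ e) \<in> idl ((\<lambda>y. y ^ (p ^ e)) ` Y)"
    unfolding idl_image_explicit[OF Y(1)]
    by (intro CollectI exI[of _ "\<lambda>y. r y ^ (p ^ e)"]) simp
  then show "f ^ (p ^ e) \<in> sat P (idl ((\<lambda>y. y ^ (p ^ e)) ` Y))"
    using Spec_power[OF P] s(1) by (intro satI) auto
qed

text \<open>A coordinate \<phi> applied to the relation \<Sum> r(y) y^q = 0 gives \<Sum>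
  \<phi>(r(y)) y = 0, and minimality of the generators puts each \<phi>(r(y)) in P. Hence r(y) lies
  in P^[q], which the y^q generate locally.\<close>

lemma lech_independent_frobenius:
  fixes P :: "'a set"
  assumes P: "P \<in> Spec" and Y: "finite Y" "P \<subseteq> sat P (idl Y)"
    and min: "\<And>r y. (\<Sum>y\<in>Y. r y * y) \<in> sat_power P 2 \<Longrightarrow> y \<in> Y \<Longrightarrow> r y \<in> P"
  shows "lech_independent P Y (\<lambda>y. y ^ (p ^ e))"
  unfolding lech_independent_def
proof (intro allI impI ballI)
  fix r y assume 0: "(\<Sum>y\<in>Y. r y * y ^ (p ^ e)) = 0" and y: "y \<in> Y"
  have "\<phi> (r y) \<in> P" if \<phi>: "\<phi> \<in> coords e" for \<phi>
  proof (rule min[OF _ y])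
    have "\<phi> (r y * y ^ (p ^ e)) = \<phi> (r y) * y" for y
      using coords_mult[OF \<phi>, of y "r y"] by (simp add: mult.commute)
    then have "(\<Sum>y\<in>Y. \<phi> (r y) * y) = \<phi> (\<Sum>y\<in>Y. r y * y ^ (p ^ e))"
      unfolding coords_sum[OF \<phi>] by simp
    also have "\<dots> = 0" unfolding 0 using coords_sum[OF \<phi>, of _ "{}"] by simp
    finally show "(\<Sum>y\<in>Y. \<phi> (r y) * y) \<in> sat_power P 2"
      using ideal_zero[OF sat_power_ideal[OF P]] by simp
  qed
  then have "r y \<in> frobenius_power (p ^ e) P" by (simp add: coords_mem_iff SpecD(1)[OF P])
  then show "r y \<in> sat P (idl ((\<lambda>y. y ^ (p ^ e)) ` Y))"
    using frobenius_power_subset_sat_span[OF P Y] by blast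
qed

text \<open>A dual monomial M detects the initial form of x. Up to a denominator x is a combination
  of monomials of degree c in minimal generators, with a coefficient outside P at some m0. M is
  chosen so that m0^q M is the product of all y^(Q - 1). Every other monomial then falls into the
  ideal of the y^Q, and so would x^q M if x^q had order above q c; the product itself would follow,
  against \<open>lech_prod_not_mem\<close>.\<close>

lemma power_not_mem_sat_power:
  fixes P :: "'a set"
  assumes P: "P \<in> Spec" and Y0: "finite Y0" "Y0 \<subseteq> P" "P \<subseteq> sat P (idl Y0)"
    and x: "x \<in> sat_power P c" "x \<notin> sat_power P (c + 1)"
  shows "x ^ (p ^ e) \<notin> sat_power P (p ^ e * c + 1)"
proof
  let ?q = "p ^ e"
  assume xq: "x ^ ?q \<in> sat_power P (?q * c + 1)"
  obtain Y where fin: "finite Y" and YP: "Y \<subseteq> P" and gen: "P \<subseteq> sat P (idl Y)"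
    and min: "\<And>r y. (\<Sum>y\<in>Y. r y * y) \<in> sat_power P 2 \<Longrightarrow> y \<in> Y \<Longrightarrow> r y \<in> P"
    using obtain_minimal_generators[OF P Y0] by blast
  \<comment> \<open>Q = q p^j exceeds q c and so every q b(y) below; no exponent of M is truncated
    at 0.\<close>
  obtain j where j: "p ^ j > c" using pe_unbounded by blast
  define Q where "Q = p ^ (e + j)"
  have Q: "Q = ?q * p ^ j" by (simp add: Q_def power_add)
  have Qc: "?q * c < Q" using j by (simp add: Q)
  let ?E = "sat P (idl ((\<lambda>y. y ^ Q) ` Y))"
  have E: "is_ideal ?E" by (rule sat_ideal[OF P idl_ideal])
  have "lech_independent P Y (\<lambda>y. y ^ Q)"
    unfolding Q_def by (rule lech_independent_frobenius[OF P fin gen]) (rule min)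
  then have W: "(\<Prod>y\<in>Y. y ^ (Q - 1)) \<notin> ?E"
    by (intro lech_prod_not_mem[OF P fin YP]) (simp_all add: Q_def)
  obtain s where s: "s \<notin> P" "s * x \<in> ideal_power (idl Y) c"
    using x(1) unfolding sat_power_eq_span[OF P YP gen] by (elim satE)
  obtain F where F: "finite F" "F \<subseteq> {\<Prod>y\<in>Y. y ^ b y |b. sum b Y = c}" "s * x \<in> idl F"
    using s(2) unfolding ideal_power_span_eq[OF fin] by (rule idl_finite_subset)
  obtain r where r: "s * x = (\<Sum>m\<in>F. r m * m)"
    using F(3) unfolding idl_finite_explicit[OF F(1)] by blast
  have "\<forall>m\<in>F. \<exists>b. m = (\<Prod>y\<in>Y. y ^ b y) \<and> sum b Y = c" using F(2) by blast
  then obtain b where b: "\<And>m. m \<in> F \<Longrightarrow> m = (\<Prod>y\<in>Y. y ^ b m y)" "\<And>m. m \<in> F \<Longrightarrow> sum (b m) Y = c"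
    by metis
  have bc: "b m y \<le> c" if "m \<in> F" "y \<in> Y" for m y
    using b(2)[OF that(1)] member_le_sum[OF that(2), of "b m"] fin by simp
  \<comment> \<open>With all coefficients in P, s x would lie in the power c + 1 of P, against the
    order of x.\<close>
  obtain m0 where m0: "m0 \<in> F" "r m0 \<notin> P"
  proof -
    have "\<exists>m\<in>F. r m \<notin> P"
    proof (rule ccontr)
      assume "\<not> ?thesis"
      then have nr: "\<forall>m\<in>F. r m \<in> P" by blast
      have "r m * m \<in> ideal_power P (1 + c)" if "m \<in> F" for m
      proof -
        have "m \<in> ideal_power P c"
          using prod_mem_ideal_power[OF SpecD(1)[OF P] fin YP, of "b m"]
          unfolding b(2)[OF that] b(1)[OF that, symmetric] .
        moreover have "r m \<in> ideal_power P 1"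
          using nr that by (simp only: ideal_power_1[OF SpecD(1)[OF P]])
        ultimately show ?thesis by (intro ideal_power_mult SpecD(1)[OF P])
      qed
      then have "s * x \<in> ideal_power P (c + 1)"
        unfolding r by (intro ideal_sum ideal_power_ideal SpecD(1)[OF P]) (simp add: add.commute)
      then show False using x(2) s(1) by (auto simp: sat_power_def intro: satI)
    qed
    then show ?thesis using that by blast
  qed
  define M where "M = (\<Prod>y\<in>Y. y ^ (Q - 1 - ?q * b m0 y))"
  have qb: "?q * b m y \<le> Q - 1" if "m \<in> F" "y \<in> Y" for m y
  proof -
    have "?q * b m y \<le> ?q * c" using bc[OF that] by simp
    then show ?thesis using Qc by linarith
  qed
  have mM: "m ^ ?q * M = (\<Prod>y\<in>Y. y ^ (?q * b m y + (Q - 1 - ?q * b m0 y)))" if "m \<in> F" for m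
  proof -
    have "m ^ ?q * M = (\<Prod>y\<in>Y. y ^ b m y) ^ ?q * M"
      by (subst (1) b(1)[OF that]) (rule refl)
    also have "\<dots> = (\<Prod>y\<in>Y. (y ^ b m y) ^ ?q * y ^ (Q - 1 - ?q * b m0 y))"
      by (simp only: M_def prod_power_distrib prod.distrib)
    also have "\<dots> = (\<Prod>y\<in>Y. y ^ (?q * b m y + (Q - 1 - ?q * b m0 y)))"
      by (intro prod.cong refl) (simp only: power_add power_mult[symmetric] mult.commute[of ?q])
    finally show ?thesis .
  qed
  have m0M: "m0 ^ ?q * M = (\<Prod>y\<in>Y. y ^ (Q - 1))"
    unfolding mM[OF m0(1)]
    by (intro prod.cong refl) (simp only: le_add_diff_inverse[OF qb[OF m0(1)]])
  \<comment> \<open>Of two distinct monomials of equal degree, m has the larger exponent at some y.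
    The q-th power stretches the gap to at least q, and the exponent of y in m^q M reaches
    Q.\<close>
  have other: "m ^ ?q * M \<in> ?E" if m: "m \<in> F" "m \<noteq> m0" for m
  proof -
    have "\<exists>y\<in>Y. b m0 y < b m y"
    proof (rule ccontr)
      assume "\<not> ?thesis"
      then have le: "b m y \<le> b m0 y" if "y \<in> Y" for y using that by (meson not_le)
      have "b m y = b m0 y" if "y \<in> Y" for y
        by (rule sum_mono_inv[OF _ le that fin]) (simp_all only: b(2)[OF m(1)] b(2)[OF m0(1)])
      then have "(\<Prod>y\<in>Y. y ^ b m y) = (\<Prod>y\<in>Y. y ^ b m0 y)" by (intro prod.cong) auto
      then show False
        using m(2) unfolding b(1)[OF m(1), symmetric] b(1)[OF m0(1), symmetric] by blast
    qed
    then obtain y where y: "y \<in> Y" "b m0 y < b m y" by blast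
    have "?q * b m0 y + ?q \<le> ?q * b m y"
      using mult_le_mono2[OF Suc_leI[OF y(2)], of ?q] by simp
    moreover have "?q > 0" by simp
    ultimately have "Q \<le> ?q * b m y + (Q - 1 - ?q * b m0 y)"
      using qb[OF m0(1) y(1)] by linarith
    then have "y ^ Q dvd y ^ (?q * b m y + (Q - 1 - ?q * b m0 y))" by (rule le_imp_power_dvd)
    also have "\<dots> dvd m ^ ?q * M"
      unfolding mM[OF m(1)] by (rule dvd_prodI[OF fin y(1)])
    finally obtain z where z: "m ^ ?q * M = y ^ Q * z" by (elim dvdE)
    have "y ^ Q \<in> ?E"
      by (rule subsetD[OF sat_superset[OF P] idl_base[OF imageI[OF y(1)]]])
    then show ?thesis unfolding z by (rule ideal_mult_right[OF E])
  qed
  have sumM: "(\<Sum>y\<in>Y. Q - 1 - ?q * b m0 y) = card Y * (Q - 1) - ?q * c"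
    by (subst sum_subtractf_nat[OF qb[OF m0(1)]])
       (simp_all only: sum_constant sum_distrib_left[symmetric] b(2)[OF m0(1)] of_nat_id)
  have cY: "?q * c \<le> card Y * (Q - 1)"
    using sum_mono[of Y "\<lambda>y. ?q * b m0 y" "\<lambda>_. Q - 1", OF qb[OF m0(1)]]
    by (simp only: sum_constant sum_distrib_left[symmetric] b(2)[OF m0(1)] of_nat_id)
  have "M \<in> ideal_power P (card Y * (Q - 1) - ?q * c)"
    unfolding M_def sumM[symmetric] by (rule prod_mem_ideal_power[OF SpecD(1)[OF P] fin YP])
  then have "M \<in> sat_power P (card Y * (Q - 1) - ?q * c)"
    unfolding sat_power_def by (rule subsetD[OF sat_superset[OF P]])
  from sat_power_mult[OF P xq this] have "x ^ ?q * M \<in> sat_power P (card Y * (Q - 1) + 1)"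
    using cY by (simp add: add.commute)
  \<comment> \<open>The exponent obtained for x^q M is exactly the one at which the pigeonhole bound
    for k = 1 takes effect.\<close>
  moreover have "sat_power P (card Y * (Q - 1) + 1) \<subseteq> frobenius_power Q (sat_power P 1)"
    unfolding Q_def by (rule sat_power_subset_frobenius_power[OF P fin YP gen]) simp
  moreover have "frobenius_power Q (sat_power P 1) \<subseteq> ?E"
    unfolding sat_power_1[OF P] Q_def by (rule frobenius_power_subset_sat_span[OF P fin gen])
  ultimately have xM: "x ^ ?q * M \<in> ?E" by blast
  have "s ^ ?q * (x ^ ?q * M) = (\<Sum>m\<in>F. r m ^ ?q * (m ^ ?q * M))"
    using arg_cong[OF r, of "\<lambda>z. z ^ ?q * M"]
    by (simp add: frob_sum power_mult_distrib sum_distrib_right mult.assoc)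
  also have "\<dots> = r m0 ^ ?q * (m0 ^ ?q * M) + (\<Sum>m\<in>F - {m0}. r m ^ ?q * (m ^ ?q * M))"
    using F(1) m0(1) by (rule sum.remove)
  finally have "r m0 ^ ?q * (\<Prod>y\<in>Y. y ^ (Q - 1))
      = s ^ ?q * (x ^ ?q * M) - (\<Sum>m\<in>F - {m0}. r m ^ ?q * (m ^ ?q * M))"
    unfolding m0M by simp
  also have "\<dots> \<in> ?E"
    by (rule ideal_diff[OF E ideal_mult[OF E xM] ideal_sum[OF E ideal_mult[OF E other]]]) auto
  finally have rW: "r m0 ^ ?q * (\<Prod>y\<in>Y. y ^ (Q - 1)) \<in> ?E" .
  have "r m0 ^ ?q \<notin> P"
  proof
    assume "r m0 ^ ?q \<in> P"
    then have "r m0 \<in> P" by (rule Spec_power[OF P])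
    with m0(2) show False by contradiction
  qed
  from sat_cancel[OF P this rW] have "(\<Prod>y\<in>Y. y ^ (Q - 1)) \<in> ?E" .
  then show False using W by blast
qed

text \<open>From powers of p to all exponents: x^s is completed to some x^(p^e), and an excess of
  its order over s c would survive the completion.\<close>

lemma power_order_le:
  fixes P :: "'a set"
  assumes P: "P \<in> Spec" and Y: "finite Y" "Y \<subseteq> P" "P \<subseteq> sat P (idl Y)"
    and x: "x \<in> sat_power P c" "x \<notin> sat_power P (c + 1)"
    and l: "x ^ s \<in> sat_power P l"
  shows "l \<le> s * c"
proof (rule ccontr)
  assume nl: "\<not> l \<le> s * c"
  obtain e where e: "s < p ^ e" using pe_unbounded by blast
  have "x ^ s * x ^ (p ^ e - s) \<in> sat_power P (l + (p ^ e - s) * c)"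
    by (rule sat_power_mult[OF P l sat_power_power[OF P x(1)]])
  then have "x ^ (p ^ e) \<in> sat_power P (l + (p ^ e - s) * c)"
    using e by (simp flip: power_add)
  moreover have "p ^ e * c + 1 \<le> l + (p ^ e - s) * c"
  proof -
    have "s * c \<le> p ^ e * c" using e by simp
    then show ?thesis using nl by (simp only: diff_mult_distrib)
  qed
  ultimately have "x ^ (p ^ e) \<in> sat_power P (p ^ e * c + 1)"
    by (meson sat_power_antimono[OF P] subsetD)
  with power_not_mem_sat_power[OF P Y x] show False by contradiction
qed

end

section \<open>Frobenius coordinates of a polynomial ring\<close>

abbreviation "lookup \<equiv> Poly_Mapping.lookup"
abbreviation "keys \<equiv> Poly_Mapping.keys"
abbreviation "single \<equiv> Poly_Mapping.single"

definition mon :: "('n::finite \<Rightarrow> nat) \<Rightarrow> ('n \<Rightarrow>\<^sub>0 nat)" where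
  "mon f = Abs_poly_mapping f"

lemma lookup_mon [simp]: "lookup (mon f) i = f i"
  by (simp add: mon_def)

definition mon_le :: "('n \<Rightarrow>\<^sub>0 nat) \<Rightarrow> ('n \<Rightarrow>\<^sub>0 nat) \<Rightarrow> bool" where
  "mon_le m m' \<longleftrightarrow> (\<forall>i. lookup m i \<le> lookup m' i)"

lemma mon_le_diff:
  assumes "mon_le m m'" shows "m + (m' - m) = m'" "(m' - m) + m = m'"
  using assms by (auto simp: mon_le_def lookup_add lookup_minus intro!: poly_mapping_eqI)

definition mon_scale :: "nat \<Rightarrow> ('n::finite \<Rightarrow>\<^sub>0 nat) \<Rightarrow> ('n \<Rightarrow>\<^sub>0 nat)" where
  "mon_scale q m = mon (\<lambda>i. q * lookup m i)"

lemma lookup_mon_scale [simp]: "lookup (mon_scale q m) i = q * lookup m i"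
  by (simp add: mon_scale_def)

definition mon_div :: "('n::finite \<Rightarrow>\<^sub>0 nat) \<Rightarrow> nat \<Rightarrow> ('n \<Rightarrow>\<^sub>0 nat)" where
  "mon_div m q = mon (\<lambda>i. lookup m i div q)"

definition mon_mod :: "('n::finite \<Rightarrow>\<^sub>0 nat) \<Rightarrow> nat \<Rightarrow> ('n \<Rightarrow>\<^sub>0 nat)" where
  "mon_mod m q = mon (\<lambda>i. lookup m i mod q)"

lemma lookup_mon_div [simp]: "lookup (mon_div m q) i = lookup m i div q"
  and lookup_mon_mod [simp]: "lookup (mon_mod m q) i = lookup m i mod q"
  by (simp_all add: mon_div_def mon_mod_def)

lemma mon_mod_div: "mon_mod m q + mon_scale q (mon_div m q) = m"
  by (rule poly_mapping_eqI) (simp add: lookup_add)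

lemma mon_residue_unique:
  assumes "\<forall>i. lookup a i < q" "a + mon_scale q t = m"
  shows "a = mon_mod m q \<and> t = mon_div m q"
proof -
  have "lookup m i = lookup a i + q * lookup t i" for i
    using arg_cong[OF assms(2), of "\<lambda>m. lookup m i"] by (simp add: lookup_add)
  then show ?thesis
    using assms(1) by (auto intro!: poly_mapping_eqI) (metis div_less less_zeroE add.right_neutral
        div_mult_self2 add.left_neutral not_gr_zero)
qed

lemma mon_le_residue:
  assumes "\<forall>i. lookup a i < q"
  shows "mon_le (mon_scale q u) (a + mon_scale q t) \<longleftrightarrow> mon_le u t"
proof -
  have "q * lookup u i \<le> lookup a i + q * lookup t i \<longleftrightarrow> lookup u i \<le> lookup t i" for i
  proof
    assume *: "q * lookup u i \<le> lookup a i + q * lookup t i"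
    have "lookup a i + q * lookup t i < q * Suc (lookup t i)" using assms by (simp add: add.commute)
    with * have "q * lookup u i < q * Suc (lookup t i)" by (rule le_less_trans)
    then show "lookup u i \<le> lookup t i" by (simp only: mult_less_cancel1 less_Suc_eq_le)
  next
    assume "lookup u i \<le> lookup t i"
    then show "q * lookup u i \<le> lookup a i + q * lookup t i" by (simp add: trans_le_add2)
  qed
  then show ?thesis by (simp add: mon_le_def lookup_add)
qed

lemma poly_mapping_sum_singles: "(\<Sum>m\<in>keys f. single m (lookup f m)) = f"
proof (rule poly_mapping_eqI)
  fix k
  have "lookup (\<Sum>m\<in>keys f. single m (lookup f m)) k = (\<Sum>m\<in>keys f. if m = k then lookup f m else 0)"
    by (simp add: lookup_sum lookup_single when_def)
  also have "\<dots> = lookup f k" by (simp add: in_keys_iff)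
  finally show "lookup (\<Sum>m\<in>keys f. single m (lookup f m)) k = lookup f k" .
qed

lemma lookup_single_mult:
  fixes f :: "('n::{finite,linorder} \<Rightarrow>\<^sub>0 nat) \<Rightarrow>\<^sub>0 'k::comm_ring_1"
  shows "lookup (single m c * f) k = (if mon_le m k then c * lookup f (k - m) else 0)"
proof -
  have eq: "m + k' = k \<longleftrightarrow> mon_le m k \<and> k' = k - m" for k'
    using mon_le_diff(1)[of m k] by (auto simp: mon_le_def lookup_add)
  have "single m c * f = (\<Sum>k'\<in>keys f. single (m + k') (c * lookup f k'))"
    by (subst (1) poly_mapping_sum_singles[symmetric, of f]) (simp add: sum_distrib_left mult_single)
  then have "lookup (single m c * f) k = (\<Sum>k'\<in>keys f. if m + k' = k then c * lookup f k' else 0)"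
    by (simp add: lookup_sum lookup_single when_def)
  also have "\<dots> = (if mon_le m k then c * lookup f (k - m) else 0)"
    unfolding eq by (simp add: in_keys_iff)
  finally show ?thesis .
qed

lemma single_power:
  fixes m :: "'n::finite \<Rightarrow>\<^sub>0 nat" and c :: "'k::comm_ring_1"
  shows "single m c ^ n = single (mon_scale n m) (c ^ n)"
proof (induction n)
  case 0
  have "mon_scale 0 m = 0" by (rule poly_mapping_eqI) simp
  then show ?case by simp
next
  case (Suc n)
  have "m + mon_scale n m = mon_scale (Suc n) m" by (rule poly_mapping_eqI) (simp add: lookup_add)
  then show ?case by (simp add: Suc mult_single)
qed

lemma CHAR_poly_mapping: "CHAR('a::comm_monoid_add \<Rightarrow>\<^sub>0 'k::comm_semiring_1) = CHAR('k)"
proof (rule CHAR_eqI)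
  show "of_nat CHAR('k) = (0 :: 'a \<Rightarrow>\<^sub>0 'k)" by (simp flip: single_of_nat)
  fix n assume "of_nat n = (0 :: 'a \<Rightarrow>\<^sub>0 'k)"
  then have "lookup (single (0 :: 'a) (of_nat n :: 'k)) 0 = 0" by (simp only: single_of_nat lookup_zero)
  then show "CHAR('k) dvd n" by (simp only: lookup_single_eq of_nat_eq_0_iff_char_dvd)
qed

text \<open>A basis of \<open>K\<close> over \<open>K\<^sup>q\<close>, with coordinates taken in \<open>K\<close> itself through the \<open>q\<close>-th root.\<close>

lemma field_frobenius_coordinates:
  assumes q: "q = CHAR('k::field) ^ e" and char: "CHAR('k::field) > 0"
  obtains \<pi> :: "'k::field \<Rightarrow> 'k \<Rightarrow> 'k"
  where "\<And>b x y. \<pi> b (x + y) = \<pi> b x + \<pi> b y" "\<And>b c x. \<pi> b (c ^ q * x) = c * \<pi> b x"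
    "\<And>x. finite {b. \<pi> b x \<noteq> 0}" "\<And>x. (\<Sum>b | \<pi> b x \<noteq> 0. b * \<pi> b x ^ q) = x"
proof -
  have prime: "prime CHAR('k)" using char by (simp add: prime_CHAR_semidom)
  \<comment> \<open>K acts on itself through q-th powers, so a basis for this action is a basis of K
    over K^q and the coordinates are already q-th roots. Additivity in the scalar is the freshman's
    dream.\<close>
  interpret V: vector_space "\<lambda>c x :: 'k. c ^ q * x"
    by unfold_locales
       (simp_all add: algebra_simps power_mult_distrib freshmans_dream'[OF prime q])
  obtain B where B: "V.independent B" "V.span B = UNIV"
    using V.independent_extend_basis[OF V.independent_empty] V.span_extend_basis[OF V.independent_empty] by blast
  show ?thesis
  proof (rule that[of "\<lambda>b x. V.representation B x b"])
    show "(\<Sum>b | V.representation B x b \<noteq> 0. b * V.representation B x b ^ q) = x" for x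
      using V.sum_nonzero_representation_eq[OF B(1), of x] B(2) by (simp add: mult.commute)
  qed (use B in \<open>simp_all add: V.representation_add V.representation_scale V.finite_representation\<close>)
qed

text \<open>The added axiom controls supports, so that an initial monomial with residue a modulo q
  can be followed through a coordinate in \<open>lm_frobenius_power\<close>.\<close>

locale mpoly_frobenius = flat_frobenius p coords
  for p :: nat and coords :: "nat \<Rightarrow> (('n::{finite,linorder}, 'k::field) mpoly \<Rightarrow> ('n, 'k) mpoly) set" +
  assumes coords_lookup: "\<And>a e h t0. \<forall>i. lookup a i < p ^ e \<Longrightarrow> lookup h (a + mon_scale (p ^ e) t0) \<noteq> 0 \<Longrightarrow>
    \<exists>\<phi>\<in>coords e. lookup (\<phi> h) t0 \<noteq> 0 \<and>
      (\<forall>t. lookup (\<phi> h) t \<noteq> 0 \<longrightarrow> lookup h (a + mon_scale (p ^ e) t) \<noteq> 0)"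

text \<open>Stated for a single q: existence is shown one exponent at a time, and a choice over e
  then yields the family \<open>coords\<close>.\<close>

definition frobenius_coordinates ::
    "nat \<Rightarrow> (('n::{finite,linorder}, 'k::field) mpoly \<Rightarrow> ('n, 'k) mpoly) set \<Rightarrow> bool" where
  "frobenius_coordinates q \<Phi> \<longleftrightarrow>
    (\<forall>\<phi>\<in>\<Phi>. \<forall>g h. \<phi> (g + h) = \<phi> g + \<phi> h) \<and>
    (\<forall>\<phi>\<in>\<Phi>. \<forall>g h. \<phi> (g ^ q * h) = g * \<phi> h) \<and>
    (\<forall>L h. is_ideal L \<longrightarrow> (h \<in> frobenius_power q L \<longleftrightarrow> (\<forall>\<phi>\<in>\<Phi>. \<phi> h \<in> L))) \<and>
    (\<forall>a h t0. (\<forall>i. lookup a i < q) \<longrightarrow> lookup h (a + mon_scale q t0) \<noteq> 0 \<longrightarrow>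
      (\<exists>\<phi>\<in>\<Phi>. lookup (\<phi> h) t0 \<noteq> 0 \<and>
        (\<forall>t. lookup (\<phi> h) t \<noteq> 0 \<longrightarrow> lookup h (a + mon_scale q t) \<noteq> 0)))"

lemma mpoly_coordinates_exist:
  assumes char: "CHAR('k::field) > 0" and q: "q = CHAR('k::field) ^ e"
  shows "\<exists>\<Phi> :: (('n::{finite,linorder}, 'k) mpoly \<Rightarrow> ('n, 'k) mpoly) set. frobenius_coordinates q \<Phi>"
proof -
  have prime: "prime CHAR('k)" using char by (simp add: prime_CHAR_semidom)
  have q0: "q > 0" using char by (simp add: q)
  have q_pow: "q = CHAR(('n, 'k) mpoly) ^ e" by (simp add: q CHAR_poly_mapping)
  have prime': "prime CHAR(('n, 'k) mpoly)" using prime by (simp add: CHAR_poly_mapping)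
  note frob_add = freshmans_dream'[OF prime' q_pow]
  note frob_sum = freshmans_dream_sum'[OF prime' q_pow]
  obtain \<pi> :: "'k \<Rightarrow> 'k \<Rightarrow> 'k" where \<pi>_add: "\<And>b x y. \<pi> b (x + y) = \<pi> b x + \<pi> b y"
    and \<pi>_mult: "\<And>b c x. \<pi> b (c ^ q * x) = c * \<pi> b x"
    and \<pi>_fin: "\<And>x. finite {b. \<pi> b x \<noteq> 0}"
    and \<pi>_sum: "\<And>x. (\<Sum>b | \<pi> b x \<noteq> 0. b * \<pi> b x ^ q) = x"
    using field_frobenius_coordinates[OF q char] by blast
  have \<pi>_0: "\<pi> b 0 = 0" for b using \<pi>_mult[of b 0 0] q0 by simp
  \<comment> \<open>The coordinate at the basis element b x^a of S over S^q: it collects the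
    monomials with residue a modulo q, divides what is left of their exponents by q, and takes the
    coordinate at b of the coefficients.\<close>
  define \<phi> :: "('n \<Rightarrow>\<^sub>0 nat) \<Rightarrow> 'k \<Rightarrow> ('n, 'k) mpoly \<Rightarrow> ('n, 'k) mpoly"
    where "\<phi> a b h = Abs_poly_mapping (\<lambda>t. \<pi> b (lookup h (a + mon_scale q t)))" for a b h
  have lookup_\<phi>: "lookup (\<phi> a b h) t = \<pi> b (lookup h (a + mon_scale q t))" for a b h t
  proof -
    have "inj (\<lambda>t :: 'n \<Rightarrow>\<^sub>0 nat. a + mon_scale q t)"
    proof (rule injI)
      fix t t' :: "'n \<Rightarrow>\<^sub>0 nat" assume "a + mon_scale q t = a + mon_scale q t'"
      then have "mon_scale q t = mon_scale q t'" by simp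
      then have "q * lookup t i = q * lookup t' i" for i by (metis lookup_mon_scale)
      then show "t = t'" using q0 by (intro poly_mapping_eqI) simp
    qed
    then have "finite ((\<lambda>t. a + mon_scale q t) -` keys h)" by (intro finite_vimageI) simp_all
    moreover have "{t. \<pi> b (lookup h (a + mon_scale q t)) \<noteq> 0} \<subseteq> (\<lambda>t. a + mon_scale q t) -` keys h"
      using \<pi>_0 by (auto simp: in_keys_iff)
    ultimately have "finite {t. \<pi> b (lookup h (a + mon_scale q t)) \<noteq> 0}" by (rule rev_finite_subset)
    then show ?thesis by (simp add: \<phi>_def)
  qed
  have \<phi>_add: "\<phi> a b (x + y) = \<phi> a b x + \<phi> a b y" for a b x y
    by (rule poly_mapping_eqI) (simp add: lookup_\<phi> lookup_add \<pi>_add)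
  have \<phi>_0: "\<phi> a b 0 = 0" for a b
    by (rule poly_mapping_eqI) (simp add: lookup_\<phi> \<pi>_0)
  have \<phi>_sum: "\<phi> a b (sum f A) = (\<Sum>i\<in>A. \<phi> a b (f i))" for a b and f :: "'c \<Rightarrow> _" and A
    by (induction A rule: infinite_finite_induct) (simp_all add: \<phi>_0 \<phi>_add)
  have \<phi>_mult: "\<phi> a b (g ^ q * h) = g * \<phi> a b h" if a: "\<forall>i. lookup a i < q" for a b g h
  proof -
    have single: "\<phi> a b (single u c ^ q * h) = single u c * \<phi> a b h" for u c
    proof (rule poly_mapping_eqI)
      fix t
      have "a + mon_scale q t - mon_scale q u = a + mon_scale q (t - u)" if "mon_le u t"
        using that by (intro poly_mapping_eqI)
          (simp add: lookup_add lookup_minus mon_le_def diff_mult_distrib2)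
      then show "lookup (\<phi> a b (single u c ^ q * h)) t = lookup (single u c * \<phi> a b h) t"
        by (simp add: lookup_\<phi> single_power lookup_single_mult mon_le_residue[OF a] \<pi>_mult \<pi>_0)
    qed
    have "g ^ q = (\<Sum>u\<in>keys g. single u (lookup g u) ^ q)"
      by (subst poly_mapping_sum_singles[symmetric, of g]) (rule frob_sum)
    then have "\<phi> a b (g ^ q * h) = (\<Sum>u\<in>keys g. single u (lookup g u) * \<phi> a b h)"
      by (simp add: sum_distrib_right \<phi>_sum single)
    also have "\<dots> = g * \<phi> a b h"
      by (simp add: sum_distrib_right[symmetric] poly_mapping_sum_singles)
    finally show ?thesis .
  qed
  let ?\<Phi> = "{\<phi> a b |a b. \<forall>i. lookup a i < q}"
  have expand: "h \<in> frobenius_power q L" if L: "\<And>a b. \<forall>i. lookup a i < q \<Longrightarrow> \<phi> a b h \<in> L" for h L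
  proof -
    \<comment> \<open>Finitely many residues and basis elements of K occur in h, so the expansion of
      h as the sum of all b x^a \<phi>(h)^q is finite even when K is infinite over K^q.\<close>
    define A where "A = (\<lambda>m. mon_mod m q) ` keys h"
    define B where "B = (\<Union>m\<in>keys h. {b. \<pi> b (lookup h m) \<noteq> 0})"
    have fin: "finite A" "finite B" using \<pi>_fin by (auto simp: A_def B_def)
    have A: "lookup a i < q" if "a \<in> A" for a i using that q0 by (auto simp: A_def)
    have expand_single: "(\<Sum>a\<in>A. \<Sum>b\<in>B. single a b * \<phi> a b (single m (lookup h m)) ^ q)
        = single m (lookup h m)" if m: "m \<in> keys h" for m
    proof -
      let ?c = "lookup h m"
      have \<phi>_single: "\<phi> a b (single m ?c) = (if a = mon_mod m q then single (mon_div m q) (\<pi> b ?c) else 0)"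
        if "a \<in> A" for a b
      proof (rule poly_mapping_eqI)
        fix t
        have "m = a + mon_scale q t \<longleftrightarrow> a = mon_mod m q \<and> mon_div m q = t"
          using mon_residue_unique[of a q t m] A[OF that] mon_mod_div[of m q] by metis
        then show "lookup (\<phi> a b (single m ?c)) t
            = lookup (if a = mon_mod m q then single (mon_div m q) (\<pi> b ?c) else 0) t"
          by (auto simp: lookup_\<phi> lookup_single when_def \<pi>_0)
      qed
      have "(\<Sum>a\<in>A. \<Sum>b\<in>B. single a b * \<phi> a b (single m ?c) ^ q)
          = (\<Sum>a\<in>A. if a = mon_mod m q
              then \<Sum>b\<in>B. single a b * single (mon_div m q) (\<pi> b ?c) ^ q else 0)"
        using q0 by (intro sum.cong refl) (simp add: \<phi>_single power_0_left)
      also have "\<dots> = (\<Sum>b\<in>B. single (mon_mod m q) b * single (mon_div m q) (\<pi> b ?c) ^ q)"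
        using fin m by (simp add: A_def)
      also have "\<dots> = (\<Sum>b\<in>B. single m (b * \<pi> b ?c ^ q))"
        by (simp add: single_power mult_single mon_mod_div)
      also have "\<dots> = single m (\<Sum>b\<in>B. b * \<pi> b ?c ^ q)"
        by (rule poly_mapping_eqI) (simp add: lookup_sum lookup_single when_def)
      also have "(\<Sum>b\<in>B. b * \<pi> b ?c ^ q) = (\<Sum>b | \<pi> b ?c \<noteq> 0. b * \<pi> b ?c ^ q)"
        using fin m q0 by (intro sum.mono_neutral_right) (auto simp: B_def)
      finally show ?thesis by (simp only: \<pi>_sum)
    qed
    have "(\<Sum>a\<in>A. \<Sum>b\<in>B. single a b * \<phi> a b h ^ q)
        = (\<Sum>a\<in>A. \<Sum>b\<in>B. \<Sum>m\<in>keys h. single a b * \<phi> a b (single m (lookup h m)) ^ q)"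
      by (subst (1) poly_mapping_sum_singles[symmetric, of h])
         (simp only: \<phi>_sum frob_sum sum_distrib_left)
    also have "\<dots> = (\<Sum>m\<in>keys h. \<Sum>a\<in>A. \<Sum>b\<in>B. single a b * \<phi> a b (single m (lookup h m)) ^ q)"
      by (simp only: sum.swap[of _ "keys h"])
    also have "\<dots> = h" by (simp add: expand_single poly_mapping_sum_singles)
    finally have "h = (\<Sum>a\<in>A. \<Sum>b\<in>B. single a b * \<phi> a b h ^ q)" by (rule sym)
    also have "\<dots> \<in> frobenius_power q L"
    proof (intro ideal_sum[OF frobenius_power_ideal])
      fix a b assume "a \<in> A"
      then show "single a b * \<phi> a b h ^ q \<in> frobenius_power q L"
        using A L by (intro ideal_mult[OF frobenius_power_ideal] power_mem_frobenius_power) blast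
    qed
    finally show ?thesis .
  qed
  have "frobenius_coordinates q ?\<Phi>"
    unfolding frobenius_coordinates_def
  proof (intro conjI ballI allI impI)
    fix f g h assume "f \<in> ?\<Phi>"
    then obtain a b where f: "f = \<phi> a b" "\<forall>i. lookup a i < q" by blast
    show "f (g + h) = f g + f h" "f (g ^ q * h) = g * f h"
      unfolding f(1) by (rule \<phi>_add, rule \<phi>_mult[OF f(2)])
  next
    fix L :: "('n, 'k) mpoly set" and h assume L: "is_ideal L"
    show "h \<in> frobenius_power q L \<longleftrightarrow> (\<forall>f\<in>?\<Phi>. f h \<in> L)"
    proof
      assume "h \<in> frobenius_power q L"
      then obtain F where F: "finite F" "F \<subseteq> {f ^ q |f. f \<in> L}" "h \<in> idl F"
        unfolding frobenius_power_def by (rule idl_finite_subset)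
      then obtain r where r: "h = (\<Sum>f\<in>F. r f * f)"
        unfolding idl_finite_explicit[OF F(1)] by blast
      show "\<forall>f\<in>?\<Phi>. f h \<in> L"
      proof clarify
        fix a :: "'n \<Rightarrow>\<^sub>0 nat" and b assume a: "\<forall>i. lookup a i < q"
        have "\<phi> a b (r f * f) \<in> L" if fF: "f \<in> F" for f
        proof -
          obtain g where g: "f = g ^ q" "g \<in> L" using F(2) fF by blast
          have "\<phi> a b (r f * f) = g * \<phi> a b (r f)"
            using \<phi>_mult[OF a, of b g "r f"] by (simp add: g(1) mult.commute)
          then show ?thesis using ideal_mult_right[OF L g(2)] by simp
        qed
        then show "\<phi> a b h \<in> L" unfolding r \<phi>_sum by (intro ideal_sum[OF L])
      qed
    next
      assume *: "\<forall>f\<in>?\<Phi>. f h \<in> L"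
      show "h \<in> frobenius_power q L"
      proof (rule expand)
        fix a :: "'n \<Rightarrow>\<^sub>0 nat" and b assume "\<forall>i. lookup a i < q"
        then have "\<phi> a b \<in> ?\<Phi>" by blast
        then show "\<phi> a b h \<in> L" by (rule bspec[OF *])
      qed
    qed
  next
    fix a :: "'n \<Rightarrow>\<^sub>0 nat" and h :: "('n, 'k) mpoly" and t0
    assume a: "\<forall>i. lookup a i < q" and nz: "lookup h (a + mon_scale q t0) \<noteq> 0"
    have "\<exists>b. \<pi> b (lookup h (a + mon_scale q t0)) \<noteq> 0"
    proof (rule ccontr)
      assume "\<not> ?thesis"
      then show False using \<pi>_sum[of "lookup h (a + mon_scale q t0)"] nz by simp
    qed
    then obtain b where "\<pi> b (lookup h (a + mon_scale q t0)) \<noteq> 0" by blast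
    moreover have "lookup h (a + mon_scale q t) \<noteq> 0" if "lookup (\<phi> a b h) t \<noteq> 0" for t
      using that \<pi>_0 by (auto simp: lookup_\<phi>)
    ultimately show "\<exists>f\<in>?\<Phi>. lookup (f h) t0 \<noteq> 0 \<and>
        (\<forall>t. lookup (f h) t \<noteq> 0 \<longrightarrow> lookup h (a + mon_scale q t) \<noteq> 0)"
      using a by (intro bexI[of _ "\<phi> a b"]) (auto simp: lookup_\<phi>)
  qed
  then show ?thesis by blast
qed

lemma mpoly_frobenius_exists:
  assumes char: "CHAR('k::field) > 0"
  obtains coords :: "nat \<Rightarrow> (('n::{finite,linorder}, 'k::field) mpoly \<Rightarrow> ('n, 'k) mpoly) set"
  where "mpoly_frobenius CHAR('k::field) coords"
proof -
  obtain coords :: "nat \<Rightarrow> (('n, 'k) mpoly \<Rightarrow> ('n, 'k) mpoly) set"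
    where c: "\<And>e. frobenius_coordinates (CHAR('k) ^ e) (coords e)"
    using mpoly_coordinates_exist[OF char refl] by metis
  note c' = c[unfolded frobenius_coordinates_def]
  note c1 = c'[THEN conjunct1, rule_format]
    and c2 = c'[THEN conjunct2, THEN conjunct1, rule_format]
    and c3 = c'[THEN conjunct2, THEN conjunct2, THEN conjunct1, rule_format]
    and c4 = c'[THEN conjunct2, THEN conjunct2, THEN conjunct2, rule_format]
  have prime: "prime CHAR('k)" using char by (simp add: prime_CHAR_semidom)
  have "mpoly_frobenius CHAR('k) coords"
  proof
    show "CHAR('k) > 1" using prime prime_gt_1_nat by blast
    show "(x + y) ^ (CHAR('k) ^ e) = x ^ (CHAR('k) ^ e) + y ^ (CHAR('k) ^ e)" for x y :: "('n, 'k) mpoly" and e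
      by (rule freshmans_dream'[where n = e]) (use prime in \<open>simp_all add: CHAR_poly_mapping\<close>)
  next
    fix e \<phi> and g h :: "('n, 'k) mpoly" assume \<phi>: "\<phi> \<in> coords e"
    show "\<phi> (g + h) = \<phi> g + \<phi> h" by (rule c1[OF \<phi>])
    show "\<phi> (g ^ (CHAR('k) ^ e) * h) = g * \<phi> h" by (rule c2[OF \<phi>])
  next
    fix L :: "('n, 'k) mpoly set" and e h assume "is_ideal L"
    then show "h \<in> frobenius_power (CHAR('k) ^ e) L \<longleftrightarrow> (\<forall>\<phi>\<in>coords e. \<phi> h \<in> L)"
      by (rule c3)
  next
    fix a :: "'n \<Rightarrow>\<^sub>0 nat" and e and h :: "('n, 'k) mpoly" and t0
    assume "\<forall>i. lookup a i < CHAR('k) ^ e" "lookup h (a + mon_scale (CHAR('k) ^ e) t0) \<noteq> 0"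
    then show "\<exists>\<phi>\<in>coords e. lookup (\<phi> h) t0 \<noteq> 0 \<and>
        (\<forall>t. lookup (\<phi> h) t \<noteq> 0 \<longrightarrow> lookup h (a + mon_scale (CHAR('k) ^ e) t) \<noteq> 0)"
      using c4 by simp
  qed
  then show ?thesis by (rule that)
qed

section \<open>Monomial orders\<close>

text \<open>A monotone subsequence always exists; a decreasing one is constant from an index of
  least value on.\<close>

lemma nat_seq_mono_subseq:
  fixes g :: "nat \<Rightarrow> nat"
  shows "\<exists>\<phi> :: nat \<Rightarrow> nat. strict_mono \<phi> \<and> (\<forall>i j. i \<le> j \<longrightarrow> g (\<phi> i) \<le> g (\<phi> j))"
proof -
  obtain \<psi> :: "nat \<Rightarrow> nat" where \<psi>: "strict_mono \<psi>" "monoseq (\<lambda>n. g (\<psi> n))"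
    using seq_monosub by blast
  show ?thesis
  proof (cases "incseq (\<lambda>n. g (\<psi> n))")
    case True
    then show ?thesis using \<psi>(1) by (auto simp: incseq_def)
  next
    case False
    then have dec: "\<And>m n. m \<le> n \<Longrightarrow> g (\<psi> n) \<le> g (\<psi> m)"
      using \<psi>(2) by (auto simp: monoseq_iff decseq_def)
    define N where "N = (ARG_MIN (\<lambda>n. g (\<psi> n)) n. True)"
    have N: "g (\<psi> N) \<le> g (\<psi> n)" for n
      unfolding N_def using arg_min_nat_le[of "\<lambda>_. True" n "\<lambda>n. g (\<psi> n)"] by simp
    have "strict_mono (\<lambda>n. \<psi> (n + N))" using \<psi>(1) by (simp add: strict_mono_def)
    moreover have "g (\<psi> (i + N)) \<le> g (\<psi> (j + N))" for i j
      using order_trans[OF dec[of N "i + N"] N[of "j + N"]] by simp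
    ultimately show ?thesis by blast
  qed
qed

text \<open>Subsequences are refined for one variable after another until every exponent is
  nondecreasing.\<close>

lemma dickson:
  fixes f :: "nat \<Rightarrow> ('n::finite \<Rightarrow>\<^sub>0 nat)"
  obtains i j where "i < j" "mon_le (f i) (f j)"
proof -
  have "\<exists>\<phi> :: nat \<Rightarrow> nat. strict_mono \<phi> \<and>
      (\<forall>v\<in>V. \<forall>i j. i \<le> j \<longrightarrow> lookup (f (\<phi> i)) v \<le> lookup (f (\<phi> j)) v)" for V
    using finite[of V]
  proof (induction V rule: finite_induct)
    case empty
    show ?case by (intro exI[of _ id]) (simp add: strict_mono_def)
  next
    case (insert v V)
    from insert.IH obtain \<phi> :: "nat \<Rightarrow> nat" where \<phi>: "strict_mono \<phi>"
      "\<And>v i j. v \<in> V \<Longrightarrow> i \<le> j \<Longrightarrow> lookup (f (\<phi> i)) v \<le> lookup (f (\<phi> j)) v" by blast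
    obtain \<psi> :: "nat \<Rightarrow> nat" where \<psi>: "strict_mono \<psi>"
      "\<And>i j. i \<le> j \<Longrightarrow> lookup (f (\<phi> (\<psi> i))) v \<le> lookup (f (\<phi> (\<psi> j))) v"
      using nat_seq_mono_subseq[of "\<lambda>i. lookup (f (\<phi> i)) v"] by blast
    have "lookup (f (\<phi> (\<psi> i))) w \<le> lookup (f (\<phi> (\<psi> j))) w" if w: "w \<in> insert v V" "i \<le> j" for w i j
    proof (cases "w = v")
      case True
      then show ?thesis using \<psi>(2)[OF w(2)] by (simp only:)
    next
      case False
      have "\<psi> i \<le> \<psi> j" using strict_mono_less_eq[OF \<psi>(1)] w(2) by (simp only:)
      then show ?thesis using \<phi>(2) w(1) False by blast
    qed
    note mono = this
    show ?case
    proof (intro exI conjI ballI allI impI)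
      show "strict_mono (\<phi> \<circ> \<psi>)" using \<phi>(1) \<psi>(1) by (rule strict_mono_o)
    next
      fix w and i j :: nat assume "w \<in> insert v V" "i \<le> j"
      then show "lookup (f ((\<phi> \<circ> \<psi>) i)) w \<le> lookup (f ((\<phi> \<circ> \<psi>) j)) w"
        unfolding o_apply by (rule mono)
    qed
  qed
  from this[of UNIV] obtain \<phi> :: "nat \<Rightarrow> nat" where "strict_mono \<phi>"
    "\<And>v i j. i \<le> j \<Longrightarrow> lookup (f (\<phi> i)) v \<le> lookup (f (\<phi> j)) v" by blast
  then have "\<phi> 0 < \<phi> 1" "mon_le (f (\<phi> 0)) (f (\<phi> 1))"
    by (simp_all add: mon_le_def strict_mono_def)
  then show ?thesis by (rule that)
qed

section \<open>Initial monomials\<close>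

locale monomial_order =
  fixes r :: "(('n::{finite,linorder} \<Rightarrow>\<^sub>0 nat) \<times> ('n \<Rightarrow>\<^sub>0 nat)) set"
  assumes term_order: "term_order r"
begin

abbreviation le (infix \<open>\<preceq>\<close> 50) where "m \<preceq> m' \<equiv> (m, m') \<in> r"

abbreviation lm :: "('n, 'k::zero) mpoly \<Rightarrow> ('n \<Rightarrow>\<^sub>0 nat)" where
  "lm F \<equiv> initial_monomial r F"

lemma le_refl: "m \<preceq> m"
  and le_trans: "a \<preceq> b \<Longrightarrow> b \<preceq> c \<Longrightarrow> a \<preceq> c"
  and le_antisym: "a \<preceq> b \<Longrightarrow> b \<preceq> a \<Longrightarrow> a = b"
  and le_total: "a \<preceq> b \<or> b \<preceq> a"
  and le_zero: "0 \<preceq> m"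
  and le_add: "a \<preceq> b \<Longrightarrow> a + t \<preceq> b + t"
proof -
  have lin: "linear_order r" using term_order by (simp add: term_order_def)
  then show refl: "m \<preceq> m" for m by (auto simp: order_on_defs refl_on_def)
  show "a \<preceq> b \<Longrightarrow> b \<preceq> c \<Longrightarrow> a \<preceq> c"
    using lin by (auto simp: order_on_defs dest: transD)
  show "a \<preceq> b \<Longrightarrow> b \<preceq> a \<Longrightarrow> a = b" using lin by (auto simp: order_on_defs dest: antisymD)
  show "a \<preceq> b \<or> b \<preceq> a"
    using lin refl by (cases "a = b") (auto simp: order_on_defs total_on_def)
  show "0 \<preceq> m" "a \<preceq> b \<Longrightarrow> a + t \<preceq> b + t"
    using term_order by (simp_all add: term_order_def)
qed

lemma le_add_cancel: assumes "a + t \<preceq> b + t" shows "a \<preceq> b"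
proof (rule ccontr)
  assume "\<not> a \<preceq> b"
  then have "b \<preceq> a" using le_total by blast
  then have "a + t = b + t" using le_add le_antisym assms by blast
  then show False using \<open>\<not> a \<preceq> b\<close> le_refl by simp
qed

lemma le_add_mono: assumes "a \<preceq> b" "c \<preceq> d" shows "a + c \<preceq> b + d"
proof -
  have "a + c \<preceq> b + c" "c + b \<preceq> d + b" using assms by (auto intro: le_add)
  then show ?thesis using le_trans by (metis add.commute)
qed

lemma mon_le_imp_le: assumes "mon_le a b" shows "a \<preceq> b"
  using le_add[OF le_zero[of "b - a"], of a] mon_le_diff(2)[OF assms] by simp

lemma le_scale: assumes "a \<preceq> b" shows "mon_scale n a \<preceq> mon_scale n b"
proof (induction n)
  case 0
  have "mon_scale 0 a = mon_scale 0 b" by (rule poly_mapping_eqI) simp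
  then show ?case by (simp add: le_refl)
next
  case (Suc n)
  have "mon_scale (Suc n) m = m + mon_scale n m" for m :: "'n \<Rightarrow>\<^sub>0 nat"
    by (rule poly_mapping_eqI) (simp add: lookup_add)
  then show ?case using le_add_mono[OF assms Suc] by simp
qed

lemma le_scale_cancel: assumes "mon_scale n a \<preceq> mon_scale n b" "n > 0" shows "a \<preceq> b"
proof (rule ccontr)
  assume *: "\<not> a \<preceq> b"
  then have "b \<preceq> a" using le_total by blast
  then have eq: "mon_scale n a = mon_scale n b" by (intro le_antisym assms le_scale)
  have "lookup a i = lookup b i" for i
    using arg_cong[OF eq, of "\<lambda>m. lookup m i"] assms(2) by simp
  then have "a = b" by (rule poly_mapping_eqI)
  then show False using * le_refl by simp
qed

text \<open>By Dickson's lemma an infinite descent contains a monomial dividing a later one, hence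
  below it in the order.\<close>

lemma wf_less: "wf {(a, b). a \<preceq> b \<and> a \<noteq> b}"
  unfolding wf_iff_no_infinite_down_chain
proof
  assume "\<exists>f. \<forall>i. (f (Suc i), f i) \<in> {(a, b). a \<preceq> b \<and> a \<noteq> b}"
  then obtain f where f: "\<And>i. f (Suc i) \<preceq> f i" "\<And>i. f (Suc i) \<noteq> f i" by auto
  have dec: "f j \<preceq> f i" if "i \<le> j" for i j
    using that by (induction j rule: dec_induct) (auto intro: le_refl le_trans f(1))
  obtain i j where ij: "i < j" "mon_le (f i) (f j)" by (rule dickson)
  have "f i \<preceq> f (Suc i)"
    using mon_le_imp_le[OF ij(2)] dec[of "Suc i" j] ij(1) le_trans by (meson Suc_leI)
  then show False using f le_antisym by blast
qed

lemma finite_has_max: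
  assumes "finite A" "A \<noteq> {}" obtains m where "m \<in> A" "\<And>m'. m' \<in> A \<Longrightarrow> m' \<preceq> m"
proof -
  have "\<exists>m\<in>A. \<forall>m'\<in>A. m' \<preceq> m"
    using assms
  proof (induction rule: finite_ne_induct)
    case (insert x F)
    then obtain m where m: "m \<in> F" "\<forall>m'\<in>F. m' \<preceq> m" by blast
    show ?case
    proof (cases "x \<preceq> m")
      case True then show ?thesis using m by blast
    next
      case False
      then have "m \<preceq> x" using le_total by blast
      then show ?thesis using m le_refl le_trans by blast
    qed
  qed (simp add: le_refl)
  then show ?thesis using that by blast
qed

lemma lm_eqI: "m \<in> keys F \<Longrightarrow> (\<And>m'. m' \<in> keys F \<Longrightarrow> m' \<preceq> m) \<Longrightarrow> lm F = m"
  unfolding initial_monomial_def by (rule the_equality) (auto intro: le_antisym)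

lemma lm_props: assumes "F \<noteq> 0" shows "lm F \<in> keys F" "m \<in> keys F \<Longrightarrow> m \<preceq> lm F"
proof -
  obtain m0 where m0: "m0 \<in> keys F" "\<And>m'. m' \<in> keys F \<Longrightarrow> m' \<preceq> m0"
    using finite_has_max[of "keys F"] assms by auto
  then have "lm F = m0" by (rule lm_eqI)
  with m0 show "lm F \<in> keys F" "m \<in> keys F \<Longrightarrow> m \<preceq> lm F" by auto
qed

lemma lm_mult:
  fixes F G :: "('n, 'k::idom) mpoly"
  assumes "F \<noteq> 0" "G \<noteq> 0" shows "lm (F * G) = lm F + lm G"
proof (rule lm_eqI)
  fix m assume "m \<in> keys (F * G)"
  then obtain i j where "m = i + j" "i \<in> keys F" "j \<in> keys G" using keys_mult by blast
  then show "m \<preceq> lm F + lm G" using lm_props assms by (auto intro: le_add_mono)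
next
  let ?a = "lm F" and ?b = "lm G"
  have "F * G = (\<Sum>i\<in>keys F. single i (lookup F i) * G)"
    by (simp add: sum_distrib_right[symmetric] poly_mapping_sum_singles)
  then have "lookup (F * G) (?a + ?b) = (\<Sum>i\<in>keys F. lookup (single i (lookup F i) * G) (?a + ?b))"
    by (simp add: lookup_sum)
  also have "\<dots> = lookup (single ?a (lookup F ?a) * G) (?a + ?b) +
      (\<Sum>i\<in>keys F - {?a}. lookup (single i (lookup F i) * G) (?a + ?b))"
    using lm_props(1)[OF assms(1)] by (intro sum.remove) auto
  also have "(\<Sum>i\<in>keys F - {?a}. lookup (single i (lookup F i) * G) (?a + ?b)) = 0"
  proof (intro sum.neutral ballI)
    fix i assume i: "i \<in> keys F - {?a}"
    show "lookup (single i (lookup F i) * G) (?a + ?b) = 0"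
    proof (rule ccontr)
      assume "lookup (single i (lookup F i) * G) (?a + ?b) \<noteq> 0"
      then have le: "mon_le i (?a + ?b)" and key: "?a + ?b - i \<in> keys G"
        by (auto simp: lookup_single_mult in_keys_iff split: if_splits)
      let ?j = "?a + ?b - i"
      have ij: "i + ?j = ?a + ?b" by (rule mon_le_diff(1)[OF le])
      have "i + ?j \<preceq> ?a + ?j" using lm_props(2)[OF assms(1)] i by (auto intro: le_add)
      moreover have "?a + ?j \<preceq> i + ?j"
        unfolding ij using lm_props(2)[OF assms(2) key] by (intro le_add_mono le_refl)
      ultimately have "i + ?j = ?a + ?j" by (rule le_antisym)
      then show False using i by simp
    qed
  qed
  also have "lookup (single ?a (lookup F ?a) * G) (?a + ?b) = lookup F ?a * lookup G ?b"
    by (simp add: lookup_single_mult mon_le_def lookup_add)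
  finally show "?a + ?b \<in> keys (F * G)"
    using lm_props(1)[OF assms(1)] lm_props(1)[OF assms(2)] by (simp add: in_keys_iff)
qed

lemma lm_power:
  fixes F :: "('n, 'k::idom) mpoly"
  assumes "F \<noteq> 0" shows "lm (F ^ n) = mon_scale n (lm F)"
proof (induction n)
  case 0
  have "mon_scale 0 (lm F) = 0" by (rule poly_mapping_eqI) simp
  moreover have "lm (1 :: ('n, 'k) mpoly) = 0" by (rule lm_eqI) (simp_all add: le_refl)
  ultimately show ?case by simp
next
  case (Suc n)
  have "lm F + mon_scale n (lm F) = mon_scale (Suc n) (lm F)"
    by (rule poly_mapping_eqI) (simp add: lookup_add)
  then show ?case using Suc assms by (simp add: lm_mult)
qed

text \<open>The hypothesis says that the two initial ideals agree. Subtracting a multiple of g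
  cancels the leading term of f and leaves an element of J' with smaller initial monomial, to which
  well-founded induction applies.\<close>

lemma ideal_eqI_lm:
  fixes J J' :: "('n, 'k::field) mpoly set"
  assumes J: "is_ideal J" and J': "is_ideal J'" and sub: "J \<subseteq> J'"
    and lm: "\<And>f. f \<in> J' \<Longrightarrow> f \<noteq> 0 \<Longrightarrow> \<exists>g\<in>J. g \<noteq> 0 \<and> mon_le (lm g) (lm f)"
  shows "J = J'"
proof -
  have "f \<in> J' \<longrightarrow> f \<noteq> 0 \<longrightarrow> lm f = m \<longrightarrow> f \<in> J" for m f
  proof (induction m arbitrary: f rule: wf_induct_rule[OF wf_less])
    case (1 m)
    show ?case
    proof (intro impI)
      assume f: "f \<in> J'" "f \<noteq> 0" and m: "lm f = m"
      obtain g where g: "g \<in> J" "g \<noteq> 0" "mon_le (lm g) (lm f)" using lm f by blast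
      define t where "t = lm f - lm g"
      define s where "s = single t (lookup f (lm f) / lookup g (lm g))"
      have t: "t + lm g = lm f" unfolding t_def by (rule mon_le_diff(2)[OF g(3)])
      have lc: "lookup f (lm f) \<noteq> 0" "lookup g (lm g) \<noteq> 0"
        using lm_props(1)[OF f(2)] lm_props(1)[OF g(2)] by (simp_all add: in_keys_iff)
      have sg: "s * g \<in> J" by (rule ideal_mult[OF J g(1)])
      have f': "f - s * g \<in> J'" using f sg sub by (intro ideal_diff[OF J']) auto
      have diff: "lm f - t = lm g" using t by (metis add_diff_cancel_left')
      have "mon_le t (lm f)" unfolding t[symmetric] by (simp add: mon_le_def lookup_add)
      then have "lookup (s * g) (lm f) = lookup f (lm f) / lookup g (lm g) * lookup g (lm g)"
        by (simp only: s_def lookup_single_mult if_True diff)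
      also have "\<dots> = lookup f (lm f)" using lc by simp
      finally have zero: "lookup (f - s * g) (lm f) = 0" by (simp add: lookup_minus)
      have "f - s * g \<in> J"
      proof (cases "f - s * g = 0")
        case True then show ?thesis using ideal_zero[OF J] by simp
      next
        case False
        have "k \<preceq> lm f" if "k \<in> keys (f - s * g)" for k
        proof (cases "k \<in> keys f")
          case True then show ?thesis using lm_props(2)[OF f(2)] by blast
        next
          case False
          with that have "lookup (s * g) k \<noteq> 0" by (auto simp: in_keys_iff lookup_minus)
          then have le: "mon_le t k" and "k - t \<in> keys g"
            by (auto simp: s_def lookup_single_mult in_keys_iff split: if_splits)
          then have "k - t + t \<preceq> lm g + t" using lm_props(2)[OF g(2)] by (intro le_add)
          then show ?thesis using mon_le_diff(2)[OF le] t by (simp add: add.commute)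
        qed
        then have "lm (f - s * g) \<preceq> lm f" using lm_props(1)[OF False] by blast
        moreover have "lm (f - s * g) \<noteq> lm f"
          using lm_props(1)[OF False] zero by (auto simp: in_keys_iff)
        ultimately show ?thesis using "1.IH" m f' False by blast
      qed
      then have "(f - s * g) + s * g \<in> J" using sg by (rule ideal_add[OF J])
      then show "f \<in> J" by simp
    qed
  qed
  then have "J' \<subseteq> J" using ideal_zero[OF J] by blast
  with sub show ?thesis by (rule equalityI)
qed

text \<open>The minimal elements for divisibility: Dickson's lemma bars infinitely many, and
  well-foundedness of the term order finds one below each m.\<close>

lemma monomial_basis:
  fixes M :: "('n \<Rightarrow>\<^sub>0 nat) set"
  shows "\<exists>M0\<subseteq>M. finite M0 \<and> (\<forall>m\<in>M. \<exists>m0\<in>M0. mon_le m0 m)"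
proof -
  let ?M0 = "{m \<in> M. \<forall>m'\<in>M. mon_le m' m \<longrightarrow> m' = m}"
  have "finite ?M0"
  proof (rule ccontr)
    assume "infinite ?M0"
    then obtain f :: "nat \<Rightarrow> 'n \<Rightarrow>\<^sub>0 nat" where f: "inj f" "range f \<subseteq> ?M0"
      using infinite_countable_subset by blast
    obtain i j where ij: "i < j" "mon_le (f i) (f j)" by (rule dickson)
    have "f i \<in> M" "f j \<in> ?M0" using f(2) by blast+
    then have "f i = f j" using ij(2) by blast
    then show False using f(1) ij(1) by (simp add: inj_eq)
  qed
  moreover have "\<exists>m0\<in>?M0. mon_le m0 m" if m: "m \<in> M" for m
  proof -
    have "m \<in> {m' \<in> M. mon_le m' m}" using m by (simp add: mon_le_def)
    from wf_less[unfolded wf_eq_minimal, THEN spec, THEN spec, THEN mp, OF this]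
    obtain z where z: "z \<in> M" "mon_le z m"
      and min: "\<forall>y. y \<preceq> z \<and> y \<noteq> z \<longrightarrow> \<not> (y \<in> M \<and> mon_le y m)"
      by auto
    have "m' = z" if "m' \<in> M" "mon_le m' z" for m'
    proof (rule ccontr)
      assume ne: "m' \<noteq> z"
      have "mon_le m' m" using that(2) z(2) unfolding mon_le_def by (meson order_trans)
      then show False using min mon_le_imp_le[OF that(2)] ne that(1) by blast
    qed
    then show ?thesis using z by blast
  qed
  ultimately show ?thesis by (intro exI[of _ ?M0]) blast
qed

text \<open>Hilbert's basis theorem: elements realizing the finitely many minimal initial monomials
  form a Groebner basis.\<close>

lemma ideal_finitely_generated:
  fixes I :: "('n, 'k::field) mpoly set"
  assumes I: "is_ideal I" obtains B where "finite B" "I = idl B"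
proof -
  obtain M0 where M0: "finite M0" "M0 \<subseteq> lm ` (I - {0})"
    "\<And>m. m \<in> lm ` (I - {0}) \<Longrightarrow> \<exists>m0\<in>M0. mon_le m0 m"
    using monomial_basis[of "lm ` (I - {0})"] by blast
  obtain B where B: "B \<subseteq> I - {0}" "finite B" "M0 = lm ` B"
    using finite_subset_image[OF M0(1,2)] by blast
  have "idl B = I"
  proof (rule ideal_eqI_lm[OF idl_ideal I])
    show "idl B \<subseteq> I" using B by (intro idl_minimal[OF I]) blast
  next
    fix f assume "f \<in> I" "f \<noteq> 0"
    then obtain b where "b \<in> B" "mon_le (lm b) (lm f)" using M0(3)[of "lm f"] B(3) by auto
    then show "\<exists>g\<in>idl B. g \<noteq> 0 \<and> mon_le (lm g) (lm f)"
      using B(1) by (intro bexI[of _ b]) (auto intro: idl_base)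
  qed
  then show ?thesis using that B(2) by blast
qed

lemma ideal_UNIV_if_lm_0:
  fixes A :: "('n, 'k::field) mpoly set"
  assumes A: "is_ideal A" and g: "g \<in> A" "g \<noteq> 0" "lm g = 0"
  shows "A = UNIV"
proof -
  have m0: "m = 0" if "m \<in> keys g" for m
    by (rule le_antisym[OF lm_props(2)[OF g(2) that, unfolded g(3)] le_zero])
  have keys: "keys g = {0}"
    using m0 lm_props(1)[OF g(2)] unfolding g(3) by (intro equalityI subsetI) simp_all
  have "g = single 0 (lookup g 0)"
    using poly_mapping_sum_singles[of g] unfolding keys by simp
  then have "single 0 (1 / lookup g 0) * g = single 0 (1 / lookup g 0) * single 0 (lookup g 0)"
    by (rule arg_cong)
  also have "\<dots> = single (0 + 0) (1 / lookup g 0 * lookup g 0)" by (rule mult_single)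
  also have "\<dots> = 1" using lm_props(1)[OF g(2)] unfolding g(3) by (simp add: in_keys_iff)
  finally have "1 \<in> A" using ideal_mult[OF A g(1), of "single 0 (1 / lookup g 0)"] by simp
  then show ?thesis using ideal_eq_UNIV_iff[OF A] by blast
qed

end

section \<open>Initial monomials under Frobenius coordinates\<close>

locale mpoly_frobenius_order = mpoly_frobenius p coords + monomial_order r
  for p :: nat and coords :: "nat \<Rightarrow> (('n::{finite,linorder}, 'k::field) mpoly \<Rightarrow> ('n, 'k) mpoly) set"
    and r :: "(('n \<Rightarrow>\<^sub>0 nat) \<times> ('n \<Rightarrow>\<^sub>0 nat)) set"
begin

text \<open>Every monomial t of the coordinate chosen by \<open>coords_lookup\<close> comes from a
  monomial a + q t of G, where a is the residue of lm G modulo q. The order is compatible with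
  adding a and with scaling by q, so the largest t is the one that comes from lm G.\<close>

lemma lm_frobenius_power:
  fixes A :: "('n, 'k) mpoly set"
  assumes A: "is_ideal A" and G: "G \<in> frobenius_power (p ^ e) A" "G \<noteq> 0"
  obtains g where "g \<in> A" "g \<noteq> 0" "lm g = mon_div (lm G) (p ^ e)"
proof -
  let ?q = "p ^ e"
  let ?a = "mon_mod (lm G) ?q" and ?t0 = "mon_div (lm G) ?q"
  have a: "\<forall>i. lookup ?a i < ?q" by simp
  have eq: "?a + mon_scale ?q ?t0 = lm G" by (rule mon_mod_div)
  have "lookup G (?a + mon_scale ?q ?t0) \<noteq> 0"
    unfolding eq using lm_props(1)[OF G(2)] by (simp add: in_keys_iff)
  from coords_lookup[OF a this] obtain \<phi> where \<phi>: "\<phi> \<in> coords e" "lookup (\<phi> G) ?t0 \<noteq> 0"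
    "\<And>t. lookup (\<phi> G) t \<noteq> 0 \<Longrightarrow> lookup G (?a + mon_scale ?q t) \<noteq> 0" by blast
  have "\<phi> G \<in> A" using G(1) \<phi>(1) coords_mem_iff[OF A] by blast
  moreover have "\<phi> G \<noteq> 0" using \<phi>(2) by auto
  moreover have "lm (\<phi> G) = ?t0"
  proof (rule lm_eqI)
    show "?t0 \<in> keys (\<phi> G)" using \<phi>(2) by (simp add: in_keys_iff)
  next
    fix t assume "t \<in> keys (\<phi> G)"
    then have "?a + mon_scale ?q t \<in> keys G" using \<phi>(3) by (simp add: in_keys_iff)
    then have "?a + mon_scale ?q t \<preceq> ?a + mon_scale ?q ?t0"
      unfolding eq by (rule lm_props(2)[OF G(2)])
    then have "mon_scale ?q t + ?a \<preceq> mon_scale ?q ?t0 + ?a" by (simp only: add.commute[of ?a])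
    from le_scale_cancel[OF le_add_cancel[OF this]] show "t \<preceq> ?t0" by simp
  qed
  ultimately show ?thesis by (rule that)
qed

text \<open>Once q exceeds every exponent of lm c, the quotient monomial is 1 and A contains a
  nonzero constant. Both the tight closure argument and the separation of symbolic powers rest on
  this.\<close>

lemma mem_all_frobenius_powers:
  fixes A :: "('n, 'k) mpoly set"
  assumes A: "is_ideal A" and c: "c \<noteq> 0" "\<And>e. e \<ge> 1 \<Longrightarrow> c \<in> frobenius_power (p ^ e) A"
  shows "A = UNIV"
proof -
  obtain e where e: "e \<ge> 1" "p ^ e > (\<Sum>i\<in>UNIV. lookup (lm c) i)" using pe_unbounded by blast
  have "lookup (lm c) i < p ^ e" for i
    using member_le_sum[of i UNIV "lookup (lm c)"] e(2) by simp
  then have "mon_div (lm c) (p ^ e) = 0" by (intro poly_mapping_eqI) simp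
  moreover obtain g where "g \<in> A" "g \<noteq> 0" "lm g = mon_div (lm c) (p ^ e)"
    by (rule lm_frobenius_power[OF A c(2)[OF e(1)] c(1)])
  ultimately show ?thesis using ideal_UNIV_if_lm_0[OF A] by simp
qed

lemma squarefree_power_mem_frobenius_power:
  fixes A :: "('n, 'k) mpoly set"
  assumes A: "is_ideal A" and F: "F \<noteq> 0" "squarefree_monomial (lm F)"
    and mem: "F ^ (p ^ e - 1) \<in> frobenius_power (p ^ e) A"
  shows "A = UNIV"
proof -
  have "(p ^ e - 1) * lookup (lm F) i < p ^ e" for i
  proof -
    have "(p ^ e - 1) * lookup (lm F) i \<le> (p ^ e - 1) * 1"
      using F(2) unfolding squarefree_monomial_def by (intro mult_le_mono2) blast
    also have "\<dots> < p ^ e" by simp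
    finally show ?thesis .
  qed
  then have "mon_div (lm (F ^ (p ^ e - 1))) (p ^ e) = 0"
    unfolding lm_power[OF F(1)] by (intro poly_mapping_eqI) simp
  moreover have "F ^ (p ^ e - 1) \<noteq> 0" using F(1) by simp
  then obtain g where "g \<in> A" "g \<noteq> 0" "lm g = mon_div (lm (F ^ (p ^ e - 1))) (p ^ e)"
    by (rule lm_frobenius_power[OF A mem])
  ultimately show ?thesis using ideal_UNIV_if_lm_0[OF A] by simp
qed

end

section \<open>Polynomials over a subring\<close>

definition subring_set :: "'a::comm_ring_1 set \<Rightarrow> bool" where
  "subring_set A \<longleftrightarrow> 0 \<in> A \<and> 1 \<in> A \<and> (\<forall>x\<in>A. \<forall>y\<in>A. x + y \<in> A \<and> x - y \<in> A \<and> x * y \<in> A)"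

lemma subring_setD:
  assumes "subring_set A"
  shows "0 \<in> A" "1 \<in> A" "x \<in> A \<Longrightarrow> y \<in> A \<Longrightarrow> x + y \<in> A" "x \<in> A \<Longrightarrow> y \<in> A \<Longrightarrow> x - y \<in> A"
    "x \<in> A \<Longrightarrow> y \<in> A \<Longrightarrow> x * y \<in> A"
  using assms by (auto simp: subring_set_def)

lemma subring_set_sum: "subring_set A \<Longrightarrow> (\<And>i. i \<in> I \<Longrightarrow> f i \<in> A) \<Longrightarrow> sum f I \<in> A"
  by (induction I rule: infinite_finite_induct) (auto simp: subring_setD)

text \<open>A is either the subring K[V] of S or a prime P, in which case the condition means
  vanishing modulo P. A polynomial in one more variable over K[V] is thus a \<open>poly\<close> over
  S with restricted coefficients, to be evaluated at that variable.\<close>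

definition poly_over :: "'a::comm_ring_1 set \<Rightarrow> 'a poly \<Rightarrow> bool" where
  "poly_over A f \<longleftrightarrow> (\<forall>i. coeff f i \<in> A)"

lemma poly_over_intros:
  assumes A: "subring_set A"
  shows "poly_over A 0" "c \<in> A \<Longrightarrow> poly_over A (monom c n)"
    "poly_over A f \<Longrightarrow> poly_over A g \<Longrightarrow> poly_over A (f + g)"
    "poly_over A f \<Longrightarrow> poly_over A g \<Longrightarrow> poly_over A (f - g)"
    "poly_over A f \<Longrightarrow> poly_over A g \<Longrightarrow> poly_over A (f * g)"
    "c \<in> A \<Longrightarrow> poly_over A f \<Longrightarrow> poly_over A (smult c f)"
  using A by (auto simp: poly_over_def subring_setD coeff_mult intro!: subring_set_sum)

lemma cancel_leading_coeff:
  fixes f g :: "'a::idom poly"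
  assumes "degree g \<le> degree f"
  defines "h \<equiv> smult (lead_coeff g) f - monom (lead_coeff f) (degree f - degree g) * g"
  shows "h = 0 \<or> degree h < degree f"
proof (rule disjCI)
  assume *: "\<not> degree h < degree f"
  have "coeff (monom (lead_coeff f) (degree f - degree g) * g) (degree f) = lead_coeff f * lead_coeff g"
    using assms(1) by (simp add: coeff_monom_mult)
  then have "coeff h (degree f) = 0" by (simp add: h_def mult.commute)
  moreover have "degree (monom (lead_coeff f) (degree f - degree g) * g) \<le> degree f"
    using degree_mult_le[of "monom (lead_coeff f) (degree f - degree g)" g]
      degree_monom_le[of "lead_coeff f" "degree f - degree g"] assms(1) by linarith
  then have "degree h \<le> degree f"
    unfolding h_def by (intro degree_diff_le) (auto intro: order_trans[OF degree_smult_le])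
  ultimately show "h = 0" using * by (metis leading_coeff_0_iff le_neq_implies_less)
qed

lemma drop_leading_coeff:
  fixes f :: "'a::idom poly"
  defines "h \<equiv> f - monom (lead_coeff f) (degree f)"
  shows "h = 0 \<or> degree h < degree f"
proof (rule disjCI)
  assume *: "\<not> degree h < degree f"
  have "coeff h (degree f) = 0" by (simp add: h_def)
  moreover have "degree h \<le> degree f"
    unfolding h_def by (intro degree_diff_le degree_monom_le) simp
  ultimately show "h = 0" using * by (metis leading_coeff_0_iff le_neq_implies_less)
qed

text \<open>Powers of the leading coefficient take the place of its inverse. The bound on
  \<open>degree u\<close> is kept because \<open>fibre_prime_maximal\<close> compares u with a
  polynomial of least degree.\<close>

lemma pseudo_division_over:
  fixes f g :: "'a::idom poly"
  assumes A: "subring_set A" and f: "poly_over A f" and g: "poly_over A g"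
  shows "\<exists>k u r. poly_over A u \<and> poly_over A r \<and> smult (lead_coeff f ^ k) g = u * f + r \<and>
    (r = 0 \<or> degree r < degree f) \<and> degree u \<le> degree g - degree f"
  using g
proof (induction "degree g" arbitrary: g rule: less_induct)
  case less
  note A' = poly_over_intros[OF A]
  show ?case
  proof (cases "degree g < degree f")
    case True
    then show ?thesis using less.prems A' by (intro exI[of _ 0] exI[of _ g]) auto
  next
    case False
    define t where "t = monom (lead_coeff g) (degree g - degree f)"
    define h where "h = smult (lead_coeff f) g - t * f"
    have lc: "lead_coeff f \<in> A" "lead_coeff g \<in> A" using f less.prems by (auto simp: poly_over_def)
    have t: "poly_over A t" unfolding t_def by (intro A' lc)
    have h: "poly_over A h" unfolding h_def by (intro A' lc f less.prems t)
    have degt: "degree t \<le> degree g - degree f" unfolding t_def by (rule degree_monom_le)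
    have "h = 0 \<or> degree h < degree g"
      using cancel_leading_coeff[of f g] False unfolding h_def t_def by simp
    then show ?thesis
    proof
      assume "h = 0"
      then show ?thesis
        using t degt A' by (intro exI[of _ 1] exI[of _ t] exI[of _ 0]) (auto simp: h_def)
    next
      assume hg: "degree h < degree g"
      from less.hyps[OF this h] obtain k u r where IH: "poly_over A u" "poly_over A r"
        "smult (lead_coeff f ^ k) h = u * f + r" "r = 0 \<or> degree r < degree f"
        "degree u \<le> degree h - degree f" by blast
      have pow: "lead_coeff f ^ k \<in> A"
        using lc A by (induction k) (auto simp: subring_setD)
      let ?u = "u + smult (lead_coeff f ^ k) t"
      have "smult (lead_coeff f ^ Suc k) g = smult (lead_coeff f ^ k) (h + t * f)"
        by (simp add: h_def mult.commute)
      also have "\<dots> = ?u * f + r" using IH(3) by (simp add: smult_add_right algebra_simps)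
      finally have eq: "smult (lead_coeff f ^ Suc k) g = ?u * f + r" .
      have "degree ?u \<le> degree g - degree f"
        using IH(5) hg degt by (intro degree_add_le order_trans[OF degree_smult_le]) auto
      moreover have "poly_over A ?u" by (intro A' IH pow t)
      ultimately show ?thesis using IH(2,4) eq by blast
    qed
  qed
qed

text \<open>Over the residue field of P \<inter> A the polynomials with value in P at x form a
  principal ideal, generated by g. Division by g needs its leading coefficient inverted, which the
  saturation of J provides; degrees drop until all coefficients lie in P, the case
  \<open>base\<close>.\<close>

lemma saturated_step:
  fixes x :: "'a::idom"
  assumes A: "subring_set A" and P: "P \<in> Spec" and J: "is_ideal J"
    and sat: "\<And>s f. s \<notin> P \<Longrightarrow> s * f \<in> J \<Longrightarrow> f \<in> J"
    and g: "poly_over A g" "poly g x \<in> P" "poly g x \<in> J" "lead_coeff g \<notin> P"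
    and min: "\<And>f. poly_over A f \<Longrightarrow> poly f x \<in> P \<Longrightarrow> \<not> poly_over P f \<Longrightarrow> degree g \<le> degree f"
    and base: "\<And>f. poly_over A f \<Longrightarrow> poly_over P f \<Longrightarrow> poly f x \<in> J"
  shows "poly_over A f \<Longrightarrow> poly f x \<in> P \<Longrightarrow> poly f x \<in> J"
proof (induction "degree f" arbitrary: f rule: less_induct)
  case less
  note A' = poly_over_intros[OF A] and IP = SpecD(1)[OF P]
  show ?case
  proof (cases "poly_over P f")
    case True then show ?thesis using base less.prems by blast
  next
    case False
    then have deg: "degree g \<le> degree f" using min less.prems by blast
    define t where "t = monom (lead_coeff f) (degree f - degree g)"
    define h where "h = smult (lead_coeff g) f - t * g"
    have lc: "lead_coeff f \<in> A" "lead_coeff g \<in> A" using g less.prems by (auto simp: poly_over_def)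
    have h: "poly_over A h" unfolding h_def t_def by (intro A' lc g less.prems)
    have hx: "poly h x = lead_coeff g * poly f x - poly t x * poly g x" by (simp add: h_def)
    have hP: "poly h x \<in> P"
      unfolding hx by (intro ideal_diff[OF IP] ideal_mult[OF IP] less.prems g)
    have "h = 0 \<or> degree h < degree f"
      using cancel_leading_coeff[OF deg] unfolding h_def t_def .
    then have "poly h x \<in> J" using less.hyps[OF _ h hP] ideal_zero[OF J] by auto
    then have "poly h x + poly t x * poly g x \<in> J"
      by (rule ideal_add[OF J _ ideal_mult[OF J g(3)]])
    then have "lead_coeff g * poly f x \<in> J" by (simp add: hx)
    then show ?thesis by (rule sat[OF g(4)])
  qed
qed

text \<open>A leading term with coefficient in P could be dropped: the value stays in P, some other
  coefficient is outside P, and the degree falls.\<close>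

lemma minimal_poly_lead_coeff:
  fixes x :: "'a::idom"
  assumes A: "subring_set A" and P: "P \<in> Spec"
    and g: "poly_over A g" "poly g x \<in> P" "\<not> poly_over P g"
    and min: "\<And>f. poly_over A f \<Longrightarrow> poly f x \<in> P \<Longrightarrow> \<not> poly_over P f \<Longrightarrow> degree g \<le> degree f"
  shows "lead_coeff g \<notin> P"
proof
  assume lc: "lead_coeff g \<in> P"
  note IP = SpecD(1)[OF P]
  define h where "h = g - monom (lead_coeff g) (degree g)"
  have "lead_coeff g \<in> A" using g(1) by (simp add: poly_over_def)
  then have "poly_over A h" unfolding h_def by (intro poly_over_intros[OF A] g)
  moreover have "poly h x \<in> P"
    unfolding h_def using lc by (simp add: poly_monom) (intro ideal_diff[OF IP] ideal_mult_right[OF IP] g(2))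
  moreover have "\<not> poly_over P h"
  proof
    assume "poly_over P h"
    have "coeff g i \<in> P" for i
    proof -
      have "coeff h i + coeff (monom (lead_coeff g) (degree g)) i \<in> P"
        using \<open>poly_over P h\<close> lc ideal_zero[OF IP] by (intro ideal_add[OF IP]) (auto simp: poly_over_def)
      then show ?thesis by (simp add: h_def)
    qed
    then show False using g(3) by (simp add: poly_over_def)
  qed
  moreover have "h \<noteq> 0" using \<open>\<not> poly_over P h\<close> ideal_zero[OF IP] by (auto simp: poly_over_def)
  then have "degree h < degree g" using drop_leading_coeff[of g] unfolding h_def by simp
  ultimately show False using min[of h] by simp
qed

text \<open>Over a prime of \<open>A\<close> the fibre of \<open>A[x]\<close> is a principal ideal domain, so a chain of primes of
  \<open>A[x]\<close> with the same contraction to \<open>A\<close> has at most two members.\<close>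

lemma fibre_prime_maximal:
  fixes x :: "'a::idom"
  assumes A: "subring_set A" and P: "P \<in> Spec" and Q: "Q \<in> Spec" and PQ: "P \<subseteq> Q"
    and contr: "P \<inter> A = Q \<inter> A"
    and ex: "\<exists>g. poly_over A g \<and> poly g x \<in> P \<and> \<not> poly_over P g"
    and f: "poly_over A f" "poly f x \<in> Q"
  shows "poly f x \<in> P"
proof (rule ccontr)
  assume nf: "poly f x \<notin> P"
  note A' = poly_over_intros[OF A] and IP = SpecD(1)[OF P] and IQ = SpecD(1)[OF Q]
  let ?F = "\<lambda>f. poly_over A f \<and> poly f x \<in> Q \<and> poly f x \<notin> P"
  let ?G = "\<lambda>g. poly_over A g \<and> poly g x \<in> P \<and> \<not> poly_over P g"
  obtain f where f: "poly_over A f" "poly f x \<in> Q" "poly f x \<notin> P"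
    and minf: "\<And>h. ?F h \<Longrightarrow> degree f \<le> degree h"
    using ex_has_least_nat[of ?F f degree] f nf by blast
  obtain g where g: "poly_over A g" "poly g x \<in> P" "\<not> poly_over P g"
    and ming: "\<And>h. ?G h \<Longrightarrow> degree g \<le> degree h"
    using ex_has_least_nat[of ?G _ degree] ex by blast
  have cP: "lead_coeff g \<notin> P" using minimal_poly_lead_coeff[OF A P g] ming by blast
  have lc: "lead_coeff f \<in> A" "lead_coeff g \<in> A" using f g by (auto simp: poly_over_def)
  have bP: "lead_coeff f \<notin> P"
  proof
    assume b: "lead_coeff f \<in> P"
    define h where "h = f - monom (lead_coeff f) (degree f)"
    have hx: "poly h x = poly f x - lead_coeff f * x ^ degree f" by (simp add: h_def poly_monom)
    have bx: "lead_coeff f * x ^ degree f \<in> P" by (rule ideal_mult_right[OF IP b])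
    have "poly_over A h" unfolding h_def by (intro A' lc f)
    moreover have "poly h x \<in> Q" unfolding hx using bx PQ f by (intro ideal_diff[OF IQ]) auto
    moreover have hP: "poly h x \<notin> P"
      using ideal_add[OF IP _ bx, of "poly h x"] f(3) unfolding hx by auto
    moreover have "h \<noteq> 0" using hP ideal_zero[OF IP] by auto
    then have "degree h < degree f" using drop_leading_coeff[of f] unfolding h_def by simp
    ultimately show False using minf[of h] by simp
  qed
  \<comment> \<open>Otherwise g, whose leading coefficient is a unit at P, would lower the degree of
    f.\<close>
  have fg: "degree f \<le> degree g"
  proof (rule ccontr)
    assume "\<not> degree f \<le> degree g"
    then have deg: "degree g \<le> degree f" by simp
    define t where "t = monom (lead_coeff f) (degree f - degree g)"
    define h where "h = smult (lead_coeff g) f - t * g"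
    have hx: "poly h x = lead_coeff g * poly f x - poly t x * poly g x" by (simp add: h_def)
    have tg: "poly t x * poly g x \<in> P" by (rule ideal_mult[OF IP g(2)])
    have "poly_over A h" unfolding h_def t_def by (intro A' lc f g)
    moreover have "poly h x \<in> Q"
      unfolding hx by (rule ideal_diff[OF IQ ideal_mult[OF IQ f(2)] subsetD[OF PQ tg]])
    moreover have hP: "poly h x \<notin> P"
    proof
      assume "poly h x \<in> P"
      then have "poly h x + poly t x * poly g x \<in> P" using tg by (rule ideal_add[OF IP])
      then show False using SpecD(3)[OF P, of "lead_coeff g" "poly f x"] cP f(3) by (simp add: hx)
    qed
    moreover have "h \<noteq> 0" using hP ideal_zero[OF IP] by auto
    then have "degree h < degree f"
      using cancel_leading_coeff[OF deg] unfolding h_def t_def by simp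
    ultimately show False using minf[of h] by simp
  qed
  \<comment> \<open>A constant f would be an element of Q \<inter> A = P \<inter> A.\<close>
  have f0: "degree f > 0"
  proof (rule ccontr)
    assume "\<not> degree f > 0"
    then obtain a where a: "f = [:a:]" by (metis degree_eq_zeroE not_gr_zero)
    then have "a \<in> A" using f(1) by (auto simp: poly_over_def dest: spec[of _ 0])
    then show False using contr f(2,3) a by auto
  qed
  obtain k u r where u: "poly_over A u" and r: "poly_over A r"
    and eq: "smult (lead_coeff f ^ k) g = u * f + r"
    and degr: "r = 0 \<or> degree r < degree f" and degu: "degree u \<le> degree g - degree f"
    using pseudo_division_over[OF A f(1) g(1)] by blast
  have eqx: "lead_coeff f ^ k * poly g x = poly u x * poly f x + poly r x"
    using arg_cong[OF eq, of "\<lambda>h. poly h x"] by simp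
  have gk: "lead_coeff f ^ k * poly g x \<in> P" by (rule ideal_mult[OF IP g(2)])
  have rP: "poly r x \<in> P"
  proof (rule ccontr)
    assume nr: "poly r x \<notin> P"
    have "poly r x = lead_coeff f ^ k * poly g x - poly u x * poly f x" using eqx by simp
    also have "\<dots> \<in> Q"
      by (rule ideal_diff[OF IQ subsetD[OF PQ gk] ideal_mult[OF IQ f(2)]])
    finally have "degree f \<le> degree r" using minf r nr by blast
    then show False using degr nr ideal_zero[OF IP] by auto
  qed
  \<comment> \<open>Both r and u have value in P at x and, unless zero, degree below that of g.
    Minimality of g then forces their coefficients into P, and those of g with them, since
    \<open>lead_coeff f\<close> is not in P.\<close>
  have "poly_over P r"
  proof (rule ccontr)
    assume nr: "\<not> poly_over P r"
    then have "r \<noteq> 0" using ideal_zero[OF IP] by (auto simp: poly_over_def)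
    moreover have "degree g \<le> degree r" using ming r rP nr by blast
    ultimately show False using degr fg by simp
  qed
  have "poly u x * poly f x = lead_coeff f ^ k * poly g x - poly r x" using eqx by simp
  also have "\<dots> \<in> P" by (intro ideal_diff[OF IP] gk rP)
  finally have uP: "poly u x \<in> P" using SpecD(3)[OF P] f(3) by blast
  have "poly_over P u"
  proof (rule ccontr)
    assume "\<not> poly_over P u"
    then have "degree g \<le> degree u" using ming u uP by blast
    then show False using degu fg f0 by simp
  qed
  have "coeff g i \<in> P" for i
  proof -
    have "lead_coeff f ^ k * coeff g i = coeff (u * f) i + coeff r i"
      using arg_cong[OF eq, of "\<lambda>h. coeff h i"] by simp
    also have "\<dots> \<in> P"
      using \<open>poly_over P u\<close> \<open>poly_over P r\<close> unfolding coeff_mult poly_over_def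
      by (intro ideal_add[OF IP] ideal_sum[OF IP] ideal_mult_right[OF IP]) auto
    finally show ?thesis using SpecD(3)[OF P] Spec_power[OF P] bP by blast
  qed
  then show False using g(3) by (simp add: poly_over_def)
qed

section \<open>Generators of a localized prime and its height\<close>

lemma lookup_times_sum:
  fixes F G :: "'a::monoid_add \<Rightarrow>\<^sub>0 'b::semiring_0"
  shows "lookup (F * G) k = (\<Sum>(i, j)\<in>keys F \<times> keys G. if i + j = k then lookup F i * lookup G j else 0)"
proof -
  have "F * G = (\<Sum>i\<in>keys F. single i (lookup F i)) * (\<Sum>j\<in>keys G. single j (lookup G j))"
    by (simp only: poly_mapping_sum_singles)
  also have "\<dots> = (\<Sum>(i, j)\<in>keys F \<times> keys G. single (i + j) (lookup F i * lookup G j))"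
    by (simp add: sum_product sum.cartesian_product mult_single)
  finally show ?thesis
    by (simp add: lookup_sum lookup_single when_def split_def)
qed

text \<open>For F and G outside the extension of P, take the largest exponents a and b with
  coefficient not in P; in degree a + b every other product of coefficients has a factor in
  P.\<close>

lemma prime_poly_mapping:
  fixes P :: "'b::comm_ring_1 set"
  assumes P: "P \<in> Spec"
  shows "{F :: 'a::{ordered_cancel_comm_monoid_add, linorder} \<Rightarrow>\<^sub>0 'b. \<forall>m. lookup F m \<in> P} \<in> Spec" (is "?P \<in> Spec")
proof (rule SpecI)
  note IP = SpecD(1)[OF P]
  show "is_ideal ?P"
  proof (rule is_idealI)
    fix F G :: "'a \<Rightarrow>\<^sub>0 'b" assume F: "F \<in> ?P"
    show "G * F \<in> ?P"
    proof clarify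
      fix m show "lookup (G * F) m \<in> P"
        unfolding lookup_times_sum using F
        by (intro ideal_sum[OF IP]) (auto intro!: ideal_mult[OF IP] ideal_zero[OF IP])
    qed
  qed (auto simp: lookup_add intro: ideal_zero[OF IP] ideal_add[OF IP])
  have "lookup (1 :: 'a \<Rightarrow>\<^sub>0 'b) 0 \<notin> P" using SpecD(2)[OF P] by simp
  then show "1 \<notin> ?P" by blast
  fix F G :: "'a \<Rightarrow>\<^sub>0 'b" assume FG: "F * G \<in> ?P"
  show "F \<in> ?P \<or> G \<in> ?P"
  proof (rule ccontr)
    assume nFG: "\<not> ?thesis"
    define a where "a = Max {m. lookup F m \<notin> P}"
    define b where "b = Max {m. lookup G m \<notin> P}"
    have fin: "finite {m. lookup H m \<notin> P}" for H :: "'a \<Rightarrow>\<^sub>0 'b"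
      by (rule finite_subset[of _ "keys H"]) (auto simp: in_keys_iff ideal_zero[OF IP])
    have a: "lookup F a \<notin> P" and b: "lookup G b \<notin> P"
      using Max_in[OF fin[of F]] Max_in[OF fin[of G]] nFG by (auto simp: a_def b_def)
    have a_max: "m \<le> a" if "lookup F m \<notin> P" for m
      unfolding a_def using that by (intro Max_ge fin) simp
    have b_max: "m \<le> b" if "lookup G m \<notin> P" for m
      unfolding b_def using that by (intro Max_ge fin) simp
    have ab: "(a, b) \<in> keys F \<times> keys G"
      using a b ideal_zero[OF IP] by (auto simp: in_keys_iff)
    let ?t = "\<lambda>(i, j). if i + j = a + b then lookup F i * lookup G j else 0"
    have "lookup (F * G) (a + b) = ?t (a, b) + (\<Sum>ij\<in>keys F \<times> keys G - {(a, b)}. ?t ij)"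
      unfolding lookup_times_sum using ab by (intro sum.remove) auto
    then have "lookup F a * lookup G b
        = lookup (F * G) (a + b) - (\<Sum>ij\<in>keys F \<times> keys G - {(a, b)}. ?t ij)" by simp
    also have "\<dots> \<in> P"
    proof (intro ideal_diff[OF IP] ideal_sum[OF IP])
      show "lookup (F * G) (a + b) \<in> P" using FG by blast
      fix ij assume ij: "ij \<in> keys F \<times> keys G - {(a, b)}"
      obtain i j where [simp]: "ij = (i, j)" by (cases ij)
      show "?t ij \<in> P"
      proof (cases "i + j = a + b")
        case True
        have "lookup F i \<in> P \<or> lookup G j \<in> P"
        proof (rule ccontr)
          assume "\<not> ?thesis"
          then have "i \<le> a" "j \<le> b" using a_max b_max by blast+
          then have "i = a \<and> j = b"
            using True by (metis add_le_cancel_left add_le_cancel_right add_left_mono add_right_mono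
                antisym add_left_cancel add_right_cancel)
          then show False using ij by simp
        qed
        then show ?thesis using True by (auto intro: ideal_mult[OF IP] ideal_mult_right[OF IP])
      qed (simp add: ideal_zero[OF IP])
    qed
    finally show False using SpecD(3)[OF P] a b by blast
  qed
qed

lemma prime_preimage:
  fixes h :: "'a::comm_ring_1 \<Rightarrow> 'b::comm_ring_1"
  assumes "Q \<in> Spec" "\<And>x y. h (x + y) = h x + h y" "\<And>x y. h (x * y) = h x * h y" "h 1 = 1"
  shows "{x. h x \<in> Q} \<in> Spec"
proof (rule SpecI)
  have "h 0 = 0" using assms(2)[of 0 0] by (metis add_0 add_cancel_right_right)
  then show "is_ideal {x. h x \<in> Q}"
    using SpecD(1)[OF assms(1)] by (auto simp: is_ideal_iff assms(2,3))
qed (use assms SpecD[OF assms(1)] in auto)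

section \<open>Contraction to a polynomial subring and extension back\<close>

definition mon_restrict :: "'n set \<Rightarrow> ('n::finite \<Rightarrow>\<^sub>0 nat) \<Rightarrow> ('n \<Rightarrow>\<^sub>0 nat)" where
  "mon_restrict V m = mon (\<lambda>i. if i \<in> V then lookup m i else 0)"

lemma lookup_mon_restrict [simp]: "lookup (mon_restrict V m) i = (if i \<in> V then lookup m i else 0)"
  by (simp add: mon_restrict_def)

lemma mon_restrict_add: "mon_restrict V (a + b) = mon_restrict V a + mon_restrict V b"
  by (rule poly_mapping_eqI) (simp add: lookup_add)

lemma mon_restrict_decompose: "mon_restrict V m + mon_restrict (- V) m = m"
  by (rule poly_mapping_eqI) (simp add: lookup_add)

text \<open>A polynomial read as a polynomial in the variables outside \<open>V\<close>, with coefficients in \<open>K[V]\<close>.\<close>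

definition coeffs_over :: "'n set \<Rightarrow> ('n::{finite,linorder}, 'k::field) mpoly \<Rightarrow> ('n \<Rightarrow>\<^sub>0 nat) \<Rightarrow>\<^sub>0 ('n, 'k) mpoly" where
  "coeffs_over V f = (\<Sum>k\<in>keys f. single (mon_restrict (- V) k) (single (mon_restrict V k) (lookup f k)))"

lemma coeffs_over_superset:
  assumes "finite A" "keys f \<subseteq> A"
  shows "coeffs_over V f = (\<Sum>k\<in>A. single (mon_restrict (- V) k) (single (mon_restrict V k) (lookup f k)))"
  unfolding coeffs_over_def using assms
  by (intro sum.mono_neutral_left) (auto simp: in_keys_iff)

lemma coeffs_over_add: "coeffs_over V (f + g) = coeffs_over V f + coeffs_over V g"
proof -
  have fin: "finite (keys f \<union> keys g)" by simp
  show ?thesis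
    unfolding coeffs_over_superset[OF fin keys_add] coeffs_over_superset[OF fin Un_upper1]
      coeffs_over_superset[OF fin Un_upper2]
    by (simp add: lookup_add single_add sum.distrib)
qed

lemma coeffs_over_0 [simp]: "coeffs_over V 0 = 0"
  by (simp add: coeffs_over_def)

lemma coeffs_over_sum: "coeffs_over V (sum f A) = (\<Sum>i\<in>A. coeffs_over V (f i))"
  by (induction A rule: infinite_finite_induct) (simp_all add: coeffs_over_add)

lemma coeffs_over_single:
  "coeffs_over V (single k c) = single (mon_restrict (- V) k) (single (mon_restrict V k) c)"
  by (cases "c = 0") (simp_all add: coeffs_over_def)

lemma coeffs_over_1: "coeffs_over V 1 = 1"
proof -
  have "mon_restrict W 0 = 0" for W :: "'a set" by (rule poly_mapping_eqI) simp
  then show ?thesis using coeffs_over_single[of V 0 1] by simp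
qed

lemma coeffs_over_mult: "coeffs_over V (f * g) = coeffs_over V f * coeffs_over V g"
proof -
  have "f * g = (\<Sum>i\<in>keys f. single i (lookup f i)) * (\<Sum>j\<in>keys g. single j (lookup g j))"
    by (simp only: poly_mapping_sum_singles)
  also have "\<dots> = (\<Sum>i\<in>keys f. \<Sum>j\<in>keys g. single (i + j) (lookup f i * lookup g j))"
    by (simp add: sum_product mult_single)
  finally have "coeffs_over V (f * g) = (\<Sum>i\<in>keys f. \<Sum>j\<in>keys g.
      coeffs_over V (single i (lookup f i)) * coeffs_over V (single j (lookup g j)))"
    by (simp add: coeffs_over_sum coeffs_over_single mult_single mon_restrict_add)
  also have "\<dots> = coeffs_over V (\<Sum>i\<in>keys f. single i (lookup f i)) *
      coeffs_over V (\<Sum>j\<in>keys g. single j (lookup g j))"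
    by (simp add: coeffs_over_sum sum_product)
  finally show ?thesis by (simp only: poly_mapping_sum_singles)
qed

definition polys_in :: "'n set \<Rightarrow> ('n::{finite,linorder}, 'k::field) mpoly set" where
  "polys_in V = {f. \<forall>k\<in>keys f. \<forall>i. i \<notin> V \<longrightarrow> lookup k i = 0}"

lemma single_in_polys_in: "\<forall>i. i \<notin> V \<longrightarrow> lookup k i = 0 \<Longrightarrow> single k c \<in> polys_in V"
  by (cases "c = 0") (auto simp: polys_in_def)

lemma subring_polys_in:
  fixes V :: "'n::{finite,linorder} set"
  shows "subring_set (polys_in V :: ('n, 'k::field) mpoly set)"
  unfolding subring_set_def
proof (intro conjI ballI)
  fix f g :: "('n, 'k) mpoly" assume f: "f \<in> polys_in V" and g: "g \<in> polys_in V"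
  show "f + g \<in> polys_in V" "f - g \<in> polys_in V" "f * g \<in> polys_in V"
    using f g keys_add[of f g] keys_diff[of f g] keys_mult[of f g]
    by (fastforce simp: polys_in_def lookup_add)+
qed (auto simp: polys_in_def)

lemma polys_in_mono: "V \<subseteq> W \<Longrightarrow> polys_in V \<subseteq> polys_in W"
  by (auto simp: polys_in_def)

lemma coeffs_over_polys_in:
  assumes "f \<in> polys_in V" shows "coeffs_over V f = single 0 f"
proof -
  have "mon_restrict (- V) k = 0" "mon_restrict V k = k" if "k \<in> keys f" for k
    using assms that by (auto simp: polys_in_def intro!: poly_mapping_eqI)
  then have "coeffs_over V f = (\<Sum>k\<in>keys f. single 0 (single k (lookup f k)))"
    by (simp add: coeffs_over_def)
  also have "\<dots> = single 0 (\<Sum>k\<in>keys f. single k (lookup f k))"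
    by (rule poly_mapping_eqI) (simp add: lookup_sum lookup_single when_def)
  finally show ?thesis by (simp only: poly_mapping_sum_singles)
qed

lemma lookup_coeffs_over:
  "lookup (coeffs_over V f) m = (\<Sum>k | k \<in> keys f \<and> mon_restrict (- V) k = m. single (mon_restrict V k) (lookup f k))"
  unfolding coeffs_over_def lookup_sum lookup_single when_def
  by (rule sum.inter_filter[symmetric]) simp

lemma lookup_coeffs_over_in: "lookup (coeffs_over V f) m \<in> polys_in V"
  unfolding lookup_coeffs_over by (intro subring_set_sum[OF subring_polys_in] single_in_polys_in) simp

lemma mem_ideal_if_coeffs_over:
  assumes J: "is_ideal J" and "\<And>m. lookup (coeffs_over V f) m \<in> J"
  shows "f \<in> J"
proof -
  let ?r = "mon_restrict (- V)"
  have "f = (\<Sum>k\<in>keys f. single (mon_restrict V k) (lookup f k) * single (?r k) 1)"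
    by (simp add: mult_single mon_restrict_decompose poly_mapping_sum_singles)
  also have "\<dots> = (\<Sum>m\<in>?r ` keys f. \<Sum>k | k \<in> keys f \<and> ?r k = m.
      single (mon_restrict V k) (lookup f k) * single (?r k) 1)"
    by (rule sum.image_gen) simp
  also have "\<dots> = (\<Sum>m\<in>?r ` keys f. lookup (coeffs_over V f) m * single m 1)"
    unfolding lookup_coeffs_over sum_distrib_right by (intro sum.cong) auto
  also have "\<dots> \<in> J" by (intro ideal_sum[OF J] ideal_mult_right[OF J] assms)
  finally show ?thesis .
qed

text \<open>The ideal (P \<inter> K[V]) S: the coefficients over K[V] lie in K[V] anyway, and
  membership in the extension is tested on them.\<close>

definition contraction_ext :: "('n::{finite,linorder}, 'k::field) mpoly set \<Rightarrow> 'n set \<Rightarrow> ('n, 'k) mpoly set" where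
  "contraction_ext P V = {f. \<forall>m. lookup (coeffs_over V f) m \<in> P}"

lemma contraction_ext_prime: "P \<in> Spec \<Longrightarrow> contraction_ext P V \<in> Spec"
  using prime_preimage[OF prime_poly_mapping[of P], of "coeffs_over V"]
  by (simp add: contraction_ext_def coeffs_over_add coeffs_over_mult coeffs_over_1)

lemma contraction_ext_polys_in:
  assumes "P \<in> Spec" "f \<in> polys_in V" shows "f \<in> contraction_ext P V \<longleftrightarrow> f \<in> P"
  using ideal_zero[OF SpecD(1)[OF assms(1)]] coeffs_over_polys_in[OF assms(2)]
  by (auto simp: contraction_ext_def lookup_single when_def)

lemma contraction_ext_minimal:
  assumes P: "P \<in> Spec" and J: "is_ideal J" "\<And>f. f \<in> polys_in V \<Longrightarrow> f \<in> P \<Longrightarrow> f \<in> J"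
  shows "contraction_ext P V \<subseteq> J"
proof
  fix f assume f: "f \<in> contraction_ext P V"
  have "lookup (coeffs_over V f) m \<in> J" for m
    using f by (intro J(2)[OF lookup_coeffs_over_in]) (simp add: contraction_ext_def)
  then show "f \<in> J" by (rule mem_ideal_if_coeffs_over[OF J(1)])
qed

lemma contraction_ext_mono:
  assumes "P \<in> Spec" "Q \<in> Spec" "P \<subseteq> Q" "V \<subseteq> W" shows "contraction_ext P V \<subseteq> contraction_ext Q W"
proof (rule contraction_ext_minimal[OF assms(1) SpecD(1)[OF contraction_ext_prime[OF assms(2)]]])
  fix f assume "f \<in> polys_in V" "f \<in> P"
  then show "f \<in> contraction_ext Q W"
    using contraction_ext_polys_in[OF assms(2), of f W] polys_in_mono[OF assms(4)] assms(3)
    by (metis subsetD)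
qed

lemma contraction_ext_UNIV: "P \<in> Spec \<Longrightarrow> contraction_ext P UNIV = P"
  using contraction_ext_polys_in[of P _ UNIV] by (auto simp: polys_in_def)

lemma contraction_ext_empty:
  assumes P: "P \<in> Spec" shows "contraction_ext P {} = {0}"
proof
  show "contraction_ext P {} \<subseteq> {0}"
  proof (rule contraction_ext_minimal[OF P])
    show "is_ideal {0}" by (auto simp: is_ideal_iff)
    fix f assume f: "f \<in> polys_in {}" "f \<in> P"
    have "k = 0" if "k \<in> keys f" for k
      using f(1) that by (intro poly_mapping_eqI) (auto simp: polys_in_def)
    then have "f = single 0 (lookup f 0)"
      by (intro poly_mapping_eqI) (auto simp: lookup_single when_def in_keys_iff)
    then obtain c where c: "f = single 0 c" ..
    have "c = 0"
    proof (rule ccontr)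
      assume "c \<noteq> 0"
      then have "single 0 (1 / c) * f = 1" by (simp add: c mult_single)
      moreover have "single 0 (1 / c) * f \<in> P" by (rule ideal_mult[OF SpecD(1)[OF P] f(2)])
      ultimately show False using SpecD(2)[OF P] by simp
    qed
    then show "f \<in> {0}" by (simp add: c)
  qed
  show "{0} \<subseteq> contraction_ext P {}"
    using ideal_zero[OF SpecD(1)[OF contraction_ext_prime[OF P]]] by simp
qed

definition variable :: "'n \<Rightarrow> ('n::{finite,linorder}, 'k::field) mpoly" where
  "variable v = single (mon (\<lambda>i. if i = v then 1 else 0)) 1"

lemma polys_in_insert_eq_poly:
  assumes v: "v \<notin> V" and f: "f \<in> polys_in (insert v V)"
  shows "\<exists>g. poly_over (polys_in V) g \<and> f = poly g (variable v)"
proof (intro exI conjI)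
  let ?g = "\<Sum>k\<in>keys f. monom (single (mon_restrict V k) (lookup f k)) (lookup k v)"
  show "poly_over (polys_in V) ?g"
    unfolding poly_over_def coeff_sum
    by (auto intro!: subring_set_sum[OF subring_polys_in] single_in_polys_in
        subring_setD(1)[OF subring_polys_in])
  have eq: "single (mon_restrict V k) c * variable v ^ lookup k v = single k c" if "k \<in> keys f" for k c
  proof -
    have "mon_restrict V k + mon_scale (lookup k v) (mon (\<lambda>i. if i = v then 1 else 0)) = k"
      using f that v by (intro poly_mapping_eqI) (auto simp: lookup_add polys_in_def)
    then show ?thesis by (simp add: variable_def single_power mult_single)
  qed
  have "poly ?g (variable v) = (\<Sum>k\<in>keys f. single k (lookup f k))"
    unfolding poly_sum poly_monom by (intro sum.cong refl eq)
  then show "f = poly ?g (variable v)" by (simp only: poly_mapping_sum_singles)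
qed

lemma poly_variable_contraction_ext:
  assumes P: "P \<in> Spec" and "poly_over (polys_in V) g" "poly_over P g"
  shows "poly g x \<in> contraction_ext P V"
proof -
  note I = SpecD(1)[OF contraction_ext_prime[OF P, of V]]
  have "coeff g i \<in> contraction_ext P V" for i
    using assms contraction_ext_polys_in[OF P] by (auto simp: poly_over_def)
  then show ?thesis unfolding poly_altdef by (intro ideal_sum[OF I] ideal_mult_right[OF I])
qed

text \<open>The polynomial g makes v algebraic over the fraction field of K[V]/(P \<inter> K[V]). If
  no such g existed, every element of P \<inter> K[V, v] would have its coefficients in P and
  already lie in the smaller extension.\<close>

lemma contraction_ext_jump:
  assumes P: "P \<in> Spec" and v: "v \<notin> V" and ne: "contraction_ext P (insert v V) \<noteq> contraction_ext P V"
  shows "\<exists>g. poly_over (polys_in V) g \<and> poly g (variable v) \<in> P \<and> \<not> poly_over P g"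
proof (rule ccontr)
  assume *: "\<not> ?thesis"
  have "contraction_ext P (insert v V) \<subseteq> contraction_ext P V"
  proof (rule contraction_ext_minimal[OF P SpecD(1)[OF contraction_ext_prime[OF P]]])
    fix f assume f: "f \<in> polys_in (insert v V)" "f \<in> P"
    then obtain g where g: "poly_over (polys_in V) g" "f = poly g (variable v)"
      using polys_in_insert_eq_poly[OF v] by blast
    then have "poly_over P g" using * f(2) by blast
    then show "f \<in> contraction_ext P V"
      unfolding g(2) by (rule poly_variable_contraction_ext[OF P g(1)])
  qed
  then show False using ne contraction_ext_mono[OF P P order_refl, of V "insert v V"] by blast
qed

section \<open>Chains of primes and local generators\<close>

definition prime_chain_length :: "'a::comm_ring_1 set \<Rightarrow> nat \<Rightarrow> bool" where
  "prime_chain_length P n \<longleftrightarrow> (\<exists>c. (\<forall>i\<le>n. c i \<in> Spec) \<and> (\<forall>i<n. c i \<subset> c (Suc i)) \<and> c n = P)"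

lemma height_eq: "height P = Sup {n. prime_chain_length P n}"
  by (simp add: height_def prime_chain_length_def)

lemma prime_chain_length_0: "P \<in> Spec \<Longrightarrow> prime_chain_length P 0"
  unfolding prime_chain_length_def by (rule exI[of _ "\<lambda>_. P"]) simp

lemma prime_chain_length_Suc:
  assumes "prime_chain_length P n" "Q \<in> Spec" "P \<subset> Q" shows "prime_chain_length Q (Suc n)"
proof -
  obtain c where c: "\<forall>i\<le>n. c i \<in> Spec" "\<forall>i<n. c i \<subset> c (Suc i)" "c n = P"
    using assms(1) by (auto simp: prime_chain_length_def)
  show ?thesis unfolding prime_chain_length_def
    using c assms(2,3) by (intro exI[of _ "c(Suc n := Q)"]) (auto simp: le_Suc_eq less_Suc_eq)
qed

text \<open>Variables are adjoined one at a time. When (P \<inter> K[V]) S stays the same, so do the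
  generators. When it grows, the value at v of one polynomial of least degree generates the new part
  locally at P, and the extensions, being prime, form a chain with one more step. So generators
  never outnumber steps.\<close>

lemma contraction_ext_generators:
  fixes P :: "('n::{finite,linorder}, 'k::field) mpoly set"
  assumes P: "P \<in> Spec"
  shows "\<exists>Y n. finite Y \<and> Y \<subseteq> P \<and> contraction_ext P V \<subseteq> sat P (idl Y) \<and> card Y \<le> n \<and>
    prime_chain_length (contraction_ext P V) n"
  using finite[of V]
proof (induction V rule: finite_induct)
  case empty
  have "{0} \<subseteq> sat P (idl {})"
    using ideal_zero[OF sat_ideal[OF P idl_ideal]] by blast
  then show ?case
    using prime_chain_length_0[OF contraction_ext_prime[OF P, of "{}"]] contraction_ext_empty[OF P]
    by (intro exI[of _ "{}"] exI[of _ 0]) simp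
next
  case (insert v V)
  obtain Y n where Y: "finite Y" "Y \<subseteq> P" "contraction_ext P V \<subseteq> sat P (idl Y)" "card Y \<le> n"
    and n: "prime_chain_length (contraction_ext P V) n"
    using insert.IH by blast
  show ?case
  proof (cases "contraction_ext P (insert v V) = contraction_ext P V")
    case True
    then show ?thesis using Y n by (intro exI[of _ Y] exI[of _ n]) simp
  next
    case False
    let ?A = "polys_in V" and ?x = "variable v"
    let ?G = "\<lambda>g. poly_over ?A g \<and> poly g ?x \<in> P \<and> \<not> poly_over P g"
    obtain g0 where "?G g0" using contraction_ext_jump[OF P insert.hyps(2) False] by blast
    then obtain g where g: "?G g" and min: "\<And>h. ?G h \<Longrightarrow> degree g \<le> degree h"
      using ex_has_least_nat[of ?G g0 degree] by blast
    let ?Y = "insert (poly g ?x) Y" and ?J = "sat P (idl (insert (poly g ?x) Y))"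
    have J: "is_ideal ?J" by (rule sat_ideal[OF P idl_ideal])
    have YJ: "sat P (idl Y) \<subseteq> ?J" by (intro sat_mono idl_mono) blast
    have "contraction_ext P (insert v V) \<subseteq> ?J"
    proof (rule contraction_ext_minimal[OF P J])
      fix f assume f: "f \<in> polys_in (insert v V)" "f \<in> P"
      then obtain h where h: "poly_over ?A h" "f = poly h ?x"
        using polys_in_insert_eq_poly[OF insert.hyps(2)] by blast
      show "f \<in> ?J"
        unfolding h(2)
      proof (rule saturated_step[OF subring_polys_in P J])
        show "f \<in> ?J" if "s \<notin> P" "s * f \<in> ?J" for s f using that by (rule sat_cancel[OF P])
        show "poly_over ?A g" "poly g ?x \<in> P" "poly_over ?A h" "poly h ?x \<in> P"
          using g h f by auto
        show "poly g ?x \<in> ?J" by (rule subsetD[OF sat_superset[OF P] idl_base]) simp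
        show "lead_coeff g \<notin> P"
          by (rule minimal_poly_lead_coeff[OF subring_polys_in P, of V g ?x]) (use g min in blast)+
        show "degree g \<le> degree f" if "poly_over ?A f" "poly f ?x \<in> P" "\<not> poly_over P f" for f
          using min that by blast
        show "poly f ?x \<in> ?J" if "poly_over ?A f" "poly_over P f" for f
          using poly_variable_contraction_ext[OF P that] Y(3) YJ by blast
      qed
    qed
    moreover have "contraction_ext P V \<subset> contraction_ext P (insert v V)"
      using False contraction_ext_mono[OF P P order_refl, of V "insert v V"] by blast
    then have "prime_chain_length (contraction_ext P (insert v V)) (Suc n)"
      by (rule prime_chain_length_Suc[OF n contraction_ext_prime[OF P]])
    moreover have "card ?Y \<le> Suc n" using card_insert_le_m1[of "Suc n" Y] Y(1,4)
      by (simp add: card_insert_if)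
    ultimately show ?thesis
      using Y(1,2) g by (intro exI[of _ ?Y] exI[of _ "Suc n"]) simp
  qed
qed

text \<open>The variables that modulo P are algebraic over the preceding ones, in the linear order
  of the index type. This finite invariant separates the members of a chain of primes.\<close>

definition jumps :: "('n::{finite,linorder}, 'k::field) mpoly set \<Rightarrow> 'n set" where
  "jumps P = {v. contraction_ext P {..v} \<noteq> contraction_ext P {..<v}}"

text \<open>Let v be the first variable at which the extensions of P and Q differ. If P jumped at v,
  then \<open>fibre_prime_maximal\<close> would force agreement there too; so P does not jump at v,
  and Q must.\<close>

lemma jumps_neq:
  fixes P Q :: "('n::{finite,linorder}, 'k::field) mpoly set"
  assumes P: "P \<in> Spec" and Q: "Q \<in> Spec" and PQ: "P \<subset> Q"
  shows "jumps P \<noteq> jumps Q"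
proof -
  let ?D = "{v. contraction_ext P {..v} \<noteq> contraction_ext Q {..v}}"
  have "{..Max UNIV} = (UNIV :: 'n set)" by auto
  then have "Max UNIV \<in> ?D"
    using PQ contraction_ext_UNIV[OF P] contraction_ext_UNIV[OF Q] by auto
  then have D: "finite ?D" "?D \<noteq> {}" by auto
  define v where "v = Min ?D"
  have v: "v \<in> ?D" unfolding v_def by (rule Min_in[OF D])
  have before: "contraction_ext P {..u} = contraction_ext Q {..u}" if "u < v" for u
  proof (rule ccontr)
    assume "contraction_ext P {..u} \<noteq> contraction_ext Q {..u}"
    then have "u \<in> ?D" by simp
    from Min_le[OF D(1) this] that show False by (simp add: v_def)
  qed
  have lt: "contraction_ext P {..<v} = contraction_ext Q {..<v}"
  proof (cases "{..<v} = {}")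
    case True then show ?thesis by (simp add: contraction_ext_empty P Q)
  next
    case False
    then have "Max {..<v} \<in> {..<v}" by (intro Max_in) auto
    moreover have "{..<v} = {..Max {..<v}}"
      using calculation by (auto intro: Max_ge)
    ultimately show ?thesis using before by (metis lessThan_iff)
  qed
  have ins: "{..v} = insert v {..<v}" by auto
  have "v \<notin> jumps P"
  proof
    assume "v \<in> jumps P"
    then have "contraction_ext P (insert v {..<v}) \<noteq> contraction_ext P {..<v}"
      by (simp add: jumps_def ins)
    note ex = contraction_ext_jump[OF P _ this]
    have contr: "P \<inter> polys_in {..<v} = Q \<inter> polys_in {..<v}"
      using lt contraction_ext_polys_in[OF P, of _ "{..<v}"] contraction_ext_polys_in[OF Q, of _ "{..<v}"]
      by blast
    have "contraction_ext Q {..v} \<subseteq> contraction_ext P {..v}"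
    proof (rule contraction_ext_minimal[OF Q SpecD(1)[OF contraction_ext_prime[OF P]]])
      fix f assume f: "f \<in> polys_in {..v}" "f \<in> Q"
      then obtain h where h: "poly_over (polys_in {..<v}) h" "f = poly h (variable v)"
        using polys_in_insert_eq_poly[of v "{..<v}"] unfolding ins by auto
      have "f \<in> P"
        unfolding h(2)
        by (rule fibre_prime_maximal[OF subring_polys_in P Q _ contr ex h(1)])
           (use PQ f(2) h(2) in auto)
      then show "f \<in> contraction_ext P {..v}" using contraction_ext_polys_in[OF P f(1)] by blast
    qed
    then show False using v contraction_ext_mono[OF P Q, of "{..v}" "{..v}"] PQ by blast
  qed
  moreover have "v \<in> jumps Q"
  proof (rule ccontr)
    assume "v \<notin> jumps Q"
    then have "contraction_ext Q {..v} = contraction_ext P {..<v}" by (simp add: jumps_def lt)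
    moreover have "contraction_ext P {..<v} = contraction_ext P {..v}"
      using \<open>v \<notin> jumps P\<close> by (simp add: jumps_def)
    ultimately show False using v by simp
  qed
  ultimately show ?thesis by blast
qed

text \<open>The n + 1 members of a chain have distinct sets of jumps. Any finite bound makes the
  supremum in \<open>height\<close> a genuine maximum.\<close>

lemma prime_chain_length_bounded:
  fixes P :: "('n::{finite,linorder}, 'k::field) mpoly set"
  assumes "prime_chain_length P n" shows "n < 2 ^ card (UNIV :: 'n set)"
proof -
  obtain c where c: "\<forall>i\<le>n. c i \<in> (Spec :: ('n, 'k) mpoly set set)" "\<forall>i<n. c i \<subset> c (Suc i)"
    using assms by (auto simp: prime_chain_length_def)
  have less: "c i \<subset> c j" if "i < j" "j \<le> n" for i j
    using that
  proof (induction j)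
    case (Suc j)
    show ?case
    proof (cases "i = j")
      case True then show ?thesis using c(2) Suc.prems by simp
    next
      case False
      then have "c i \<subset> c j" using Suc by simp
      moreover have "c j \<subset> c (Suc j)" using c(2) Suc.prems by simp
      ultimately show ?thesis by (rule psubset_trans)
    qed
  qed simp
  have "inj_on (\<lambda>i. jumps (c i)) {..n}"
  proof (rule inj_onI, rule ccontr)
    fix i j assume ij: "i \<in> {..n}" "j \<in> {..n}" "jumps (c i) = jumps (c j)" "i \<noteq> j"
    then consider "i < j" | "j < i" by linarith
    then show False
      using jumps_neq[of "c i" "c j"] jumps_neq[of "c j" "c i"] less[of i j] less[of j i] c(1) ij
      by cases auto
  qed
  then have "card {..n} \<le> card (Pow (UNIV :: 'n set))"
    by (rule card_inj_on_le) auto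
  then show ?thesis unfolding card_atMost card_Pow[OF finite] by simp
qed

lemma height_ge:
  fixes P :: "('n::{finite,linorder}, 'k::field) mpoly set"
  assumes "prime_chain_length P n" shows "n \<le> height P"
proof -
  have "bdd_above {n. prime_chain_length P n}"
    using prime_chain_length_bounded by (intro bdd_aboveI[of _ "2 ^ card (UNIV :: 'n set)"]) (auto dest: less_imp_le)
  then show ?thesis unfolding height_eq using assms by (intro cSup_upper) auto
qed

lemma generators_le_height:
  fixes P :: "('n::{finite,linorder}, 'k::field) mpoly set"
  assumes P: "P \<in> Spec"
  obtains Y where "finite Y" "Y \<subseteq> P" "P \<subseteq> sat P (idl Y)" "card Y \<le> height P"
proof -
  obtain Y n where Y: "finite Y" "Y \<subseteq> P" "P \<subseteq> sat P (idl Y)" "card Y \<le> n"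
    and n: "prime_chain_length P n"
    using contraction_ext_generators[OF P, of UNIV] contraction_ext_UNIV[OF P] by auto
  show ?thesis using Y height_ge[OF n] by (intro that[of Y]) auto
qed

lemma height_pos:
  fixes P :: "('n::{finite,linorder}, 'k::field) mpoly set"
  assumes P: "P \<in> Spec" and "P \<noteq> {0}" shows "height P > 0"
proof -
  have "{0} \<in> (Spec :: ('n, 'k) mpoly set set)"
    using contraction_ext_prime[OF P, of "{}"] contraction_ext_empty[OF P] by simp
  moreover have "{0} \<subset> P" using assms ideal_zero[OF SpecD(1)[OF P]] by blast
  ultimately have "prime_chain_length P (Suc 0)"
    using prime_chain_length_Suc[OF prime_chain_length_0 P] by blast
  then show ?thesis using height_ge by fastforce
qed

section \<open>Integral closure and associated primes\<close>

lemma integral_closure_superset: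
  assumes J: "is_ideal J" shows "J \<subseteq> integral_closure J"
proof
  fix f assume "f \<in> J"
  then have "- f \<in> ideal_power J 1" using ideal_uminus[OF J] by (simp only: ideal_power_1[OF J])
  then show "f \<in> integral_closure J"
    unfolding integral_closure_def by (intro CollectI exI[of _ 1] conjI exI[of _ "\<lambda>_. - f"]) simp_all
qed

lemma integral_closure_proper:
  assumes J: "is_ideal J" and "1 \<in> integral_closure J" shows "J = UNIV"
proof -
  obtain n a where a: "\<forall>i\<in>{1..n}. a i \<in> ideal_power J i" "1 ^ n + (\<Sum>i=1..n. a i * 1 ^ (n - i)) = 0"
    using assms(2) unfolding integral_closure_def by blast
  have sub: "ideal_power J i \<subseteq> J" if "i \<ge> 1" for i
    using ideal_power_antimono[OF J that] by (simp only: ideal_power_1[OF J])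
  have "(\<Sum>i=1..n. a i) \<in> J"
  proof (rule ideal_sum[OF J])
    fix i assume i: "i \<in> {1..n}"
    then have "i \<ge> 1" by simp
    from sub[OF this] show "a i \<in> J" using a(1) i by blast
  qed
  moreover have "1 = - (\<Sum>i=1..n. a i)" using a(2) by (simp add: eq_neg_iff_add_eq_0)
  ultimately have "1 \<in> J" using ideal_uminus[OF J] by metis
  then show ?thesis using ideal_eq_UNIV_iff[OF J] by blast
qed

text \<open>Substitute f = (f + j) - j in an equation for f and collect powers of f + j; the new
  coefficients b(k) stay in J^k. Stability under adding J is what
  \<open>Ass_integral_closure_superset\<close> uses.\<close>

lemma integral_closure_add:
  assumes J: "is_ideal J" and f: "f \<in> integral_closure J" and j: "j \<in> J"
  shows "f + j \<in> integral_closure J"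
proof -
  obtain n a where n: "n > 0" and a: "\<forall>i\<in>{1..n}. a i \<in> ideal_power J i"
    and eq: "f ^ n + (\<Sum>i=1..n. a i * f ^ (n - i)) = 0"
    using f unfolding integral_closure_def by blast
  let ?g = "f + j"
  \<comment> \<open>The leading coefficient 1 joins the sum as index 0, being an element of J^0 =
    S.\<close>
  define a' where "a' = a(0 := 1)"
  have a': "a' i \<in> ideal_power J i" if "i \<le> n" for i
    using a that by (cases "i = 0") (auto simp: a'_def ideal_power_0)
  define b where "b k = (\<Sum>i\<le>k. a' i * of_nat ((n - i) choose (k - i)) * (- j) ^ (k - i))" for k
  have split: "(\<Sum>k\<le>n. h k) = h 0 + (\<Sum>k=1..n. h k)" for h :: "nat \<Rightarrow> 'a"
  proof -
    have "{..n} = insert 0 {1..n}" by auto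
    then show ?thesis by simp
  qed
  have "b k \<in> ideal_power J k" if "k \<le> n" for k
    unfolding b_def
  proof (intro ideal_sum[OF ideal_power_ideal[OF J]])
    fix i assume i: "i \<in> {..k}"
    have "(- j) ^ (k - i) \<in> ideal_power J ((k - i) * 1)"
      using ideal_uminus[OF J j] by (intro ideal_power_power[OF J]) (simp only: ideal_power_1[OF J])
    moreover have "a' i * of_nat ((n - i) choose (k - i)) \<in> ideal_power J i"
      using i that by (intro ideal_mult_right[OF ideal_power_ideal[OF J]] a') simp
    ultimately have "a' i * of_nat ((n - i) choose (k - i)) * (- j) ^ (k - i)
        \<in> ideal_power J (i + (k - i) * 1)" by (intro ideal_power_mult[OF J])
    then show "a' i * of_nat ((n - i) choose (k - i)) * (- j) ^ (k - i) \<in> ideal_power J k"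
      using i by simp
  qed
  moreover have "?g ^ n + (\<Sum>k=1..n. b k * ?g ^ (n - k)) = 0"
  proof -
    let ?t = "\<lambda>i l. a' i * of_nat ((n - i) choose l) * (- j) ^ l * ?g ^ (n - i - l)"
    have "0 = (\<Sum>i\<le>n. a' i * f ^ (n - i))" using eq by (simp add: split a'_def)
    also have "\<dots> = (\<Sum>i\<le>n. \<Sum>l\<le>n - i. ?t i l)"
    proof (intro sum.cong refl)
      fix i
      have "f ^ (n - i) = (- j + ?g) ^ (n - i)" by simp
      also have "\<dots> = (\<Sum>l\<le>n - i. of_nat ((n - i) choose l) * (- j) ^ l * ?g ^ (n - i - l))"
        by (rule binomial_ring)
      finally show "a' i * f ^ (n - i) = (\<Sum>l\<le>n - i. ?t i l)"
        by (simp only: sum_distrib_left mult.assoc)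
    qed
    also have "\<dots> = (\<Sum>(i, l)\<in>(SIGMA i:{..n}. {..n - i}). ?t i l)"
      by (simp add: sum.Sigma)
    also have "(SIGMA i:{..n}. {..n - i}) = {(i, l). i + l \<le> n}" by auto
    also have "(\<Sum>(i, l)\<in>{(i, l). i + l \<le> n}. ?t i l) = (\<Sum>k\<le>n. \<Sum>i\<le>k. ?t i (k - i))"
      by (rule sum.triangle_reindex_eq)
    also have "\<dots> = (\<Sum>k\<le>n. b k * ?g ^ (n - k))"
      unfolding b_def sum_distrib_right by (intro sum.cong refl) simp
    finally show ?thesis by (simp add: split b_def a'_def)
  qed
  ultimately show ?thesis
    unfolding integral_closure_def using n by (intro CollectI exI[of _ n] conjI exI[of _ b]) simp_all
qed

text \<open>For n the degree of an equation of f, J^n f^N lies in J^N: when N \<ge> n, the equation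
  rewrites f^n by lower powers with coefficients in powers of J. The multiplier d does not depend on
  N, as tight closure requires.\<close>

lemma integral_closure_multiplier:
  assumes J: "is_ideal J" and f: "f \<in> integral_closure J"
  obtains n where "\<And>d N. d \<in> ideal_power J n \<Longrightarrow> d * f ^ N \<in> ideal_power J N"
proof -
  obtain n a where a: "\<forall>i\<in>{1..n}. a i \<in> ideal_power J i"
    and eq: "f ^ n + (\<Sum>i=1..n. a i * f ^ (n - i)) = 0"
    using f unfolding integral_closure_def by blast
  have "d * f ^ N \<in> ideal_power J N" if d: "d \<in> ideal_power J n" for d N
  proof (induction N rule: less_induct)
    case (less N)
    note I = ideal_power_ideal[OF J]
    show ?case
    proof (cases "n \<le> N")
      case False
      then have "d \<in> ideal_power J N" using ideal_power_antimono[OF J, of N n] d by auto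
      then show ?thesis by (rule ideal_mult_right[OF I])
    next
      case True
      have "f ^ n = - (\<Sum>i=1..n. a i * f ^ (n - i))" using eq by (simp add: eq_neg_iff_add_eq_0)
      moreover have "d * f ^ N = d * f ^ (N - n) * f ^ n"
        using True by (simp add: mult.assoc flip: power_add)
      ultimately have "d * f ^ N = - (\<Sum>i=1..n. d * f ^ (N - n) * (a i * f ^ (n - i)))"
        by (simp add: sum_distrib_left)
      also have "\<dots> = - (\<Sum>i=1..n. a i * (d * f ^ (N - i)))"
      proof (intro arg_cong[of _ _ uminus] sum.cong refl)
        fix i assume "i \<in> {1..n}"
        then have "f ^ (N - i) = f ^ (N - n) * f ^ (n - i)" using True by (simp flip: power_add)
        then show "d * f ^ (N - n) * (a i * f ^ (n - i)) = a i * (d * f ^ (N - i))"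
          by (simp add: mult_ac)
      qed
      also have "\<dots> \<in> ideal_power J N"
      proof (intro ideal_uminus[OF I] ideal_sum[OF I])
        fix i assume i: "i \<in> {1..n}"
        have "a i * (d * f ^ (N - i)) \<in> ideal_power J (i + (N - i))"
          using a i True by (intro ideal_power_mult[OF J] less) auto
        then show "a i * (d * f ^ (N - i)) \<in> ideal_power J N" using i True by simp
      qed
      finally show ?thesis .
    qed
  qed
  then show ?thesis by (rule that)
qed

lemma ideal_power_nonzero:
  fixes J :: "'a::idom set"
  assumes J: "is_ideal J" "J \<noteq> {0}" obtains d where "d \<in> ideal_power J n" "d \<noteq> 0"
proof -
  obtain x where x: "x \<in> J" "x \<noteq> 0" using J ideal_zero[OF J(1)] by blast
  have "x ^ n \<in> ideal_power J (n * 1)"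
    by (rule ideal_power_power[OF J(1)]) (simp only: ideal_power_1[OF J(1)] x)
  then show ?thesis using x by (intro that[of "x ^ n"]) simp_all
qed

text \<open>The quotient is unfolded into cosets of the integral closure C. As 0 annihilates x, all
  c + c' (c'' + y) lie in C; with r in place of 0 they change by a multiple of r, an element of J,
  and C is stable under adding J.\<close>

lemma Ass_integral_closure_superset:
  assumes J: "is_ideal J" and P: "P \<in> Ass (integral_closure J)"
  shows "J \<subseteq> P"
proof
  fix r assume r: "r \<in> J"
  let ?C = "integral_closure J" and ?R = "cring_class_ops :: 'a ring"
  obtain x where PS: "P \<in> Spec" and "x \<in> carrier (?R Quot ?C)"
    and P_eq: "P = {r. (?C +>\<^bsub>?R\<^esub> r) \<otimes>\<^bsub>?R Quot ?C\<^esub> x = \<zero>\<^bsub>?R Quot ?C\<^esub>}"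
    using P unfolding Ass_def by blast
  then obtain y where x: "x = ?C +>\<^bsub>?R\<^esub> y" by (auto simp: FactRing_def A_RCOSETS_def')
  have coset: "?C +>\<^bsub>?R\<^esub> z = {c + z |c. c \<in> ?C}" for z
    by (auto simp: a_r_coset_def' plus_class)
  have mem_P: "z \<in> P \<longleftrightarrow> {c + (c' + z) * (c'' + y) |c c' c''. c \<in> ?C \<and> c' \<in> ?C \<and> c'' \<in> ?C} = ?C" for z
  proof -
    have "(?C +>\<^bsub>?R\<^esub> z) \<otimes>\<^bsub>?R Quot ?C\<^esub> x
        = {c + (c' + z) * (c'' + y) |c c' c''. c \<in> ?C \<and> c' \<in> ?C \<and> c'' \<in> ?C}"
      unfolding x by (auto simp: FactRing_def rcoset_mult_def coset times_class)
    then show ?thesis by (simp add: P_eq FactRing_def)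
  qed
  have JC: "J \<subseteq> ?C" by (rule integral_closure_superset[OF J])
  have "0 \<in> P" by (rule ideal_zero[OF SpecD(1)[OF PS]])
  then have 0: "c + c' * (c'' + y) \<in> ?C" if "c \<in> ?C" "c' \<in> ?C" "c'' \<in> ?C" for c c' c''
    using that unfolding mem_P by auto
  show "r \<in> P"
    unfolding mem_P
  proof (intro equalityI subsetI)
    fix z assume "z \<in> {c + (c' + r) * (c'' + y) |c c' c''. c \<in> ?C \<and> c' \<in> ?C \<and> c'' \<in> ?C}"
    then obtain c c' c'' where c: "c \<in> ?C" "c' \<in> ?C" "c'' \<in> ?C" "z = c + (c' + r) * (c'' + y)" by blast
    have "z = (c + c' * (c'' + y)) + r * (c'' + y)" by (simp add: c(4) algebra_simps)
    also have "\<dots> \<in> ?C" by (intro integral_closure_add[OF J] 0 c ideal_mult_right[OF J r])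
    finally show "z \<in> ?C" .
  next
    fix z assume "z \<in> ?C"
    \<comment> \<open>Taking c' = -r makes the product vanish, so every z in C is attained.\<close>
    moreover have "- r \<in> ?C" using JC ideal_uminus[OF J r] by blast
    ultimately show "z \<in> {c + (c' + r) * (c'' + y) |c c' c''. c \<in> ?C \<and> c' \<in> ?C \<and> c'' \<in> ?C}"
      by (intro CollectI exI[of _ z] exI[of _ "- r"]) simp
  qed
qed

lemma StAssD:
  assumes I: "is_ideal I" and P: "P \<in> StAss I" shows "P \<in> Spec" "I \<subseteq> P"
proof -
  obtain s where s: "P \<in> Ass (integral_closure (ideal_power I s))" using P by (auto simp: StAss_def)
  then show PS: "P \<in> Spec" by (auto simp: Ass_def)
  have sub: "ideal_power I s \<subseteq> P"
    by (rule Ass_integral_closure_superset[OF ideal_power_ideal[OF I] s])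
  show "I \<subseteq> P"
  proof
    fix x assume "x \<in> I"
    then have "x ^ s \<in> ideal_power I (s * 1)"
      by (intro ideal_power_power[OF I]) (simp only: ideal_power_1[OF I])
    then show "x \<in> P" using sub by (intro Spec_power[OF PS, of x s]) auto
  qed
qed

lemma prime_contains_Inter:
  assumes P: "P \<in> Spec" and E: "finite E" "\<And>Q. Q \<in> E \<Longrightarrow> is_ideal Q" "\<Inter>E \<subseteq> P"
  shows "\<exists>Q\<in>E. Q \<subseteq> P"
proof (rule ccontr)
  assume "\<not> ?thesis"
  then have "\<forall>Q\<in>E. \<exists>x. x \<in> Q \<and> x \<notin> P" by blast
  then obtain x where x: "\<And>Q. Q \<in> E \<Longrightarrow> x Q \<in> Q" "\<And>Q. Q \<in> E \<Longrightarrow> x Q \<notin> P" by metis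
  have "prod x E \<in> Q" if "Q \<in> E" for Q
    using ideal_mult_right[OF E(2)[OF that] x(1)[OF that]] prod.remove[OF E(1) that, of x] by simp
  then have "prod x E \<in> P" using E(3) by blast
  then show False using Spec_prod[OF E(1) P, of x, OF x(2)] by blast
qed

context mpoly_frobenius_order
begin

text \<open>With a multiplier d \<noteq> 0 independent of q and l = \<open>card B\<close>, the
  element d x^q lies in I^((k + l) q), which the pigeonhole puts into (I^k)^[q]. So d is in every
  Frobenius power of (I^k : x), and this colon is the whole ring.\<close>

lemma integral_closure_power_subset:
  fixes I :: "('n, 'k) mpoly set"
  assumes I: "is_ideal I" "I \<noteq> {0}" and B: "finite B" "I = idl B"
  shows "integral_closure (ideal_power I (k + card B)) \<subseteq> ideal_power I k"
proof
  fix x assume x: "x \<in> integral_closure (ideal_power I (k + card B))"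
  let ?J = "ideal_power I (k + card B)" and ?L = "ideal_power I k"
  have J: "is_ideal ?J" and L: "is_ideal ?L" by (rule ideal_power_ideal[OF I(1)])+
  obtain n where n: "\<And>d N. d \<in> ideal_power ?J n \<Longrightarrow> d * x ^ N \<in> ideal_power ?J N"
    by (rule integral_closure_multiplier[OF J x]) blast
  obtain d where d: "d \<in> ideal_power ?J n" "d \<noteq> 0"
    using ideal_power_nonzero[OF I, of "(k + card B) * n"]
    by (auto simp only: ideal_power_ideal_power[OF I(1)])
  have "d \<in> frobenius_power (p ^ e) {y. y * x \<in> ?L}" for e
  proof -
    have "d * x ^ (p ^ e) \<in> ideal_power I ((k + card B) * p ^ e)"
      using n[OF d(1), of "p ^ e"] by (simp only: ideal_power_ideal_power[OF I(1)])
    also have "\<dots> \<subseteq> frobenius_power (p ^ e) ?L"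
      unfolding B(2)
    proof (rule ideal_power_subset_frobenius_power[OF B(1)])
      have "card B * (p ^ e - 1) \<le> card B * p ^ e" by (rule mult_le_mono2) simp
      moreover have "p ^ e > 0" by simp
      ultimately show "k * p ^ e + card B * (p ^ e - 1) < (k + card B) * p ^ e + p ^ e"
        by (simp only: add_mult_distrib)
    qed simp
    finally show ?thesis unfolding frobenius_power_colon[OF L] .
  qed
  then have "{y. y * x \<in> ?L} = UNIV" by (rule mem_all_frobenius_powers[OF ideal_colon[OF L] d(2)])
  then have "1 * x \<in> ?L" by blast
  then show "x \<in> ?L" by simp
qed

section \<open>Ideals compatible with F and their finiteness\<close>

text \<open>Fedder's condition that F^(q - 1) lie in (J^[q] : J), for all q: equivalently, every map
  \<phi>(F^(q - 1) f) of f built from a Frobenius coordinate \<phi> sends J into itself.\<close>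

definition compatible :: "('n, 'k) mpoly \<Rightarrow> ('n, 'k) mpoly set \<Rightarrow> bool" where
  "compatible F J \<longleftrightarrow> is_ideal J \<and> (\<forall>e. \<forall>f\<in>J. F ^ (p ^ e - 1) * f \<in> frobenius_power (p ^ e) J)"

text \<open>A finite piece of the initial ideal; for compatible ideals it determines the rest, so
  its cardinality decides equality of nested ones.\<close>

definition squarefree_lms :: "('n, 'k) mpoly set \<Rightarrow> ('n \<Rightarrow>\<^sub>0 nat) set" where
  "squarefree_lms J = {m. squarefree_monomial m \<and> (\<exists>f\<in>J. f \<noteq> 0 \<and> lm f = m)}"

lemma finite_squarefree_monomials: "finite {m :: 'n \<Rightarrow>\<^sub>0 nat. squarefree_monomial m}"
proof (rule finite_subset)
  show "{m :: 'n \<Rightarrow>\<^sub>0 nat. squarefree_monomial m} \<subseteq> range (\<lambda>V. mon (\<lambda>i. if i \<in> V then 1 else 0))"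
  proof clarify
    fix m :: "'n \<Rightarrow>\<^sub>0 nat" assume m: "squarefree_monomial m"
    have "lookup m i = (if lookup m i \<noteq> 0 then 1 else 0)" for i
      using m unfolding squarefree_monomial_def by (auto dest: spec[of _ i])
    then have "m = mon (\<lambda>i. if i \<in> {i. lookup m i \<noteq> 0} then 1 else 0)"
      by (intro poly_mapping_eqI) (simp only: lookup_mon mem_Collect_eq)
    then show "m \<in> range (\<lambda>V. mon (\<lambda>i. if i \<in> V then 1 else 0))" by (rule range_eqI)
  qed
qed simp

lemma finite_squarefree_lms: "finite (squarefree_lms J)"
  by (rule finite_subset[OF _ finite_squarefree_monomials]) (auto simp: squarefree_lms_def)

lemma squarefree_lms_mono: "J \<subseteq> J' \<Longrightarrow> squarefree_lms J \<subseteq> squarefree_lms J'"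
  by (auto simp: squarefree_lms_def)

lemma compatible_Inter: "(\<And>J. J \<in> \<J> \<Longrightarrow> compatible F J) \<Longrightarrow> compatible F (\<Inter>\<J>)"
  by (auto simp: compatible_def frobenius_power_Inter ideal_Inter)

text \<open>Applying a coordinate of Frobenius to \<open>F\<^sup>q\<^sup>-\<^sup>1 f\<close> replaces the initial monomial of \<open>f\<close> by one with
  exponents at most 1 that divides it.\<close>

lemma compatible_squarefree_lm:
  assumes J: "compatible F J" and F: "F \<noteq> 0" "squarefree_monomial (lm F)" and f: "f \<in> J" "f \<noteq> 0"
  obtains g where "g \<in> J" "g \<noteq> 0" "squarefree_monomial (lm g)" "mon_le (lm g) (lm f)"
proof -
  obtain e where e: "p ^ e > (\<Sum>i\<in>UNIV. lookup (lm f) i)" using pe_unbounded by blast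
  let ?q = "p ^ e" and ?G = "F ^ (p ^ e - 1) * f"
  have a: "lookup (lm f) i < ?q" for i using member_le_sum[of i UNIV "lookup (lm f)"] e by simp
  have "?G \<in> frobenius_power ?q J" "is_ideal J" using J f(1) by (auto simp: compatible_def)
  moreover have "?G \<noteq> 0" using F f by simp
  ultimately obtain g where g: "g \<in> J" "g \<noteq> 0" "lm g = mon_div (lm ?G) ?q"
    using lm_frobenius_power by blast
  have lmG: "lm ?G = mon_scale (?q - 1) (lm F) + lm f"
    using F f by (simp add: lm_mult lm_power)
  \<comment> \<open>Each exponent of lm G is at most (q - 1) plus that of lm f, hence below 2q, so
    its quotient by q is at most 1. Where f has exponent 0 it is below q, and the quotient is
    0.\<close>
  have bound: "lookup (lm g) i \<le> 1 \<and> lookup (lm g) i \<le> lookup (lm f) i" for i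
  proof -
    have "(?q - 1) * lookup (lm F) i \<le> (?q - 1) * 1"
      using F(2) unfolding squarefree_monomial_def by (intro mult_le_mono2) blast
    then have le: "(?q - 1) * lookup (lm F) i + lookup (lm f) i \<le> (?q - 1) + lookup (lm f) i" by simp
    have eq: "lookup (lm g) i = ((?q - 1) * lookup (lm F) i + lookup (lm f) i) div ?q"
      unfolding g(3) lmG by (simp only: lookup_mon_div lookup_add lookup_mon_scale)
    have "?q > 0" by simp
    then have "(?q - 1) * lookup (lm F) i + lookup (lm f) i < 2 * ?q" using le a[of i] by linarith
    then have "lookup (lm g) i < 2" unfolding eq by (simp add: less_mult_imp_div_less)
    moreover have "lookup (lm g) i = 0" if "lookup (lm f) i = 0"
      unfolding eq using le that \<open>?q > 0\<close> by (intro div_less) linarith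
    ultimately show ?thesis by (cases "lookup (lm f) i") auto
  qed
  show ?thesis
    by (rule that[OF g(1,2)]) (use bound in \<open>auto simp: squarefree_monomial_def mon_le_def\<close>)
qed

lemma compatible_eqI:
  assumes "is_ideal J" and J': "compatible F J'" and F: "F \<noteq> 0" "squarefree_monomial (lm F)"
    and sub: "J \<subseteq> J'" and lms: "card (squarefree_lms J') \<le> card (squarefree_lms J)"
  shows "J = J'"
proof (rule ideal_eqI_lm)
  show "is_ideal J'" using J' by (simp add: compatible_def)
  fix f assume "f \<in> J'" "f \<noteq> 0"
  then obtain g where g: "g \<in> J'" "g \<noteq> 0" "squarefree_monomial (lm g)" "mon_le (lm g) (lm f)"
    by (rule compatible_squarefree_lm[OF J' F])
  have "squarefree_lms J = squarefree_lms J'"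
    by (rule card_seteq[OF finite_squarefree_lms squarefree_lms_mono[OF sub] lms])
  moreover have "lm g \<in> squarefree_lms J'" using g by (auto simp: squarefree_lms_def)
  ultimately obtain g' where "g' \<in> J" "g' \<noteq> 0" "lm g' = lm g"
    unfolding squarefree_lms_def by blast
  then show "\<exists>g\<in>J. g \<noteq> 0 \<and> mon_le (lm g) (lm f)" using g(4) by auto
qed (use assms in auto)

text \<open>Among the infinite subfamilies let D maximize the number of squarefree initial monomials
  of the intersection; all infinite subfamilies of D then share that intersection. It is prime, as
  one of two halves of D is infinite, and finite subfamilies reach it, so it belongs to every
  infinite subfamily of D. But it can be removed from D.\<close>

lemma finite_compatible_primes:
  assumes F: "F \<noteq> 0" "squarefree_monomial (lm F)"
    and C: "\<And>P. P \<in> C \<Longrightarrow> P \<in> Spec" "\<And>P. P \<in> C \<Longrightarrow> compatible F P"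
  shows "finite C"
proof (rule ccontr)
  assume inf: "infinite C"
  let ?card = "\<lambda>D. card (squarefree_lms (\<Inter>D))"
  have compat: "compatible F (\<Inter>D)" if "D \<subseteq> C" for D
    using that C(2) by (intro compatible_Inter) blast
  have ideal: "is_ideal (\<Inter>D)" if "D \<subseteq> C" for D
    using compat[OF that] by (simp add: compatible_def)
  have "?card D \<le> card {m :: 'n \<Rightarrow>\<^sub>0 nat. squarefree_monomial m}" for D
    by (rule card_mono[OF finite_squarefree_monomials]) (auto simp: squarefree_lms_def)
  then have bound: "?card D < Suc (card {m :: 'n \<Rightarrow>\<^sub>0 nat. squarefree_monomial m})" for D
    by (simp only: less_Suc_eq_le)
  have "\<exists>D. (infinite D \<and> D \<subseteq> C) \<and> (\<forall>E. infinite E \<and> E \<subseteq> C \<longrightarrow> ?card E \<le> ?card D)"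
    by (rule ex_has_greatest_nat[of "\<lambda>D. infinite D \<and> D \<subseteq> C" C ?card
        "Suc (card {m :: 'n \<Rightarrow>\<^sub>0 nat. squarefree_monomial m})"])
       (use inf bound in \<open>simp_all add: less_imp_le\<close>)
  then obtain D where D: "infinite D" "D \<subseteq> C"
    and maxD: "\<And>E. infinite E \<Longrightarrow> E \<subseteq> C \<Longrightarrow> ?card E \<le> ?card D" by blast
  have sub_eq: "\<Inter>D = \<Inter>E" if "infinite E" "E \<subseteq> D" for E
  proof -
    have EC: "E \<subseteq> C" using that D by blast
    show ?thesis
      by (rule compatible_eqI[OF ideal[OF D(2)] compat[OF EC] F])
         (rule Inter_anti_mono[OF that(2)], rule maxD[OF that(1) EC])
  qed
  have prime: "\<Inter>D \<in> Spec"
  proof (rule SpecI[OF ideal[OF D(2)]])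
    have "D \<noteq> {}" using D(1) by auto
    then obtain P where P: "P \<in> D" by blast
    then have "1 \<notin> P" using SpecD(2)[OF C(1)] D(2) by blast
    with P show "1 \<notin> \<Inter>D" by blast
    fix a b assume ab: "a * b \<in> \<Inter>D"
    have "a \<in> P \<or> b \<in> P" if "P \<in> D" for P
    proof (rule SpecD(3)[OF C(1)])
      show "P \<in> C" "a * b \<in> P" using that ab D(2) by auto
    qed
    then have D_sub: "D \<subseteq> {P \<in> D. a \<in> P} \<union> {P \<in> D. b \<in> P}" by blast
    have "infinite ({P \<in> D. a \<in> P} \<union> {P \<in> D. b \<in> P})"
      using D(1) finite_subset[OF D_sub] by blast
    then have "infinite {P \<in> D. a \<in> P} \<or> infinite {P \<in> D. b \<in> P}"
      unfolding finite_Un by blast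
    then show "a \<in> \<Inter>D \<or> b \<in> \<Inter>D"
    proof
      assume "infinite {P \<in> D. a \<in> P}"
      then have "\<Inter>D = \<Inter>{P \<in> D. a \<in> P}" by (rule sub_eq) blast
      then show ?thesis by blast
    next
      assume "infinite {P \<in> D. b \<in> P}"
      then have "\<Inter>D = \<Inter>{P \<in> D. b \<in> P}" by (rule sub_eq) blast
      then show ?thesis by blast
    qed
  qed
  have attained: "\<Inter>D \<in> E" if E: "infinite E" "E \<subseteq> D" for E
  proof -
    have EC: "E \<subseteq> C" using E D by blast
    \<comment> \<open>G has the fewest squarefree initial monomials among finite subfamilies, so
      adding a member of E cannot shrink its intersection, which therefore lies in all members of
      E.\<close>
    obtain G where G: "finite G" "G \<subseteq> E" and minG: "\<And>H. finite H \<Longrightarrow> H \<subseteq> E \<Longrightarrow> ?card G \<le> ?card H"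
      using ex_has_least_nat[of "\<lambda>H. finite H \<and> H \<subseteq> E" "{}" ?card] by blast
    have "\<Inter>G \<subseteq> P" if P: "P \<in> E" for P
    proof -
      have "\<Inter>(insert P G) = \<Inter>G"
      proof (rule compatible_eqI[OF ideal compat F])
        show "insert P G \<subseteq> C" "G \<subseteq> C" "\<Inter>(insert P G) \<subseteq> \<Inter>G" using G(2) EC P by auto
        show "?card G \<le> ?card (insert P G)" using G P by (intro minG) auto
      qed
      then show ?thesis by blast
    qed
    then have "\<Inter>G \<subseteq> \<Inter>D" unfolding sub_eq[OF E] by blast
    moreover have "is_ideal Q" if "Q \<in> G" for Q using that G(2) EC C(2) by (auto simp: compatible_def)
    ultimately obtain Q where Q: "Q \<in> G" "Q \<subseteq> \<Inter>D"
      using prime_contains_Inter[OF prime G(1)] by blast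
    have "Q \<in> E" using Q(1) G(2) by blast
    moreover have "Q \<in> D" using \<open>Q \<in> E\<close> E(2) by blast
    then have "\<Inter>D = Q" using Q(2) by blast
    ultimately show ?thesis by simp
  qed
  have "\<Inter>D \<in> D - {\<Inter>D}" using D(1) by (intro attained) auto
  then show False by blast
qed

end

section \<open>Test ideals\<close>

lemma symbolic_power_nonpos: "l \<le> 0 \<Longrightarrow> symbolic_power P l = UNIV"
  by (simp add: symbolic_power_def)

lemma symbolic_power_proper:
  assumes P: "P \<in> Spec" and "l > 0" shows "1 \<notin> symbolic_power P l"
proof -
  have "symbolic_power P l \<subseteq> sat_power P 1"
    unfolding symbolic_power_eq[OF P] using assms by (intro sat_power_antimono[OF P]) simp
  then show ?thesis using SpecD(2)[OF P] unfolding sat_power_1[OF P] by blast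
qed

lemma symbolic_power_antimono: "P \<in> Spec \<Longrightarrow> m \<le> n \<Longrightarrow> symbolic_power P n \<subseteq> symbolic_power P m"
  by (simp add: symbolic_power_eq sat_power_antimono nat_mono)

text \<open>Negative exponents are included, since truncation at 0 only enlarges the sum of the two.
  \<open>mem_test_ideal\<close> meets them when \<lfloor>c d\<rfloor> + 1 is below the
  height.\<close>

lemma symbolic_power_mult:
  assumes P: "P \<in> Spec" and "a \<in> symbolic_power P m" "b \<in> symbolic_power P n"
  shows "a * b \<in> symbolic_power P (m + n)"
proof -
  have "a * b \<in> sat_power P (nat m + nat n)"
    using assms by (intro sat_power_mult[OF P]) (simp_all add: symbolic_power_eq)
  moreover have "nat (m + n) \<le> nat m + nat n" by simp
  ultimately show ?thesis unfolding symbolic_power_eq[OF P] using sat_power_antimono[OF P] by blast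
qed

lemma symbolic_power_power:
  assumes P: "P \<in> Spec" and a: "a \<in> symbolic_power P m"
  shows "a ^ n \<in> symbolic_power P (int n * m)"
proof (induction n)
  case (Suc n)
  have "a * a ^ n \<in> symbolic_power P (m + int n * m)" by (rule symbolic_power_mult[OF P a Suc])
  then show ?case by (simp add: algebra_simps)
qed (simp add: symbolic_power_nonpos)

lemma sat_power_symbolic: "P \<in> Spec \<Longrightarrow> symbolic_power P (int n) = sat_power P n"
  by (simp add: symbolic_power_eq)

context mpoly_frobenius_order
begin

text \<open>The least ideal exists because Frobenius powers commute with arbitrary intersections:
  the intersection of all candidates is a candidate.\<close>

lemma frobenius_root_properties:
  fixes J :: "('n, 'k) mpoly set"
  shows "is_ideal (frobenius_root (p ^ e) J)" "J \<subseteq> frobenius_power (p ^ e) (frobenius_root (p ^ e) J)"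
    "is_ideal L \<Longrightarrow> J \<subseteq> frobenius_power (p ^ e) L \<Longrightarrow> frobenius_root (p ^ e) J \<subseteq> L"
proof -
  let ?S = "{L. is_ideal L \<and> J \<subseteq> frobenius_power (p ^ e) L}"
  have I: "is_ideal (\<Inter>?S)" by (rule ideal_Inter) simp
  have sub: "J \<subseteq> frobenius_power (p ^ e) (\<Inter>?S)"
    by (subst frobenius_power_Inter) auto
  have "frobenius_root (p ^ e) J = \<Inter>?S"
    unfolding frobenius_root_def by (rule Least_equality) (use I sub in auto)
  then show "is_ideal (frobenius_root (p ^ e) J)"
    "J \<subseteq> frobenius_power (p ^ e) (frobenius_root (p ^ e) J)"
    "is_ideal L \<Longrightarrow> J \<subseteq> frobenius_power (p ^ e) L \<Longrightarrow> frobenius_root (p ^ e) J \<subseteq> L"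
    using I sub by auto
qed

lemma sat_power_subset_frobenius_power_height:
  fixes P :: "('n, 'k) mpoly set"
  assumes P: "P \<in> Spec" and n: "n + p ^ e > k * p ^ e + height P * (p ^ e - 1)"
  shows "sat_power P n \<subseteq> frobenius_power (p ^ e) (sat_power P k)"
proof -
  obtain Y where Y: "finite Y" "Y \<subseteq> P" "P \<subseteq> sat P (idl Y)" "card Y \<le> height P"
    by (rule generators_le_height[OF P])
  have "card Y * (p ^ e - 1) \<le> height P * (p ^ e - 1)" by (rule mult_le_mono1[OF Y(4)])
  then show ?thesis using n by (intro sat_power_subset_frobenius_power[OF P Y(1-3)]) linarith
qed

text \<open>An element of all symbolic powers would lie in P^[q] for every q. Separation makes the
  order of a nonzero element, and with it e_P(I), finite.\<close>

lemma not_mem_sat_power: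
  fixes P :: "('n, 'k) mpoly set"
  assumes P: "P \<in> Spec" and x: "x \<noteq> 0" obtains n where "x \<notin> sat_power P n"
proof -
  have "\<exists>n. x \<notin> sat_power P n"
  proof (rule ccontr)
    assume "\<not> ?thesis"
    then have all: "x \<in> sat_power P n" for n by blast
    have "x \<in> frobenius_power (p ^ e) P" for e
    proof -
      let ?n = "height P * (p ^ e - 1) + 1"
      have "sat_power P ?n \<subseteq> frobenius_power (p ^ e) (sat_power P 1)"
        by (rule sat_power_subset_frobenius_power_height[OF P]) simp
      then show ?thesis using all[of ?n] unfolding sat_power_1[OF P] by blast
    qed
    then have "P = UNIV" by (rule mem_all_frobenius_powers[OF SpecD(1)[OF P] x])
    then show False using SpecD(2)[OF P] by blast
  qed
  then show ?thesis using that by blast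
qed

text \<open>The element x of exact order d is kept as a witness: it bounds the exponents of
  condition (diamond) in \<open>mem_test_ideal\<close>.\<close>

lemma symbolic_order_eq:
  fixes P I :: "('n, 'k) mpoly set"
  assumes P: "P \<in> Spec" and I: "is_ideal I" "I \<noteq> {0}" "I \<subseteq> P"
  obtains d x where "symbolic_order P I = int d" "d > 0" "I \<subseteq> sat_power P d"
    "x \<in> I" "x \<notin> sat_power P (d + 1)"
proof -
  obtain y where y: "y \<in> I" "y \<noteq> 0" using I ideal_zero[OF I(1)] by blast
  obtain n where n: "y \<notin> sat_power P n" by (rule not_mem_sat_power[OF P y(2)])
  then have "n \<noteq> 0" by (metis UNIV_I sat_power_0[OF P])
  then obtain n' where n': "n = Suc n'" by (cases n) auto
  define d where "d = (LEAST d. \<not> I \<subseteq> sat_power P (Suc d))"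
  have ex: "\<not> I \<subseteq> sat_power P (Suc n')" using n n' y by blast
  have d1: "\<not> I \<subseteq> sat_power P (Suc d)"
    unfolding d_def by (rule LeastI[of "\<lambda>d. \<not> I \<subseteq> sat_power P (Suc d)", OF ex])
  have d2: "I \<subseteq> sat_power P d"
  proof (cases d)
    case 0 then show ?thesis by (simp add: sat_power_0[OF P])
  next
    case (Suc d')
    then have "d' < d" by simp
    then have "I \<subseteq> sat_power P (Suc d')"
      unfolding d_def using not_less_Least by blast
    then show ?thesis using Suc by simp
  qed
  have "d \<noteq> 0"
  proof
    assume "d = 0"
    then have "\<not> I \<subseteq> sat_power P 1" using d1 by simp
    then show False using I(3) unfolding sat_power_1[OF P] by blast
  qed
  moreover have "symbolic_order P I = int d"
    unfolding symbolic_order_def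
  proof (rule Greatest_equality)
    show "I \<subseteq> symbolic_power P (int d)" using d2 by (simp add: sat_power_symbolic[OF P])
    fix l assume l: "I \<subseteq> symbolic_power P l"
    show "l \<le> int d"
    proof (rule ccontr)
      assume "\<not> l \<le> int d"
      then have "symbolic_power P l \<subseteq> sat_power P (Suc d)"
        unfolding symbolic_power_eq[OF P] by (intro sat_power_antimono[OF P]) simp
      then show False using l d1 by blast
    qed
  qed
  ultimately show ?thesis using d1 d2 that[of d] by (auto simp: subset_eq)
qed

text \<open>At P the power of I with exponent \<lceil>c q\<rceil> has order at least q \<lfloor>c
  d\<rfloor>, and the pigeonhole costs height P (q - 1). This leaves the Frobenius power of the
  symbolic power on the right.\<close>

lemma test_ideal_subset_symbolic_power:
  fixes P I :: "('n, 'k) mpoly set"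
  assumes p: "p = CHAR('k)" and P: "P \<in> Spec" and I: "is_ideal I" "I \<noteq> {0}" "I \<subseteq> P" and c: "c > 0"
  shows "test_ideal c I \<subseteq> symbolic_power P (\<lfloor>c * real_of_int (symbolic_order P I)\<rfloor> + 1 - int (height P))"
proof -
  obtain d x where d: "symbolic_order P I = int d" "I \<subseteq> sat_power P d"
    by (rule symbolic_order_eq[OF P I])
  define fl where "fl = \<lfloor>c * real d\<rfloor>"
  let ?l = "fl + 1 - int (height P)"
  \<comment> \<open>The strict inequality of the pigeonhole comes down to this.\<close>
  have h: "height P > 0" using I ideal_zero[OF I(1)] by (intro height_pos[OF P]) blast
  have "frobenius_root (p ^ e) (ideal_power I (nat \<lceil>c * real (p ^ e)\<rceil>)) \<subseteq> symbolic_power P ?l" for e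
  proof (cases "?l \<le> 0")
    case True then show ?thesis by (simp add: symbolic_power_nonpos)
  next
    case False
    define q where "q = p ^ e"
    define n where "n = nat \<lceil>c * real q\<rceil>"
    define k where "k = nat ?l"
    have q: "q \<ge> 1" using p_pos by (simp add: q_def Suc_leI)
    have k: "int k = ?l" using False by (simp add: k_def)
    have "c * real q \<le> real n" unfolding n_def by (rule real_nat_ceiling_ge)
    then have "real_of_int fl * real q \<le> real n * real d"
    proof -
      assume le: "c * real q \<le> real n"
      have "real_of_int fl * real q \<le> (c * real d) * real q"
        unfolding fl_def by (intro mult_right_mono of_int_floor_le) simp
      also have "\<dots> = (c * real q) * real d" by simp
      also have "\<dots> \<le> real n * real d" by (intro mult_right_mono le) simp
      finally show ?thesis .
    qed
    then have "real_of_int (fl * int q) \<le> real_of_int (int (n * d))" by simp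
    then have fln: "fl * int q \<le> int (n * d)" by (simp only: of_int_le_iff)
    have "int (k * q + height P * (q - 1)) = (fl + 1 - int (height P)) * int q + int (height P) * (int q - 1)"
      using q by (simp add: k of_nat_diff)
    also have "\<dots> = fl * int q + int q - int (height P)" by (simp add: algebra_simps)
    also have "\<dots> < int (n * d + q)" using fln h by simp
    finally have "k * q + height P * (q - 1) < n * d + q" by (simp only: of_nat_less_iff)
    then have "sat_power P (n * d) \<subseteq> frobenius_power q (sat_power P k)"
      unfolding q_def by (rule sat_power_subset_frobenius_power_height[OF P])
    moreover have "ideal_power I n \<subseteq> sat_power P (n * d)"
      by (rule ideal_power_subset_sat_power[OF P I(1) d(2)])
    ultimately have "ideal_power I n \<subseteq> frobenius_power q (sat_power P k)" by blast
    then have "frobenius_root q (ideal_power I n) \<subseteq> sat_power P k"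
      unfolding q_def by (rule frobenius_root_properties(3)[OF sat_power_ideal[OF P]])
    then show ?thesis by (simp add: symbolic_power_eq[OF P] k_def n_def q_def)
  qed
  then show ?thesis unfolding test_ideal_def p[symmetric] d(1) fl_def by auto
qed

text \<open>F^(q - 1) f has order at least (q - 1) height P + 1, the least value that the pigeonhole
  accepts for k = 1.\<close>

lemma compatible_if_mem_symbolic_power:
  assumes P: "P \<in> Spec" and F: "F \<in> symbolic_power P (int (height P))"
  shows "compatible F P"
  unfolding compatible_def
proof (intro conjI allI ballI)
  show IP: "is_ideal P" by (rule SpecD(1)[OF P])
  fix e f assume f: "f \<in> P"
  let ?n = "(p ^ e - 1) * height P + 1"
  have "F \<in> sat_power P (height P)" using F by (simp only: sat_power_symbolic[OF P])
  moreover have "f \<in> sat_power P 1" using f by (simp only: sat_power_1[OF P])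
  ultimately have "F ^ (p ^ e - 1) * f \<in> sat_power P ?n"
    by (intro sat_power_mult[OF P] sat_power_power[OF P])
  moreover have "sat_power P ?n \<subseteq> frobenius_power (p ^ e) (sat_power P 1)"
    by (rule sat_power_subset_frobenius_power_height[OF P]) simp
  ultimately show "F ^ (p ^ e - 1) * f \<in> frobenius_power (p ^ e) P"
    unfolding sat_power_1[OF P] by blast
qed

lemma mem_test_ideal:
  fixes I :: "('n, 'k) mpoly set"
  assumes p: "p = CHAR('k)" and I: "is_ideal I" "I \<noteq> {0}" and c: "c > 0"
    and dia: "\<And>s. s \<ge> s0 \<Longrightarrow>
      integral_closure (ideal_power I s) = (\<Inter>P\<in>StAss I. symbolic_power P (int (g P s)))"
    and F: "F \<noteq> 0" "squarefree_monomial (lm F)"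
      "\<And>P. P \<in> StAss I \<Longrightarrow> F \<in> symbolic_power P (int (height P))"
    and fin: "finite (StAss I)"
    and f: "\<And>P. P \<in> StAss I \<Longrightarrow>
      f \<in> symbolic_power P (\<lfloor>c * real_of_int (symbolic_order P I)\<rfloor> + 1 - int (height P))"
  shows "f \<in> test_ideal c I"
proof -
  obtain B where B: "finite B" "I = idl B" by (rule ideal_finitely_generated[OF I(1)])
  note S = StAssD[OF I(1)]
  let ?d = "\<lambda>P. real_of_int (symbolic_order P I)"
  \<comment> \<open>For q \<ge> \<open>?N P\<close> one has (c q + 1 + l) d \<le> q (\<lfloor>c
    d\<rfloor> + 1) - height P, where l = \<open>card B\<close>, d = e_P(I), and c q + 1 + l bounds
    the exponent s below. The other requirement on q is c q \<ge> s0, so that condition (diamond)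
    applies at s.\<close>
  let ?N = "\<lambda>P. (real (height P) + (1 + real (card B)) * ?d P) / (of_int \<lfloor>c * ?d P\<rfloor> + 1 - c * ?d P)"
  obtain e where e: "e \<ge> 1" "p ^ e > (\<Sum>P\<in>StAss I. nat \<lceil>?N P\<rceil>) + nat \<lceil>real s0 / c\<rceil>"
    using pe_unbounded by blast
  define q where "q = p ^ e"
  define n where "n = nat \<lceil>c * real q\<rceil>"
  define s where "s = n + card B"
  have q: "q \<ge> 1" using p_pos by (simp add: q_def Suc_leI)
  have n_ge: "c * real q \<le> real n" unfolding n_def by (rule real_nat_ceiling_ge)
  have n_le: "real n \<le> c * real q + 1"
    unfolding n_def using c by (simp add: of_nat_nat ceiling_le_iff)
  have "s \<ge> s0"
  proof -
    have "real s0 / c \<le> real (nat \<lceil>real s0 / c\<rceil>)" by (rule real_nat_ceiling_ge)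
    also have "\<dots> \<le> real q" using e(2) unfolding q_def by (simp only: of_nat_le_iff)
    finally have "real s0 \<le> c * real q" using c by (simp add: field_simps)
    then show ?thesis using n_ge unfolding s_def by linarith
  qed
  have "f ^ q * F ^ (q - 1) \<in> symbolic_power P (int (g P s))" if P: "P \<in> StAss I" for P
  proof -
    obtain d x where d: "symbolic_order P I = int d" "d > 0"
      and x: "x \<in> I" "I \<subseteq> sat_power P d" "x \<notin> sat_power P (d + 1)"
      by (rule symbolic_order_eq[OF S(1)[OF P] I S(2)[OF P]])
    let ?fl = "\<lfloor>c * real d\<rfloor>" and ?h = "int (height P)"
    obtain Y where Y: "finite Y" "Y \<subseteq> P" "P \<subseteq> sat P (idl Y)"
      by (rule generators_le_height[OF S(1)[OF P]])
    \<comment> \<open>x has order exactly d, so x^s, a member of the integral closure of I^s, lies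
      in no symbolic power beyond s d. This bounds the otherwise unknown exponent g.\<close>
    have "x ^ s \<in> ideal_power I (s * 1)"
      by (rule ideal_power_power[OF I(1)]) (simp only: ideal_power_1[OF I(1)] x)
    then have "x ^ s \<in> integral_closure (ideal_power I s)"
      using integral_closure_superset[OF ideal_power_ideal[OF I(1)]] by auto
    then have "x ^ s \<in> sat_power P (g P s)"
      using P unfolding dia[OF \<open>s \<ge> s0\<close>] by (auto simp: sat_power_symbolic[OF S(1)[OF P]])
    then have "g P s \<le> s * d"
      using x by (intro power_order_le[OF S(1)[OF P] Y _ x(3)]) auto
    then have "int (g P s) \<le> int (s * d)" by (simp only: of_nat_le_iff)
    also have "\<dots> \<le> int q * (?fl + 1) - ?h"
    proof -
      have delta: "of_int ?fl + 1 - c * real d > 0" using floor_correct[of "c * real d"] by linarith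
      have "?N P \<le> real (nat \<lceil>?N P\<rceil>)" by (rule real_nat_ceiling_ge)
      also have "\<dots> \<le> real (\<Sum>P\<in>StAss I. nat \<lceil>?N P\<rceil>)"
        unfolding of_nat_le_iff by (rule member_le_sum[OF P]) (use fin in auto)
      also have "\<dots> \<le> real q" using e(2) unfolding q_def by (simp only: of_nat_le_iff)
      finally have "real (height P) + (1 + real (card B)) * real d \<le> real q * (of_int ?fl + 1 - c * real d)"
        using delta by (simp add: d(1) pos_divide_le_eq)
      then have "(c * real q + 1 + real (card B)) * real d \<le> real q * (of_int ?fl + 1) - real (height P)"
        by (simp add: algebra_simps)
      moreover have "real s * real d \<le> (c * real q + 1 + real (card B)) * real d"
        using n_le by (intro mult_right_mono) (simp_all add: s_def)
      ultimately have "real_of_int (int (s * d)) \<le> real_of_int (int q * (?fl + 1) - ?h)" by simp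
      then show ?thesis by (simp only: of_int_le_iff)
    qed
    \<comment> \<open>Split to match f^q F^(q - 1): q times the exponent assumed for f, and q - 1
      times the height from F.\<close>
    also have "\<dots> = int q * (?fl + 1 - ?h) + int (q - 1) * ?h"
      using q by (simp add: of_nat_diff algebra_simps)
    finally have le: "int (g P s) \<le> int q * (?fl + 1 - ?h) + int (q - 1) * ?h" .
    have "f \<in> symbolic_power P (?fl + 1 - ?h)" using f[OF P] by (simp add: d(1))
    then have "f ^ q * F ^ (q - 1) \<in> symbolic_power P (int q * (?fl + 1 - ?h) + int (q - 1) * ?h)"
      using F(3)[OF P] by (intro symbolic_power_mult symbolic_power_power S(1)[OF P])
    then show ?thesis using symbolic_power_antimono[OF S(1)[OF P] le] by blast
  qed
  then have "f ^ q * F ^ (q - 1) \<in> integral_closure (ideal_power I s)"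
    unfolding dia[OF \<open>s \<ge> s0\<close>] by blast
  then have mem: "f ^ q * F ^ (q - 1) \<in> ideal_power I n"
    using integral_closure_power_subset[OF I B, of n] unfolding s_def by blast
  let ?L = "frobenius_root q (ideal_power I n)"
  have L: "is_ideal ?L" unfolding q_def by (rule frobenius_root_properties(1))
  have "F ^ (q - 1) * f ^ q \<in> frobenius_power q ?L"
    using mem frobenius_root_properties(2)[of "ideal_power I n" e] unfolding q_def
    by (auto simp: mult.commute)
  then have "F ^ (p ^ e - 1) \<in> frobenius_power (p ^ e) {x. x * f \<in> ?L}"
    using frobenius_power_colon[OF L] unfolding q_def by blast
  then have "{x. x * f \<in> ?L} = UNIV"
    by (rule squarefree_power_mem_frobenius_power[OF ideal_colon[OF L] F(1,2)])
  then have "1 * f \<in> ?L" by blast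
  then show ?thesis
    unfolding test_ideal_def p[symmetric] using e(1) by (auto simp: q_def n_def)
qed

lemma test_ideal_eq_Inter:
  fixes I :: "('n, 'k) mpoly set"
  assumes p: "p = CHAR('k)" and I: "is_ideal I" "I \<noteq> {0}" "I \<noteq> UNIV" and dia: "diamond I"
    and F: "F \<noteq> 0" "squarefree_monomial (lm F)"
      "\<And>P. P \<in> StAss I \<Longrightarrow> F \<in> symbolic_power P (int (height P))"
  shows "finite (StAss I)" "StAss I \<noteq> {}"
    "c > 0 \<Longrightarrow> test_ideal c I =
      (\<Inter>P\<in>StAss I. symbolic_power P (\<lfloor>c * real_of_int (symbolic_order P I)\<rfloor> + 1 - int (height P)))"
proof -
  note S = StAssD[OF I(1)]
  show fin: "finite (StAss I)"
    by (rule finite_compatible_primes[OF F(1,2)]) (use S(1) F(3) compatible_if_mem_symbolic_power in blast)+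
  obtain g s0 where dia': "\<And>s. s \<ge> s0 \<Longrightarrow>
      integral_closure (ideal_power I s) = (\<Inter>P\<in>StAss I. symbolic_power P (int (g P s)))"
    using dia unfolding diamond_def eventually_sequentially by blast
  show "StAss I \<noteq> {}"
  proof
    \<comment> \<open>An empty intersection is the whole ring, so 1 would be integral over a power
      of I.\<close>
    assume "StAss I = {}"
    then have "1 \<in> integral_closure (ideal_power I (Suc s0))" using dia'[of "Suc s0"] by simp
    then have "ideal_power I (Suc s0) = UNIV"
      by (rule integral_closure_proper[OF ideal_power_ideal[OF I(1)]])
    moreover have "ideal_power I (Suc s0) \<subseteq> ideal_power I 1"
      by (rule ideal_power_antimono[OF I(1)]) simp
    ultimately show False using I(3) unfolding ideal_power_1[OF I(1)] by blast
  qed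
  show "test_ideal c I =
      (\<Inter>P\<in>StAss I. symbolic_power P (\<lfloor>c * real_of_int (symbolic_order P I)\<rfloor> + 1 - int (height P)))"
    if c: "c > 0"
  proof (intro equalityI INT_greatest)
    show "test_ideal c I \<subseteq> symbolic_power P (\<lfloor>c * real_of_int (symbolic_order P I)\<rfloor> + 1 - int (height P))"
      if "P \<in> StAss I" for P
      by (rule test_ideal_subset_symbolic_power[OF p S(1)[OF that] I(1,2) S(2)[OF that] c])
    show "(\<Inter>P\<in>StAss I. symbolic_power P (\<lfloor>c * real_of_int (symbolic_order P I)\<rfloor> + 1 - int (height P)))
        \<subseteq> test_ideal c I"
      using mem_test_ideal[OF p I(1,2) c dia' F fin] by blast
  qed
qed

text \<open>The test ideal is proper iff some exponent in the intersection is positive. Heights are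
  integers, so the floor drops out and the condition is c e_P(I) \<ge> height P for some P;
  finiteness of StAss(I) makes the least such c attained.\<close>

lemma fpt_eq:
  fixes I :: "('n, 'k) mpoly set"
  assumes I: "is_ideal I" "I \<noteq> {0}" and fin: "finite (StAss I)" "StAss I \<noteq> {}"
    and test: "\<And>c. c > 0 \<Longrightarrow> test_ideal c I =
      (\<Inter>P\<in>StAss I. symbolic_power P (\<lfloor>c * real_of_int (symbolic_order P I)\<rfloor> + 1 - int (height P)))"
  shows "fpt I = (MIN P\<in>StAss I. real (height P) / real_of_int (symbolic_order P I))"
proof -
  note S = StAssD[OF I(1)]
  let ?r = "\<lambda>P. real (height P) / real_of_int (symbolic_order P I)"
  let ?m = "MIN P\<in>StAss I. ?r P"
  have ord: "real_of_int (symbolic_order P I) > 0" if P: "P \<in> StAss I" for P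
  proof -
    obtain d where "symbolic_order P I = int d" "d > 0"
      by (rule symbolic_order_eq[OF S(1)[OF P] I S(2)[OF P]])
    then show ?thesis by simp
  qed
  have h: "height P > 0" if P: "P \<in> StAss I" for P
    using S(2)[OF P] I ideal_zero[OF I(1)] by (intro height_pos[OF S(1)[OF P]]) blast
  have fin': "finite (?r ` StAss I)" "?r ` StAss I \<noteq> {}" using fin by auto
  have proper: "test_ideal c I \<noteq> UNIV \<longleftrightarrow> (\<exists>P\<in>StAss I. ?r P \<le> c)" if c: "c > 0" for c
  proof
    assume "test_ideal c I \<noteq> UNIV"
    then obtain P where P: "P \<in> StAss I"
      "symbolic_power P (\<lfloor>c * real_of_int (symbolic_order P I)\<rfloor> + 1 - int (height P)) \<noteq> UNIV"
      unfolding test[OF c] by auto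
    then have "int (height P) \<le> \<lfloor>c * real_of_int (symbolic_order P I)\<rfloor>"
      using symbolic_power_nonpos[of _ P] by (metis add_diff_cancel_right' diff_ge_0_iff_ge
          linorder_not_le zle_diff1_eq diff_add_eq diff_add_cancel le_diff_eq add_le_same_cancel2)
    then have "real (height P) \<le> c * real_of_int (symbolic_order P I)" by (simp add: le_floor_iff)
    then show "\<exists>P\<in>StAss I. ?r P \<le> c"
      using ord[OF P(1)] P(1) by (intro bexI[of _ P]) (simp_all add: pos_divide_le_eq)
  next
    assume "\<exists>P\<in>StAss I. ?r P \<le> c"
    then obtain P where P: "P \<in> StAss I" "?r P \<le> c" by blast
    then have "real (height P) \<le> c * real_of_int (symbolic_order P I)"
      using ord[OF P(1)] by (simp add: pos_divide_le_eq)
    then have "int (height P) \<le> \<lfloor>c * real_of_int (symbolic_order P I)\<rfloor>" by (simp add: le_floor_iff)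
    then have "1 \<notin> symbolic_power P (\<lfloor>c * real_of_int (symbolic_order P I)\<rfloor> + 1 - int (height P))"
      by (intro symbolic_power_proper[OF S(1)[OF P(1)]]) simp
    then show "test_ideal c I \<noteq> UNIV" unfolding test[OF c] using P(1) by blast
  qed
  have m_in: "?m \<in> ?r ` StAss I" by (rule Min_in[OF fin'])
  then have m_pos: "?m > 0" using ord h by auto
  show ?thesis
    unfolding fpt_def
  proof (rule Least_equality)
    show "0 < ?m \<and> test_ideal ?m I \<noteq> UNIV"
      using m_pos m_in proper[OF m_pos] by auto
    fix c assume "0 < c \<and> test_ideal c I \<noteq> UNIV"
    then obtain P where "P \<in> StAss I" "?r P \<le> c" using proper[of c] by blast
    moreover from this have "?m \<le> ?r P" by (intro Min_le[OF fin'(1)]) simp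
    ultimately show "?m \<le> c" by simp
  qed
qed

end

theorem theorem3p14:
  fixes I :: "('n::{finite,linorder}, 'k::field) mpoly set"
  assumes "CHAR('k) > 0"
    and "is_ideal I" and "I \<noteq> {0}" and "I \<noteq> UNIV"
    and "diamond_plus I"
  shows "floating_test_ideals I \<and>
    (\<forall>c>0. test_ideal c I =
      (\<Inter>P\<in>StAss I.
        symbolic_power P (\<lfloor>c * real_of_int (symbolic_order P I)\<rfloor> + 1 - int (height P)))) \<and>
    fpt I = (MIN P\<in>StAss I. real (height P) / real_of_int (symbolic_order P I))"
proof -
  obtain r F where dia: "diamond I" and r: "term_order r"
    and F: "F \<noteq> 0" "squarefree_monomial (initial_monomial r F)"
      "\<And>P. P \<in> StAss I \<Longrightarrow> F \<in> symbolic_power P (int (height P))"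
    using assms(5) unfolding diamond_plus_def by blast
  obtain coords :: "nat \<Rightarrow> (('n, 'k) mpoly \<Rightarrow> ('n, 'k) mpoly) set"
    where "mpoly_frobenius CHAR('k) coords" by (rule mpoly_frobenius_exists[OF assms(1)])
  then interpret mpoly_frobenius_order "CHAR('k)" coords r
    using r by (simp add: mpoly_frobenius_order_def monomial_order_def)
  note aux = test_ideal_eq_Inter[OF refl assms(2-4) dia F(1,2)]
  have fin: "finite (StAss I)" by (rule aux(1)) (rule F(3))
  have nonempty: "StAss I \<noteq> {}" by (rule aux(2)) (rule F(3))
  have test: "test_ideal c I = (\<Inter>P\<in>StAss I.
      symbolic_power P (\<lfloor>c * real_of_int (symbolic_order P I)\<rfloor> + 1 - int (height P)))" if "c > 0" for c
    by (rule aux(3)[OF _ that]) (rule F(3))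
  have "floating_test_ideals I"
    unfolding floating_test_ideals_def
  proof (intro allI impI equalityI INT_greatest)
    fix c :: real and P assume "c > 0" "P \<in> {P \<in> Spec. I \<subseteq> P}"
    then show "test_ideal c I \<subseteq>
        symbolic_power P (\<lfloor>c * real_of_int (symbolic_order P I)\<rfloor> + 1 - int (height P))"
      by (intro test_ideal_subset_symbolic_power[OF refl _ assms(2,3)]) auto
  next
    fix c :: real assume "c > 0"
    \<comment> \<open>Intersecting over all primes above I can only give a smaller ideal than
      intersecting over these.\<close>
    have "StAss I \<subseteq> {P \<in> Spec. I \<subseteq> P}" using StAssD[OF assms(2)] by blast
    then show "(\<Inter>P\<in>{P \<in> Spec. I \<subseteq> P}.
        symbolic_power P (\<lfloor>c * real_of_int (symbolic_order P I)\<rfloor> + 1 - int (height P))) \<subseteq> test_ideal c I"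
      unfolding test[OF \<open>c > 0\<close>] by (intro INT_anti_mono order_refl)
  qed
  moreover have "fpt I = (MIN P\<in>StAss I. real (height P) / real_of_int (symbolic_order P I))"
    by (rule fpt_eq[OF assms(2,3) fin nonempty test])
  ultimately show ?thesis using test by blast
qed

end
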